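(* Let $\alpha,\theta$ be inner functions. If $\varphi$ is an invertible element of $L^\infty$, then the map $$\mathcal N_{DA}\colon\ker D_\varphi^{\theta,\alpha}\to\ker A_{\varphi^{-1}}^{\alpha,\theta},\qquad \mathcal N_{DA}(f_-+\theta\tilde f_+)=\varphi(f_-+\theta\tilde f_+),\quad f_-\in H^2_-,\ \tilde f_+\in H^2,$$ is an isomorphism, and $$\ker D_\varphi^{\theta,\alpha}=\varphi^{-1}\ker A_{\varphi^{-1}}^{\alpha,\theta}.$$
   Context: $L^2=L^2(\mathbb T)$, $L^\infty=L^\infty(\mathbb T)$, $\mathbb T$ the unit circle; $H^2$ is the Hardy space of the unit disk viewed as a subspace of $L^2$, and $H^2_-=\bar z\,\overline{H^2}=L^2\ominus H^2$. For an inner function $\theta$, $K_\theta=H^2\ominus\theta H^2$, $(K_\theta)^\perp=L^2\ominus K_\theta=H^2_-\oplus\theta H^2$, and $P_\theta$, $Q_\theta=I-P_\theta$ are the orthogonal projections of $L^2$ onto $K_\theta$ and $(K_\theta)^\perp$. For $\psi\in L^\infty$ and inner $\alpha,\theta$: $D_\psi^{\theta,\alpha}\colon (K_\theta)^\perp\to(K_\alpha)^\perp$ is $D_\psi^{\theta,\alpha}f=Q_\alpha(\psi f)$, and $A_\psi^{\alpha,\theta}\colon K_\alpha\to K_\theta$ is $A_\psi^{\alpha,\theta}f=P_\theta(\psi f)$. *)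

theory Defs
  imports "HOL-Analysis.Analysis"
begin

section \<open>Functions on the unit circle modulo null sets\<close>

text \<open>Normalized arc length on the unit circle.\<close>

definition circle :: "complex measure" where
  "circle = distr (uniform_measure lborel {0..2 * pi}) (restrict_space borel (sphere 0 1)) cis"

lemma measurable_cis_circle:
  "cis \<in> uniform_measure lborel {0..2 * pi} \<rightarrow>\<^sub>M restrict_space borel (sphere 0 1)"
proof (rule measurable_restrict_space2)
  have "cis \<in> borel_measurable (borel :: real measure)"
    by (intro borel_measurable_continuous_onI continuous_intros)
  then show "cis \<in> uniform_measure lborel {0..2 * pi} \<rightarrow>\<^sub>M borel"
    by (simp cong: measurable_cong_sets)
qed simp

lemma emeasure_space_circle: "emeasure circle (space circle) = 1"
proof -
  have "cis -` sphere 0 1 = UNIV"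
    by auto
  then show ?thesis
    unfolding circle_def space_distr
    by (subst emeasure_distr[OF measurable_cis_circle sets.top])
       (simp add: space_restrict_space divide_ennreal)
qed

lemma borel_measurable_cnj [measurable (raw)]:
  fixes f :: "'a \<Rightarrow> complex"
  assumes "f \<in> borel_measurable M"
  shows "(\<lambda>x. cnj (f x)) \<in> borel_measurable M"
  using assms by (rule borel_measurable_continuous_on[rotated]) (intro continuous_intros)

definition ae_eq :: "(complex \<Rightarrow> complex) \<Rightarrow> (complex \<Rightarrow> complex) \<Rightarrow> bool" where
  "ae_eq f g \<longleftrightarrow> f \<in> borel_measurable circle \<and> g \<in> borel_measurable circle \<and>
     (AE \<zeta> in circle. f \<zeta> = g \<zeta>)"

text \<open>The ring of measurable complex functions on the circle modulo almost everywhere equality.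
  The spaces \<open>L\<^sup>2\<close>, \<open>L\<^sup>\<infinity>\<close>, \<open>H\<^sup>2\<close> below are subsets of it.\<close>

quotient_type circle_fun = "complex \<Rightarrow> complex" / partial: ae_eq
proof (rule part_equivpI)
  show "\<exists>f. ae_eq f f"
    by (rule exI[of _ "\<lambda>_. 0"]) (simp add: ae_eq_def)
  show "symp ae_eq"
    by (auto simp: symp_def ae_eq_def)
  show "transp ae_eq"
    by (auto simp: transp_def ae_eq_def)
qed

instantiation circle_fun :: comm_ring_1
begin

lift_definition zero_circle_fun :: circle_fun is "\<lambda>_. 0"
  by (simp add: ae_eq_def)

lift_definition one_circle_fun :: circle_fun is "\<lambda>_. 1"
  by (simp add: ae_eq_def)

lift_definition plus_circle_fun :: "circle_fun \<Rightarrow> circle_fun \<Rightarrow> circle_fun"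
  is "\<lambda>f g \<zeta>. f \<zeta> + g \<zeta>"
  by (auto simp: ae_eq_def)

lift_definition minus_circle_fun :: "circle_fun \<Rightarrow> circle_fun \<Rightarrow> circle_fun"
  is "\<lambda>f g \<zeta>. f \<zeta> - g \<zeta>"
  by (auto simp: ae_eq_def)

lift_definition uminus_circle_fun :: "circle_fun \<Rightarrow> circle_fun"
  is "\<lambda>f \<zeta>. - f \<zeta>"
  by (auto simp: ae_eq_def)

lift_definition times_circle_fun :: "circle_fun \<Rightarrow> circle_fun \<Rightarrow> circle_fun"
  is "\<lambda>f g \<zeta>. f \<zeta> * g \<zeta>"
  by (auto simp: ae_eq_def)

instance
proof
  have "\<not> (AE \<zeta> in circle. (0::complex) = 1)"
  proof
    assume "AE \<zeta> in circle. (0::complex) = 1"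
    then have "emeasure circle (space circle) = 0"
      by (simp add: AE_iff_measurable[OF sets.top])
    then show False
      by (simp add: emeasure_space_circle)
  qed
  then show "(0::circle_fun) \<noteq> 1"
    by transfer (auto simp: ae_eq_def)
qed (transfer, auto simp: ae_eq_def algebra_simps)+

end

lift_definition const_cf :: "complex \<Rightarrow> circle_fun" is "\<lambda>c _. c"
  by (simp add: ae_eq_def)

lift_definition coord_cf :: circle_fun is "\<lambda>\<zeta>. \<zeta>"
  by (auto simp: ae_eq_def circle_def intro: measurable_restrict_space1)

lift_definition cnj_cf :: "circle_fun \<Rightarrow> circle_fun" is "\<lambda>f \<zeta>. cnj (f \<zeta>)"
  by (auto simp: ae_eq_def borel_measurable_cnj)

lift_definition unimodular :: "circle_fun \<Rightarrow> bool" is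
  "\<lambda>f. AE \<zeta> in circle. cmod (f \<zeta>) = 1"
  by (auto simp: ae_eq_def elim: AE_mp)


section \<open>\<open>L\<^sup>2\<close> and \<open>L\<^sup>\<infinity>\<close>\<close>

lift_definition in_L2 :: "circle_fun \<Rightarrow> bool" is
  "\<lambda>f. integrable circle (\<lambda>\<zeta>. (cmod (f \<zeta>))\<^sup>2)"
  by (rule integrable_cong_AE) (auto simp: ae_eq_def)

definition L2 :: "circle_fun set" where
  "L2 = {f. in_L2 f}"

lift_definition L2_inner :: "circle_fun \<Rightarrow> circle_fun \<Rightarrow> complex" is
  "\<lambda>f g. \<integral>\<zeta>. f \<zeta> * cnj (g \<zeta>) \<partial>circle"
  by (rule integral_cong_AE)
     (auto simp: ae_eq_def intro!: borel_measurable_times borel_measurable_cnj)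

definition L2_norm :: "circle_fun \<Rightarrow> real" where
  "L2_norm f = sqrt (Re (L2_inner f f))"

lift_definition in_Linf :: "circle_fun \<Rightarrow> bool" is
  "\<lambda>f. \<exists>C. AE \<zeta> in circle. cmod (f \<zeta>) \<le> C"
  by (force simp: ae_eq_def elim: AE_mp)

definition Linf :: "circle_fun set" where
  "Linf = {f. in_Linf f}"

definition invertible_Linf :: "circle_fun \<Rightarrow> bool" where
  "invertible_Linf \<phi> \<longleftrightarrow> \<phi> \<in> Linf \<and> (\<exists>\<psi>\<in>Linf. \<phi> * \<psi> = 1)"

definition inverse_Linf :: "circle_fun \<Rightarrow> circle_fun" where
  "inverse_Linf \<phi> = (THE \<psi>. \<psi> \<in> Linf \<and> \<phi> * \<psi> = 1)"

definition orth_diff :: "circle_fun set \<Rightarrow> circle_fun set \<Rightarrow> circle_fun set" (infixl "\<ominus>" 65) where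
  "V \<ominus> W = {f \<in> V. \<forall>g\<in>W. L2_inner f g = 0}"

text \<open>Orthogonal projection onto \<open>V\<close>, meaningful on \<open>L\<^sup>2\<close> for a closed subspace \<open>V\<close>.\<close>

definition orth_proj :: "circle_fun set \<Rightarrow> circle_fun \<Rightarrow> circle_fun" where
  "orth_proj V f = (THE g. g \<in> V \<and> f - g \<in> L2 \<ominus> V)"


section \<open>Hardy space, inner functions, model spaces\<close>

definition hardy_disk :: "(complex \<Rightarrow> complex) set" where
  "hardy_disk = {F. F holomorphic_on ball 0 1 \<and>
     (\<exists>C. \<forall>r\<in>{0..<1}. (\<integral>\<zeta>. (cmod (F (complex_of_real r * \<zeta>)))\<^sup>2 \<partial>circle) \<le> C)}"

text \<open>\<open>f\<close> is the boundary function of \<open>F\<close>: radial limits almost everywhere.\<close>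

lift_definition boundary_fun :: "(complex \<Rightarrow> complex) \<Rightarrow> circle_fun \<Rightarrow> bool" is
  "\<lambda>F f. AE \<zeta> in circle. ((\<lambda>r. F (complex_of_real r * \<zeta>)) \<longlongrightarrow> f \<zeta>) (at_left 1)"
  by (auto simp: ae_eq_def elim: AE_mp)

definition H2 :: "circle_fun set" where
  "H2 = {f \<in> L2. \<exists>F\<in>hardy_disk. boundary_fun F f}"

definition H2_minus :: "circle_fun set" where
  "H2_minus = (\<lambda>f. cnj_cf coord_cf * cnj_cf f) ` H2"

text \<open>An inner function is identified with its boundary function.\<close>

definition inner_function :: "circle_fun \<Rightarrow> bool" where
  "inner_function \<theta> \<longleftrightarrow> unimodular \<theta> \<and>
     (\<exists>F. F holomorphic_on ball 0 1 \<and> bounded (F ` ball 0 1) \<and> boundary_fun F \<theta>)"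

definition model_space :: "circle_fun \<Rightarrow> circle_fun set" where
  "model_space \<theta> = H2 \<ominus> (\<lambda>f. \<theta> * f) ` H2"

definition model_perp :: "circle_fun \<Rightarrow> circle_fun set" where
  "model_perp \<theta> = L2 \<ominus> model_space \<theta>"

definition P_proj :: "circle_fun \<Rightarrow> circle_fun \<Rightarrow> circle_fun" where
  "P_proj \<theta> = orth_proj (model_space \<theta>)"

definition Q_proj :: "circle_fun \<Rightarrow> circle_fun \<Rightarrow> circle_fun" where
  "Q_proj \<theta> f = f - P_proj \<theta> f"


section \<open>Operators, kernels, isomorphisms\<close>

text \<open>An operator on a subspace is a function that is \<open>undefined\<close> off its domain.\<close>

definition dual_truncated_toeplitz ::
    "circle_fun \<Rightarrow> circle_fun \<Rightarrow> circle_fun \<Rightarrow> circle_fun \<Rightarrow> circle_fun" where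
  "dual_truncated_toeplitz \<theta> \<alpha> \<psi> = (\<lambda>f\<in>model_perp \<theta>. Q_proj \<alpha> (\<psi> * f))"

definition truncated_toeplitz ::
    "circle_fun \<Rightarrow> circle_fun \<Rightarrow> circle_fun \<Rightarrow> circle_fun \<Rightarrow> circle_fun" where
  "truncated_toeplitz \<alpha> \<theta> \<psi> = (\<lambda>f\<in>model_space \<alpha>. P_proj \<theta> (\<psi> * f))"

definition ker_D :: "circle_fun \<Rightarrow> circle_fun \<Rightarrow> circle_fun \<Rightarrow> circle_fun set" where
  "ker_D \<theta> \<alpha> \<psi> = {f \<in> model_perp \<theta>. dual_truncated_toeplitz \<theta> \<alpha> \<psi> f = 0}"

definition ker_A :: "circle_fun \<Rightarrow> circle_fun \<Rightarrow> circle_fun \<Rightarrow> circle_fun set" where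
  "ker_A \<alpha> \<theta> \<psi> = {f \<in> model_space \<alpha>. truncated_toeplitz \<alpha> \<theta> \<psi> f = 0}"

text \<open>The value at \<open>u\<close> is read off a decomposition \<open>u = f + \<theta> g\<close> with
  \<open>f \<in> H\<^sup>2\<^sub>-\<close> and \<open>g \<in> H\<^sup>2\<close>; that every \<open>u\<close> in the domain has one is not built in.\<close>

definition N_DA ::
    "circle_fun \<Rightarrow> circle_fun \<Rightarrow> circle_fun \<Rightarrow> circle_fun \<Rightarrow> circle_fun" where
  "N_DA \<theta> \<alpha> \<phi> = (\<lambda>u\<in>ker_D \<theta> \<alpha> \<phi>.
     THE v. \<exists>f\<in>H2_minus. \<exists>g\<in>H2. u = f + \<theta> * g \<and> v = \<phi> * (f + \<theta> * g))"

text \<open>Isomorphism of normed spaces: a complex linear bijection, bounded in both directions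
  for the \<open>L\<^sup>2\<close> norm.\<close>

definition L2_isomorphism ::
    "circle_fun set \<Rightarrow> circle_fun set \<Rightarrow> (circle_fun \<Rightarrow> circle_fun) \<Rightarrow> bool" where
  "L2_isomorphism V W T \<longleftrightarrow>
     (\<forall>f\<in>V. \<forall>g\<in>V. T (f + g) = T f + T g) \<and>
     (\<forall>c. \<forall>f\<in>V. T (const_cf c * f) = const_cf c * T f) \<and>
     bij_betw T V W \<and>
     (\<exists>C. \<forall>f\<in>V. L2_norm (T f) \<le> C * L2_norm f) \<and>
     (\<exists>C. \<forall>f\<in>V. L2_norm f \<le> C * L2_norm (T f))"

end

theory Submission
  imports Defs "HOL-Complex_Analysis.Cauchy_Integral_Formula"
begin

text \<open>
  An element \<open>f\<close> of \<open>(K\<^sub>\<theta>)\<^sup>\<bottom>\<close> lies in the kernel of the dual operator iff \<open>\<phi> f\<close> lies in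
  \<open>K\<^sub>\<alpha>\<close>, and an element \<open>g\<close> of \<open>K\<^sub>\<alpha>\<close> lies in the kernel of the other operator iff \<open>\<phi>\<^sup>-\<^sup>1 g\<close> lies in
  \<open>(K\<^sub>\<theta>)\<^sup>\<bottom>\<close>. So multiplication by \<open>\<phi>\<close> and by its inverse are mutually inverse maps between the two
  kernels, and they are bounded because both multipliers are in \<open>L\<^sup>\<infinity>\<close>. What this argument rests on is
  that the orthogonal projections onto model spaces exist (\<open>P_proj_props\<close>) and that every element of
  \<open>(K\<^sub>\<theta>)\<^sup>\<bottom>\<close> has the form \<open>f + \<theta> g\<close> with \<open>f\<close> in \<open>H\<^sup>2\<^sub>-\<close> and \<open>g\<close> in \<open>H\<^sup>2\<close>
  (\<open>model_perp_decomposition\<close>).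
  Both follow from the orthogonal decomposition of \<open>L\<^sup>2\<close> into \<open>H\<^sup>2\<close> and \<open>H\<^sup>2\<^sub>-\<close>, applied first to a
  function and then to its analytic part divided by \<open>\<theta>\<close> (\<open>model_decomposition\<close>).

  Since \<open>H\<^sup>2\<close> consists of the radial boundary values of functions on the disk, that decomposition is
  a theorem of Fatou type. Orthogonality (\<open>hardy_boundary_orthogonal\<close>) holds because the dilates of a
  Hardy function are bounded in \<open>L\<^sup>2\<close> and converge almost everywhere, hence converge weakly to
  the boundary function, so that its negative Fourier coefficients vanish. For the existence of the
  two parts (\<open>hardy_decomposition\<close>), the Fourier coefficients of a function in \<open>L\<^sup>2\<close> give two power
  series with square summable coefficients; such a series has radial limits almost
  everywhere (\<open>ae_radial_limit\<close>), the limits have the prescribed coefficients, and an integrable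
  function is determined by its coefficients (\<open>fourier_uniqueness\<close>, from Stone--Weierstrass).

  The radial limits come from a maximal inequality: the \<open>L\<^sup>2\<close> norm of the maximum of the Poisson
  integrals \<open>P\<^sub>r f\<close> over finitely many \<open>r\<close> is at most 16 times that of \<open>f\<close>, for any choice of the radii
  (\<open>poisson_maximal_inequality\<close>). The tail of a power
  series is then uniformly small along most radii, while its partial sums are continuous. The maximal
  inequality is proved by estimating an operator through its product with its adjoint. Choosing at
  each point a radius that attains the maximum turns the maximal function into a linear operator
  \<open>T\<close>, and the kernel of \<open>T T\<^sup>*\<close> is built from \<open>P\<^sub>r P\<^sub>s = P\<^sub>r\<^sub>s \<le> 8 (P\<^sub>r + P\<^sub>s)\<close>. Hence the norm \<open>A\<close> of the
  maximal operator satisfies \<open>A\<^sup>2 \<le> 16 A\<close>.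
\<close>

section \<open>Integration on the circle\<close>

lemma space_circle [simp]: "space circle = sphere 0 1"
  by (simp add: circle_def space_restrict_space)

lemma sets_circle: "sets circle = sets (restrict_space borel (sphere 0 1))"
  by (simp add: circle_def)

interpretation circle: finite_measure circle
  by standard (simp add: emeasure_space_circle del: space_circle)

interpretation circle2: pair_sigma_finite circle circle ..

lemma measure_circle [simp]: "measure circle (sphere 0 1) = 1"
  using emeasure_space_circle by (simp add: measure_def)

lemma borel_measurable_circle_id [measurable]: "(\<lambda>z. z) \<in> borel_measurable circle"
  by (auto simp: circle_def intro: measurable_restrict_space1)

lemma integral_circle_const [simp]: "(\<integral>z. c \<partial>circle) = (c :: 'a :: {banach, second_countable_topology})"
  by simp

lemma integrable_circle_bounded:
  fixes f :: "complex \<Rightarrow> 'a :: {banach, second_countable_topology}"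
  assumes "f \<in> borel_measurable circle" and "\<And>z. cmod z = 1 \<Longrightarrow> norm (f z) \<le> B"
  shows "integrable circle f"
  using assms by (intro circle.integrable_const_bound[of _ B]) auto

lemma cnj_eq_inverse_circle: "cmod z = 1 \<Longrightarrow> z * cnj z = 1"
  by (simp add: complex_norm_square[symmetric])

lemma integral_circle_eq:
  fixes f :: "complex \<Rightarrow> complex"
  assumes [measurable]: "f \<in> borel_measurable borel"
  shows "(\<integral>z. f z \<partial>circle) = (\<integral>t. indicator {0..2 * pi} t *\<^sub>R f (cis t) \<partial>lborel) / (2 * pi)"
proof -
  have cm[measurable]: "cis \<in> borel_measurable borel"
    by (intro borel_measurable_continuous_onI continuous_intros)
  have "(\<integral>z. f z \<partial>circle) = (\<integral>t. f (cis t) \<partial>uniform_measure lborel {0..2 * pi})"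
    unfolding circle_def
    by (rule integral_distr[OF measurable_cis_circle]) (rule measurable_restrict_space1, measurable)
  also have "\<dots> = (\<integral>t. f (cis t) \<partial>density lborel (\<lambda>t. ennreal (indicator {0..2 * pi} t / (2 * pi))))"
    unfolding uniform_measure_def
  proof (intro arg_cong2[where f = "integral\<^sup>L"] arg_cong2[where f = density] refl ext)
    fix t :: real
    have "1 / ennreal (2 * pi) = ennreal (1 / (2 * pi))"
      using divide_ennreal[of 1 "2 * pi"] by simp
    then show "indicator {0..2 * pi} t / emeasure lborel {0..2 * pi} = ennreal (indicator {0..2 * pi} t / (2 * pi))"
      by (cases "t \<in> {0..2 * pi}") auto
  qed
  also have "\<dots> = (\<integral>t. (indicator {0..2 * pi} t / (2 * pi)) *\<^sub>R f (cis t) \<partial>lborel)"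
    by (subst integral_density) (auto intro!: divide_nonneg_nonneg)
  also have "\<dots> = (\<integral>t. (indicator {0..2 * pi} t *\<^sub>R f (cis t)) / (2 * pi) \<partial>lborel)"
    by (intro Bochner_Integration.integral_cong) (auto simp: scaleR_conv_of_real)
  also have "\<dots> = (\<integral>t. indicator {0..2 * pi} t *\<^sub>R f (cis t) \<partial>lborel) / (2 * pi)"
    by (subst integral_divide_zero) simp
  finally show ?thesis .
qed

lemma integral_circle_power:
  "(\<integral>z. z ^ n \<partial>circle) = (if n = 0 then 1 else 0)"
proof (cases "n = 0")
  case False
  have D: "((\<lambda>t. cis (real n * t) / (\<i> * n)) has_vector_derivative cis t ^ n) (at t within {0..2*pi})"
    for t :: real
  proof -
    have "((\<lambda>x. exp (\<i> * n * x) / (\<i> * n)) has_field_derivative exp (\<i> * n * of_real t)) (at (of_real t))"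
      using False by (auto intro!: derivative_eq_intros)
    from has_vector_derivative_real_field[OF this, of "{0..2*pi}"]
    show ?thesis
      by (simp add: cis_conv_exp mult.assoc mult.left_commute exp_of_nat_mult flip: exp_of_nat_mult)
  qed
  have "(\<integral>t. indicator {0..2 * pi} t *\<^sub>R (cis t ^ n) \<partial>lborel)
      = cis (real n * (2 * pi)) / (\<i> * n) - cis (real n * 0) / (\<i> * n)"
  proof (rule integral_FTC_atLeastAtMost[OF _ D])
    show "continuous_on {0..2 * pi} (\<lambda>t. cis t ^ n)"
      by (intro continuous_intros)
  qed simp
  also have "\<dots> = 0"
    using cis_multiple_2pi[of n] by (simp add: mult.commute mult.left_commute)
  finally show ?thesis
    using False by (subst integral_circle_eq) auto
next
  case True
  then show ?thesis
    by (simp only: power_0 integral_circle_const simp_thms if_True)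
qed

lemma integral_circle_moment:
  "(\<integral>z. z ^ m * cnj z ^ n \<partial>circle) = (if m = n then 1 else 0)"
proof -
  have *: "(\<integral>z. z ^ (n + k) * cnj z ^ n \<partial>circle) = (if k = 0 then 1 else 0)" for n k
  proof -
    have "(\<integral>z. z ^ (n + k) * cnj z ^ n \<partial>circle) = (\<integral>z. z ^ k \<partial>circle)"
    proof (intro Bochner_Integration.integral_cong refl)
      fix z assume "z \<in> space circle"
      then have "z ^ n * cnj z ^ n = 1"
        by (simp add: cnj_eq_inverse_circle flip: power_mult_distrib)
      then show "z ^ (n + k) * cnj z ^ n = z ^ k"
        by (simp add: power_add algebra_simps)
    qed
    then show ?thesis by (simp add: integral_circle_power)
  qed
  show ?thesis
  proof (cases "n \<le> m")
    case True
    then show ?thesis using *[of n "m - n"] by auto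
  next
    case False
    have "(\<integral>z. z ^ m * cnj z ^ n \<partial>circle) = (\<integral>z. cnj (z ^ n * cnj z ^ m) \<partial>circle)"
      by (simp add: mult.commute)
    also have "\<dots> = cnj (\<integral>z. z ^ n * cnj z ^ m \<partial>circle)"
      by (rule Bochner_Integration.integral_cnj)
    finally show ?thesis using *[of m "n - m"] False by auto
  qed
qed

definition sq_integrable :: "(complex \<Rightarrow> complex) \<Rightarrow> bool" where
  "sq_integrable f \<longleftrightarrow> f \<in> borel_measurable circle \<and> integrable circle (\<lambda>z. (cmod (f z))\<^sup>2)"

lemma sq_integrableD [measurable_dest]: "sq_integrable f \<Longrightarrow> f \<in> borel_measurable circle"
  by (simp add: sq_integrable_def)

lemma cmod_add_power2_le: "(cmod (a + b))\<^sup>2 \<le> 2 * (cmod a)\<^sup>2 + 2 * (cmod b)\<^sup>2"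
proof -
  have "(cmod (a + b))\<^sup>2 \<le> (cmod a + cmod b)\<^sup>2"
    by (intro power_mono norm_triangle_ineq) auto
  also have "\<dots> \<le> 2 * (cmod a)\<^sup>2 + 2 * (cmod b)\<^sup>2"
    using sum_squares_bound[of "cmod a" "cmod b"] by (simp add: power2_sum)
  finally show ?thesis .
qed

lemma sq_integrable_add:
  assumes "sq_integrable f" "sq_integrable g"
  shows "sq_integrable (\<lambda>z. f z + g z)"
proof -
  have [measurable]: "f \<in> borel_measurable circle" "g \<in> borel_measurable circle"
    using assms by (auto simp: sq_integrable_def)
  have "integrable circle (\<lambda>z. (cmod (f z + g z))\<^sup>2)"
  proof (rule Bochner_Integration.integrable_bound)
    show "integrable circle (\<lambda>z. 2 * (cmod (f z))\<^sup>2 + 2 * (cmod (g z))\<^sup>2)"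
      using assms by (auto simp: sq_integrable_def)
    show "AE z in circle. norm ((cmod (f z + g z))\<^sup>2)
        \<le> norm (2 * (cmod (f z))\<^sup>2 + 2 * (cmod (g z))\<^sup>2)"
      using cmod_add_power2_le by auto
  qed measurable
  then show ?thesis by (simp add: sq_integrable_def)
qed

lemma sq_integrable_mult_bounded:
  assumes "sq_integrable f" and [measurable]: "g \<in> borel_measurable circle"
    and B: "AE z in circle. cmod (g z) \<le> B"
  shows "sq_integrable (\<lambda>z. g z * f z)"
proof -
  have [measurable]: "f \<in> borel_measurable circle"
    using assms by (auto simp: sq_integrable_def)
  have "integrable circle (\<lambda>z. (cmod (g z * f z))\<^sup>2)"
  proof (rule Bochner_Integration.integrable_bound)
    show "integrable circle (\<lambda>z. B\<^sup>2 * (cmod (f z))\<^sup>2)"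
      using assms by (auto simp: sq_integrable_def)
    show "AE z in circle. norm ((cmod (g z * f z))\<^sup>2) \<le> norm (B\<^sup>2 * (cmod (f z))\<^sup>2)"
      using B
    proof eventually_elim
      case (elim z)
      then have "(cmod (g z))\<^sup>2 \<le> B\<^sup>2"
        by (intro power_mono) auto
      then show ?case
        by (simp add: norm_mult power_mult_distrib mult_right_mono)
    qed
  qed measurable
  then show ?thesis by (simp add: sq_integrable_def)
qed

lemma sq_integrable_cnj: "sq_integrable f \<Longrightarrow> sq_integrable (\<lambda>z. cnj (f z))"
  by (auto simp: sq_integrable_def)

lemma sq_integrable_bounded:
  assumes "f \<in> borel_measurable circle" "\<And>z. cmod z = 1 \<Longrightarrow> cmod (f z) \<le> B"
  shows "sq_integrable f"
proof -
  have "integrable circle (\<lambda>z. (cmod (f z))\<^sup>2)"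
    using assms by (intro integrable_circle_bounded[where B = "B\<^sup>2"]) (auto intro!: power_mono)
  then show ?thesis using assms by (simp add: sq_integrable_def)
qed

lemma integrable_mult_sq_integrable:
  assumes "sq_integrable f" "sq_integrable g"
  shows "integrable circle (\<lambda>z. f z * g z)"
proof -
  have [measurable]: "f \<in> borel_measurable circle" "g \<in> borel_measurable circle"
    using assms by (auto simp: sq_integrable_def)
  show ?thesis
  proof (rule Bochner_Integration.integrable_bound)
    show "integrable circle (\<lambda>z. (cmod (f z))\<^sup>2 + (cmod (g z))\<^sup>2)"
      using assms by (auto simp: sq_integrable_def)
    have "cmod a * cmod b \<le> (cmod a)\<^sup>2 + (cmod b)\<^sup>2" for a b
      using sum_squares_bound[of "cmod a" "cmod b"] mult_nonneg_nonneg[OF norm_ge_zero[of a] norm_ge_zero[of b]]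
      by linarith
    then have "norm (f z * g z) \<le> norm ((cmod (f z))\<^sup>2 + (cmod (g z))\<^sup>2)" for z
      by (metis abs_of_nonneg add_nonneg_nonneg norm_mult real_norm_def zero_le_power2)
    then show "AE z in circle. norm (f z * g z) \<le> norm ((cmod (f z))\<^sup>2 + (cmod (g z))\<^sup>2)"
      by (intro AE_I2)
  qed measurable
qed

lemma integrable_sq_integrable: "sq_integrable f \<Longrightarrow> integrable circle f"
  using integrable_mult_sq_integrable[of f "\<lambda>_. 1", OF _ sq_integrable_bounded[of _ 1]]
  by (simp only: mult_1_right norm_one order_refl borel_measurable_const simp_thms)

text \<open>The quadratic form \<open>\<integral> (a f + b g)\<^sup>2\<close> in \<open>(a, b)\<close> is nonnegative, so its discriminant is not positive.\<close>

lemma integral_Cauchy_Schwarz: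
  fixes f g :: "'a \<Rightarrow> real"
  assumes f: "integrable M (\<lambda>x. (f x)\<^sup>2)" and g: "integrable M (\<lambda>x. (g x)\<^sup>2)"
    and fg: "integrable M (\<lambda>x. f x * g x)"
  shows "(\<integral>x. f x * g x \<partial>M)\<^sup>2 \<le> (\<integral>x. (f x)\<^sup>2 \<partial>M) * (\<integral>x. (g x)\<^sup>2 \<partial>M)"
proof -
  define X Y Z where "X = (\<integral>x. (f x)\<^sup>2 \<partial>M)" and "Y = (\<integral>x. f x * g x \<partial>M)" and "Z = (\<integral>x. (g x)\<^sup>2 \<partial>M)"
  have q: "0 \<le> a\<^sup>2 * X + 2 * (a * b) * Y + b\<^sup>2 * Z" for a b
  proof -
    have "0 \<le> (\<integral>x. (a * f x + b * g x)\<^sup>2 \<partial>M)" by simp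
    also have "\<dots> = (\<integral>x. a\<^sup>2 * (f x)\<^sup>2 + 2 * (a * b) * (f x * g x) + b\<^sup>2 * (g x)\<^sup>2 \<partial>M)"
      by (intro Bochner_Integration.integral_cong) (auto simp: power2_eq_square algebra_simps)
    also have "\<dots> = a\<^sup>2 * X + 2 * (a * b) * Y + b\<^sup>2 * Z"
      using assms by (simp add: X_def Y_def Z_def)
    finally show ?thesis .
  qed
  have X0: "0 \<le> X" and Z0: "0 \<le> Z" by (auto simp: X_def Z_def)
  show ?thesis
  proof (cases "Z = 0")
    case True
    \<comment> \<open>For \<open>a = 1\<close> the form is then affine in \<open>b\<close>, and bounded below only if its slope vanishes.\<close>
    have "Y = 0"
    proof (rule ccontr)
      assume "Y \<noteq> 0"
      then show False
        using q[of 1 "- (X + 1) / (2 * Y)"] True by simp argo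
    qed
    then show ?thesis using X0 Z0 by (simp add: X_def[symmetric] Y_def[symmetric] Z_def[symmetric])
  next
    case False
    with Z0 have "Z > 0" by simp
    have "0 \<le> Z * (X * Z - Y\<^sup>2)"
      using q[of Z "- Y"] by (simp add: power2_eq_square algebra_simps)
    then have "0 \<le> X * Z - Y\<^sup>2"
      using \<open>Z > 0\<close> by (simp add: zero_le_mult_iff)
    then show ?thesis by (simp add: X_def[symmetric] Y_def[symmetric] Z_def[symmetric])
  qed
qed

lemma sums_integral_power_series:
  assumes c: "summable (\<lambda>n. cmod (c n))" and g: "integrable circle g"
  shows "(\<lambda>n. c n * (\<integral>z. z ^ n * g z \<partial>circle)) sums (\<integral>z. (\<Sum>n. c n * z ^ n) * g z \<partial>circle)"
proof -
  have [measurable]: "g \<in> borel_measurable circle" using g by auto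
  have int: "integrable circle (\<lambda>z. z ^ n * g z)" for n
    by (rule Bochner_Integration.integrable_bound[OF g]) (auto simp: norm_mult norm_power)
  have eq: "(\<integral>z. cmod (c n * z ^ n * g z) \<partial>circle) = cmod (c n) * (\<integral>z. cmod (g z) \<partial>circle)" for n
    by (subst integral_mult_right_zero[symmetric], intro Bochner_Integration.integral_cong)
       (auto simp: norm_mult norm_power)
  have s: "summable (\<lambda>n. cmod (c n * z ^ n))" if "cmod z = 1" for z
    using c that by (simp add: norm_mult norm_power)
  have "(\<lambda>n. \<integral>z. c n * z ^ n * g z \<partial>circle) sums (\<integral>z. (\<Sum>n. c n * z ^ n * g z) \<partial>circle)"
  proof (rule sums_integral)
    show "integrable circle (\<lambda>z. c n * z ^ n * g z)" for n
      using int[of n] by (simp add: mult.assoc)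
    show "AE z in circle. summable (\<lambda>n. cmod (c n * z ^ n * g z))"
      using s by (intro AE_I2) (simp add: norm_mult[of _ "g _"] summable_mult2)
    show "summable (\<lambda>n. \<integral>z. cmod (c n * z ^ n * g z) \<partial>circle)"
      unfolding eq using c by (rule summable_mult2)
  qed
  also have "(\<integral>z. (\<Sum>n. c n * z ^ n * g z) \<partial>circle) = (\<integral>z. (\<Sum>n. c n * z ^ n) * g z \<partial>circle)"
  proof (intro Bochner_Integration.integral_cong refl)
    fix z assume "z \<in> space circle"
    then have "summable (\<lambda>n. c n * z ^ n)"
      by (intro summable_norm_cancel[OF s]) simp
    then show "(\<Sum>n. c n * z ^ n * g z) = (\<Sum>n. c n * z ^ n) * g z"
      by (rule suminf_mult2[symmetric])
  qed
  finally show ?thesis by (simp add: mult.assoc)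
qed

text \<open>On the set where \<open>|u| \<le> K |h|\<close> the product \<open>u h\<close> is dominated by \<open>K |h|\<^sup>2\<close>, and on its complement
  \<open>|u h|\<close> is at most \<open>|u|\<^sup>2 / K\<close>, which has small integral for large \<open>K\<close>. So boundedness in \<open>L\<^sup>2\<close> and
  convergence almost everywhere suffice for weak convergence.\<close>

lemma weak_convergence_circle:
  assumes u: "\<And>k. sq_integrable (u k)" and C: "\<And>k. (\<integral>z. (cmod (u k z))\<^sup>2 \<partial>circle) \<le> C"
    and lim: "AE z in circle. (\<lambda>k. u k z) \<longlonglongrightarrow> 0" and h: "sq_integrable h"
  shows "(\<lambda>k. \<integral>z. u k z * h z \<partial>circle) \<longlonglongrightarrow> 0"
proof (rule LIMSEQ_I)
  fix e :: real assume e: "0 < e"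
  have [measurable]: "u k \<in> borel_measurable circle" "h \<in> borel_measurable circle" for k
    using u h by (auto simp: sq_integrable_def)
  have "0 \<le> C" using C[of 0] order_trans[OF _ C[of 0]] by force
  define K where "K = 2 * (C + 1) / e"
  have K: "0 < K" "C / K < e / 2 + 0"
    using e \<open>0 \<le> C\<close> by (auto simp: K_def field_simps)
  have hh: "integrable circle (\<lambda>z. K * (cmod (h z))\<^sup>2)"
    using h by (auto simp: sq_integrable_def)
  define v where "v k z = min (cmod (u k z)) (K * cmod (h z)) * cmod (h z)" for k z
  have [measurable]: "v k \<in> borel_measurable circle" for k
    unfolding v_def by measurable
  have vb: "0 \<le> v k z \<and> v k z \<le> K * (cmod (h z))\<^sup>2" for k z
    unfolding v_def using K(1) by (auto simp: power2_eq_square min_le_iff_disj mult.assoc[symmetric] intro!: mult_right_mono mult_nonneg_nonneg)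
  have vn: "norm (v k z) \<le> K * (cmod (h z))\<^sup>2" for k z
    using vb[of k z] by simp
  have vu: "norm (v k z) \<le> cmod (u k z) * cmod (h z)" for k z
  proof -
    have "v k z \<le> cmod (u k z) * cmod (h z)"
      unfolding v_def by (intro mult_right_mono) auto
    then show ?thesis using vb[of k z] by simp
  qed
  have vint: "integrable circle (v k)" for k
  proof (rule Bochner_Integration.integrable_bound[OF hh])
    show "AE z in circle. norm (v k z) \<le> norm (K * (cmod (h z))\<^sup>2)"
      using vn[of k] by (intro AE_I2) (metis abs_ge_self order_trans real_norm_def)
  qed measurable
  have "(\<lambda>k. \<integral>z. v k z \<partial>circle) \<longlonglongrightarrow> (\<integral>z. 0 \<partial>circle)"
  proof (rule integral_dominated_convergence[OF _ _ hh])
    show "AE z in circle. (\<lambda>k. v k z) \<longlonglongrightarrow> 0"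
      using lim
    proof eventually_elim
      case (elim z)
      have "(\<lambda>k. cmod (u k z) * cmod (h z)) \<longlonglongrightarrow> 0"
        using elim by (intro tendsto_mult_left_zero tendsto_norm_zero)
      then show ?case
        by (rule Lim_null_comparison[OF always_eventually, rotated]) (intro allI vu)
    qed
  qed (measurable, intro AE_I2 vn)
  then obtain N where N: "\<And>k. k \<ge> N \<Longrightarrow> (\<integral>z. v k z \<partial>circle) < e / 2"
    using LIMSEQ_D[of "\<lambda>k. \<integral>z. v k z \<partial>circle" 0 "e / 2"] e
    by (metis abs_ge_self diff_zero half_gt_zero integral_circle_const order.strict_trans1 real_norm_def)
  show "\<exists>N. \<forall>k\<ge>N. norm ((\<integral>z. u k z * h z \<partial>circle) - 0) < e"
  proof (intro exI allI impI)
    fix k assume "N \<le> k"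
    have pt: "cmod (u k z * h z) \<le> v k z + (cmod (u k z))\<^sup>2 / K" for z
    proof (cases "cmod (u k z) \<le> K * cmod (h z)")
      case True
      then show ?thesis using K by (simp add: v_def norm_mult)
    next
      case False
      then have "cmod (h z) \<le> cmod (u k z) / K" using K by (simp add: field_simps)
      then have "cmod (u k z) * cmod (h z) \<le> cmod (u k z) * (cmod (u k z) / K)"
        by (intro mult_left_mono) auto
      then show ?thesis using vb[of k z] by (simp add: norm_mult power2_eq_square)
    qed
    have ui: "integrable circle (\<lambda>z. (cmod (u k z))\<^sup>2)"
      using u by (simp add: sq_integrable_def)
    have "norm (\<integral>z. u k z * h z \<partial>circle) \<le> (\<integral>z. v k z + (cmod (u k z))\<^sup>2 / K \<partial>circle)"
      by (intro Bochner_Integration.integral_norm_bound_integral Bochner_Integration.integrable_add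
          integrable_divide integrable_mult_sq_integrable u h vint ui pt)
    also have "\<dots> = (\<integral>z. v k z \<partial>circle) + (\<integral>z. (cmod (u k z))\<^sup>2 \<partial>circle) / K"
      by (subst Bochner_Integration.integral_add)
        (simp_all add: vint ui integral_divide_zero)
    also have "(\<integral>z. (cmod (u k z))\<^sup>2 \<partial>circle) / K \<le> C / K"
      using C[of k] K by (simp add: divide_right_mono)
    finally show "norm ((\<integral>z. u k z * h z \<partial>circle) - 0) < e"
      using N[OF \<open>N \<le> k\<close>] K(2) by (simp only: diff_zero) linarith
  qed
qed

section \<open>The Poisson kernel\<close>

definition poisson_kernel :: "real \<Rightarrow> complex \<Rightarrow> complex \<Rightarrow> real" where
  "poisson_kernel r z w = (1 - r\<^sup>2) / (cmod (1 - of_real r * z * cnj w))\<^sup>2"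

lemma poisson_denominator_bound:
  assumes "0 \<le> r" "cmod z = 1" "cmod w = 1"
  shows "1 - r \<le> cmod (1 - of_real r * z * cnj w)"
proof -
  have "cmod 1 - cmod (of_real r * z * cnj w) \<le> cmod (1 - of_real r * z * cnj w)"
    by (rule norm_triangle_ineq2)
  then show ?thesis
    using assms by (simp add: norm_mult)
qed

lemma poisson_kernel_sym: "poisson_kernel r z w = poisson_kernel r w z"
proof -
  have "cmod (1 - of_real r * z * cnj w) = cmod (cnj (1 - of_real r * z * cnj w))"
    by (simp only: complex_mod_cnj)
  also have "cnj (1 - of_real r * z * cnj w) = 1 - of_real r * w * cnj z"
    by (simp add: mult.commute mult.left_commute)
  finally show ?thesis by (simp add: poisson_kernel_def)
qed

lemma poisson_kernel_nonneg: "0 \<le> r \<Longrightarrow> r < 1 \<Longrightarrow> 0 \<le> poisson_kernel r z w"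
  by (simp add: poisson_kernel_def power_le_one)

lemma poisson_kernel_le:
  assumes "0 \<le> r" "r < 1" "cmod z = 1" "cmod w = 1"
  shows "poisson_kernel r z w \<le> 1 / (1 - r)\<^sup>2"
  unfolding poisson_kernel_def
proof (rule frac_le)
  show "(1 - r)\<^sup>2 \<le> (cmod (1 - of_real r * z * cnj w))\<^sup>2"
    using poisson_denominator_bound[of r z w] assms by (intro power_mono) auto
qed (use assms in auto)

text \<open>The Poisson kernel is \<open>2 Re s - 1\<close> for the Cauchy kernel \<open>s\<close>. All integrals of Poisson kernels below
  are reduced in this way to the geometric series of \<open>s\<close>.\<close>

lemma poisson_kernel_eq:
  assumes "0 \<le> r" "r < 1" "cmod z = 1" "cmod w = 1"
  defines "s \<equiv> 1 / (1 - of_real r * cnj z * w)"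
  shows "of_real (poisson_kernel r z w) = s + cnj s - 1"
proof -
  define q where "q = of_real r * cnj z * w"
  have q: "cmod q = r" using assms by (simp add: q_def norm_mult)
  have ne: "1 - q \<noteq> 0" "1 - cnj q \<noteq> 0"
    using q assms by (auto dest: arg_cong[where f = cmod])
  have den: "of_real ((cmod (1 - of_real r * z * cnj w))\<^sup>2) = (1 - q) * (1 - cnj q)"
    by (simp only: complex_norm_square q_def) (simp add: mult_ac)
  have "of_real (1 - r\<^sup>2) = 1 - q * cnj q"
    using q by (simp add: complex_norm_square[symmetric])
  then have "of_real (poisson_kernel r z w) = (1 - q * cnj q) / ((1 - q) * (1 - cnj q))"
    by (simp only: poisson_kernel_def of_real_divide den)
  also have "\<dots> = 1 / (1 - q) + 1 / (1 - cnj q) - 1"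
  proof -
    have "(v + u - u * v) / (u * v) = 1 / u + 1 / v - 1" if "u \<noteq> 0" "v \<noteq> 0" for u v :: complex
      using that by (simp add: field_simps)
    from this[OF ne] show ?thesis
      by (simp add: algebra_simps)
  qed
  finally show ?thesis by (simp add: s_def q_def)
qed

lemma measurable_poisson_kernel [measurable]:
  "(\<lambda>x. poisson_kernel r (fst x) (snd x)) \<in> borel_measurable (circle \<Otimes>\<^sub>M circle)"
proof -
  have [measurable]: "(\<lambda>x. fst x) \<in> borel_measurable (circle \<Otimes>\<^sub>M circle)"
    "(\<lambda>x. snd x) \<in> borel_measurable (circle \<Otimes>\<^sub>M circle)"
    using measurable_compose[OF measurable_fst borel_measurable_circle_id]
      measurable_compose[OF measurable_snd borel_measurable_circle_id] by auto
  show ?thesis unfolding poisson_kernel_def by measurable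
qed

lemma measurable_poisson_kernel_snd: "poisson_kernel r z \<in> borel_measurable circle"
  unfolding poisson_kernel_def by measurable

lemma geometric_circle:
  assumes "cmod a < 1" "cmod w = 1"
  shows "(\<Sum>n. a ^ n * w ^ n) = 1 / (1 - a * w)"
  using suminf_geometric[of "a * w"] assms by (simp add: power_mult_distrib norm_mult)

lemma sums_integral_geometric:
  assumes a: "cmod a < 1" and g: "integrable circle g"
  shows "(\<lambda>n. a ^ n * (\<integral>w. w ^ n * g w \<partial>circle)) sums (\<integral>w. 1 / (1 - a * w) * g w \<partial>circle)"
proof -
  have "(\<integral>w. (\<Sum>n. a ^ n * w ^ n) * g w \<partial>circle) = (\<integral>w. 1 / (1 - a * w) * g w \<partial>circle)"
    by (intro Bochner_Integration.integral_cong refl) (simp add: geometric_circle[OF a])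
  moreover have "summable (\<lambda>n. cmod (a ^ n))"
    using a by (simp add: norm_power)
  ultimately show ?thesis
    using sums_integral_power_series[of "\<lambda>n. a ^ n" g] g by simp
qed

lemma integrable_cauchy_kernel:
  assumes a: "cmod a < 1" and g: "g \<in> borel_measurable circle" "\<And>w. cmod w = 1 \<Longrightarrow> cmod (g w) \<le> B"
  shows "integrable circle (\<lambda>w. 1 / (1 - a * w) * g w)"
proof (rule integrable_circle_bounded)
  show "(\<lambda>w. 1 / (1 - a * w) * g w) \<in> borel_measurable circle"
    using g(1) by measurable
  fix w :: complex assume w: "cmod w = 1"
  have "1 - cmod a \<le> cmod (1 - a * w)"
    using norm_triangle_ineq2[of 1 "a * w"] w by (simp add: norm_mult)
  then have "cmod (1 / (1 - a * w)) \<le> 1 / (1 - cmod a)"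
    using a by (simp add: norm_divide frac_le)
  moreover have "0 \<le> B" using g(2)[OF w] norm_ge_zero[of "g w"] by linarith
  ultimately show "cmod (1 / (1 - a * w) * g w) \<le> 1 / (1 - cmod a) * B"
    using g(2)[OF w] a by (simp only: norm_mult) (intro mult_mono, auto)
qed

text \<open>Expanding the two Cauchy kernels into geometric series, only the term of degree \<open>n\<close> survives, up
  to contributions of the constant terms that cancel.\<close>

lemma integral_poisson_kernel_power:
  assumes r: "0 \<le> r" "r < 1" and z: "cmod z = 1"
  shows "(\<integral>w. w ^ n * of_real (poisson_kernel r z w) \<partial>circle) = (of_real r * z) ^ n"
proof -
  define a where "a = of_real r * cnj z"
  have a: "cmod a < 1" using r z by (simp add: a_def norm_mult)
  define K where "K w = 1 / (1 - a * w)" for w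
  have ipw: "integrable circle (\<lambda>w. w ^ n)" "integrable circle (\<lambda>w. cnj w ^ n)"
    by (rule integrable_circle_bounded[where B = 1]; simp add: norm_power)+
  have iK: "integrable circle (\<lambda>w. K w * w ^ n)" "integrable circle (\<lambda>w. K w * cnj w ^ n)"
    unfolding K_def by (rule integrable_cauchy_kernel[OF a, where B = 1]; simp add: norm_power)+
  have 1: "(\<integral>w. K w * w ^ n \<partial>circle) = (if n = 0 then 1 else 0)"
  proof -
    have "(\<lambda>k. a ^ k * (\<integral>w. w ^ k * w ^ n \<partial>circle)) sums (\<integral>w. K w * w ^ n \<partial>circle)"
      unfolding K_def by (rule sums_integral_geometric[OF a ipw(1)])
    also have "(\<lambda>k. a ^ k * (\<integral>w. w ^ k * w ^ n \<partial>circle)) = (\<lambda>k. if k = 0 then (if n = 0 then 1 else 0) else 0)"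
      by (auto simp: fun_eq_iff integral_circle_power simp flip: power_add)
    finally show ?thesis
      using sums_unique2 sums_single[of 0 "\<lambda>_. (if n = 0 then 1 else 0) :: complex"] by blast
  qed
  have 2: "(\<integral>w. K w * cnj w ^ n \<partial>circle) = a ^ n"
  proof -
    have "(\<lambda>k. a ^ k * (\<integral>w. w ^ k * cnj w ^ n \<partial>circle)) sums (\<integral>w. K w * cnj w ^ n \<partial>circle)"
      unfolding K_def by (rule sums_integral_geometric[OF a ipw(2)])
    also have "(\<lambda>k. a ^ k * (\<integral>w. w ^ k * cnj w ^ n \<partial>circle)) = (\<lambda>k. if k = n then a ^ k else 0)"
      by (auto simp: fun_eq_iff integral_circle_moment)
    finally show ?thesis
      using sums_unique2 sums_single[of n "\<lambda>k. a ^ k"] by blast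
  qed
  have 3: "(\<integral>w. cnj (K w * cnj w ^ n) \<partial>circle) = (of_real r * z) ^ n"
    by (subst Bochner_Integration.integral_cnj, subst 2) (simp add: a_def)
  have i3: "integrable circle (\<lambda>w. cnj (K w * cnj w ^ n))"
    using iK(2) by (rule Bochner_Integration.integrable_cnj)
  have "(\<integral>w. w ^ n * of_real (poisson_kernel r z w) \<partial>circle)
      = (\<integral>w. K w * w ^ n + cnj (K w * cnj w ^ n) - w ^ n \<partial>circle)"
  proof (intro Bochner_Integration.integral_cong refl)
    fix w assume "w \<in> space circle"
    then have "of_real (poisson_kernel r z w) = K w + cnj (K w) - 1"
      unfolding K_def a_def using r z by (intro poisson_kernel_eq) auto
    then show "w ^ n * of_real (poisson_kernel r z w) = K w * w ^ n + cnj (K w * cnj w ^ n) - w ^ n"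
      by (simp only: complex_cnj_mult complex_cnj_power complex_cnj_cnj ring_distribs mult.commute mult_1_left mult_1_right)
  qed
  also have "\<dots> = (\<integral>w. K w * w ^ n \<partial>circle) + (\<integral>w. cnj (K w * cnj w ^ n) \<partial>circle) - (\<integral>w. w ^ n \<partial>circle)"
    using iK(1) i3 ipw(1)
    by (simp only: Bochner_Integration.integral_diff Bochner_Integration.integral_add Bochner_Integration.integrable_add)
  also have "\<dots> = (of_real r * z) ^ n"
    by (simp only: 1 3 integral_circle_power) simp
  finally show ?thesis .
qed

text \<open>Integrating the geometric series of the first kernel against the second one replaces each power
  of the variable by its Poisson integral, which gives the series with ratio scaled by \<open>s\<close>.\<close>

lemma poisson_kernel_semigroup:
  assumes r: "0 \<le> r" "r < 1" and s: "0 \<le> s" "s < 1" and z: "cmod z = 1" and v: "cmod v = 1"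
  shows "(\<integral>w. poisson_kernel r z w * poisson_kernel s v w \<partial>circle) = poisson_kernel (r * s) z v"
proof -
  define a where "a = of_real r * cnj z"
  have a: "cmod a < 1" using r z by (simp add: a_def norm_mult)
  define K where "K w = 1 / (1 - a * w)" for w
  define p :: "complex \<Rightarrow> complex" where "p w = of_real (poisson_kernel s v w)" for w
  have pm: "p \<in> borel_measurable circle"
    unfolding p_def using measurable_poisson_kernel_snd by measurable
  have pb: "cmod (p w) \<le> 1 / (1 - s)\<^sup>2" if "cmod w = 1" for w
    using poisson_kernel_le[OF s v that] poisson_kernel_nonneg[OF s, of v w] by (simp add: p_def)
  have ip: "integrable circle p"
    by (rule integrable_circle_bounded[OF pm pb])
  have iK: "integrable circle (\<lambda>w. K w * p w)"
    unfolding K_def by (rule integrable_cauchy_kernel[OF a pm pb])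
  have i3: "integrable circle (\<lambda>w. cnj (K w * p w))"
    using iK by (rule Bochner_Integration.integrable_cnj)
  define q where "q = 1 / (1 - of_real (r * s) * cnj z * v)"
  have 1: "(\<integral>w. K w * p w \<partial>circle) = q"
  proof -
    have b: "cmod (a * (of_real s * v)) < 1"
      using r s z v mult_strict_mono'[of r 1 s 1] by (simp add: a_def norm_mult)
    have "(\<lambda>k. a ^ k * (\<integral>w. w ^ k * p w \<partial>circle)) sums (\<integral>w. K w * p w \<partial>circle)"
      unfolding K_def by (rule sums_integral_geometric[OF a ip])
    also have "(\<lambda>k. a ^ k * (\<integral>w. w ^ k * p w \<partial>circle)) = (\<lambda>k. (a * (of_real s * v)) ^ k)"
      unfolding p_def by (simp only: integral_poisson_kernel_power[OF s v] power_mult_distrib)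
    finally have "(\<integral>w. K w * p w \<partial>circle) = 1 / (1 - a * (of_real s * v))"
      using geometric_sums[OF b] sums_unique2 by blast
    then show ?thesis by (simp add: q_def a_def mult_ac)
  qed
  have 2: "(\<integral>w. cnj (K w * p w) \<partial>circle) = cnj q"
    by (subst Bochner_Integration.integral_cnj, subst 1) simp
  have 3: "(\<integral>w. p w \<partial>circle) = 1"
    using integral_poisson_kernel_power[OF s v, of 0] by (simp add: p_def)
  have "complex_of_real (\<integral>w. poisson_kernel r z w * poisson_kernel s v w \<partial>circle)
      = (\<integral>w. of_real (poisson_kernel r z w * poisson_kernel s v w) \<partial>circle)"
    by (rule integral_complex_of_real[symmetric])
  also have "\<dots> = (\<integral>w. K w * p w + cnj (K w * p w) - p w \<partial>circle)"
  proof (intro Bochner_Integration.integral_cong refl)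
    fix w assume "w \<in> space circle"
    then have "of_real (poisson_kernel r z w) = K w + cnj (K w) - 1"
      unfolding K_def a_def using r z by (intro poisson_kernel_eq) auto
    then show "of_real (poisson_kernel r z w * poisson_kernel s v w) = K w * p w + cnj (K w * p w) - p w"
      by (simp only: p_def of_real_mult complex_cnj_mult complex_cnj_complex_of_real ring_distribs mult_1_left)
  qed
  also have "\<dots> = (\<integral>w. K w * p w \<partial>circle) + (\<integral>w. cnj (K w * p w) \<partial>circle) - (\<integral>w. p w \<partial>circle)"
    using iK i3 ip
    by (simp only: Bochner_Integration.integral_diff Bochner_Integration.integral_add Bochner_Integration.integrable_add)
  also have "\<dots> = q + cnj q - 1"
    by (simp only: 1 2 3)
  also have "\<dots> = of_real (poisson_kernel (r * s) z v)"
    unfolding q_def using r s z v mult_strict_mono'[of r 1 s 1]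
    by (intro poisson_kernel_eq[symmetric]) auto
  finally show ?thesis by (simp only: of_real_eq_iff)
qed

text \<open>With \<open>q = r z cnj v\<close>, the denominators are comparable because
  \<open>|1 - q| \<le> |1 - s q| + r (1 - s) \<le> 2 |1 - s q|\<close>, and the numerators because
  \<open>1 - (r s)\<^sup>2 \<le> 1 - r\<^sup>4 \<le> 2 (1 - r\<^sup>2)\<close>, where \<open>r \<le> s\<close> enters. The constant is thus \<open>2 \<cdot> 2\<^sup>2\<close>.\<close>

lemma poisson_kernel_mult_le_left:
  assumes r: "0 \<le> r" "r \<le> s" "s < 1" and z: "cmod z = 1" and v: "cmod v = 1"
  shows "poisson_kernel (r * s) z v \<le> 8 * poisson_kernel r z v"
proof -
  define d where "d = cmod (1 - of_real r * z * cnj v)"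
  define e where "e = cmod (1 - of_real (r * s) * z * cnj v)"
  have rs: "0 \<le> r * s" "r * s < 1" "r * s \<le> r"
    using r mult_strict_mono'[of r 1 s 1] mult_left_mono[of s 1 r] by auto
  have e0: "1 - r * s \<le> e"
    unfolding e_def by (rule poisson_denominator_bound) (use rs z v in auto)
  have d0: "1 - r \<le> d"
    unfolding d_def by (rule poisson_denominator_bound) (use r z v in auto)
  have "(1 - of_real (r * s) * z * cnj v) - of_real (r * (1 - s)) * z * cnj v = 1 - of_real r * z * cnj v"
    by (simp add: algebra_simps)
  then have "d \<le> e + cmod (of_real (r * (1 - s)) * z * cnj v)"
    unfolding d_def e_def by (metis norm_triangle_ineq4)
  also have "cmod (of_real (r * (1 - s)) * z * cnj v) = r * (1 - s)"
    using r z v by (simp add: norm_mult del: of_real_mult of_real_diff)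
  also have "r * (1 - s) \<le> 1 - r * s"
    using r by (simp add: algebra_simps)
  finally have de: "d \<le> 2 * e" using e0 by simp
  have dpos: "0 < d" using d0 r by simp
  then have epos: "0 < e" using de by simp
  have dsq: "d\<^sup>2 \<le> 4 * e\<^sup>2"
    using power_mono[OF de, of 2] dpos by (simp add: power_mult_distrib)
  have "r\<^sup>2 * r\<^sup>2 \<le> r\<^sup>2 * s\<^sup>2"
    using r by (intro mult_left_mono power_mono) auto
  then have num: "1 - (r * s)\<^sup>2 \<le> (1 - r\<^sup>2) * (1 + r\<^sup>2)"
    by (simp add: algebra_simps power_mult_distrib)
  have r2: "0 \<le> 1 - r\<^sup>2" "r\<^sup>2 \<le> 1" using r by (auto simp: power_le_one)
  have num2: "1 - (r * s)\<^sup>2 \<le> (1 - r\<^sup>2) * 2"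
    using num mult_left_mono[of "1 + r\<^sup>2" 2 "1 - r\<^sup>2"] r2 by simp
  have "(1 - (r * s)\<^sup>2) / e\<^sup>2 \<le> (1 - r\<^sup>2) * 2 / (d\<^sup>2 / 4)"
    using num2 r2 dpos dsq by (intro frac_le) auto
  then show ?thesis
    by (simp add: poisson_kernel_def d_def e_def field_simps)
qed

lemma poisson_kernel_mult_le:
  assumes "0 \<le> r" "r < 1" "0 \<le> s" "s < 1" and "cmod z = 1" "cmod v = 1"
  shows "poisson_kernel (r * s) z v \<le> 8 * (poisson_kernel r z v + poisson_kernel s z v)"
proof (cases "r \<le> s")
  case True
  then show ?thesis
    using poisson_kernel_mult_le_left[of r s z v] poisson_kernel_nonneg[of s z v] assms by simp
next
  case False
  then show ?thesis
    using poisson_kernel_mult_le_left[of s r z v] poisson_kernel_nonneg[of r z v] assms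
    by (simp add: mult.commute)
qed

section \<open>The maximal inequality\<close>

text \<open>The maximal inequality is first proved for bounded functions, for which every integral in
  the argument exists.\<close>

definition bounded_borel :: "(complex \<Rightarrow> real) \<Rightarrow> bool" where
  "bounded_borel f \<longleftrightarrow> f \<in> borel_measurable circle \<and> (\<exists>B. \<forall>z. cmod z = 1 \<longrightarrow> \<bar>f z\<bar> \<le> B)"

lemma bounded_borelI:
  "f \<in> borel_measurable circle \<Longrightarrow> (\<And>z. cmod z = 1 \<Longrightarrow> \<bar>f z\<bar> \<le> B) \<Longrightarrow> bounded_borel f"
  by (auto simp: bounded_borel_def)

lemma bounded_borelE:
  assumes "bounded_borel f"
  obtains B where "f \<in> borel_measurable circle" "0 \<le> B" "\<And>z. cmod z = 1 \<Longrightarrow> \<bar>f z\<bar> \<le> B"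
proof -
  obtain B where "f \<in> borel_measurable circle" "\<And>z. cmod z = 1 \<Longrightarrow> \<bar>f z\<bar> \<le> B"
    using assms by (auto simp: bounded_borel_def)
  moreover from this(2)[of 1] have "0 \<le> B" by simp
  ultimately show ?thesis using that by blast
qed

lemma bounded_borel_measurable: "bounded_borel f \<Longrightarrow> f \<in> borel_measurable circle"
  by (simp add: bounded_borel_def)

lemma bounded_borel_integrable: "bounded_borel f \<Longrightarrow> integrable circle f"
  by (elim bounded_borelE) (rule integrable_circle_bounded, auto)

lemma bounded_borel_mult:
  assumes "bounded_borel f" "bounded_borel g"
  shows "bounded_borel (\<lambda>z. f z * g z)"
proof -
  obtain B where B: "f \<in> borel_measurable circle" "0 \<le> B" "\<And>z. cmod z = 1 \<Longrightarrow> \<bar>f z\<bar> \<le> B"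
    using assms(1) by (rule bounded_borelE) (rule that)
  obtain C where C: "g \<in> borel_measurable circle" "0 \<le> C" "\<And>z. cmod z = 1 \<Longrightarrow> \<bar>g z\<bar> \<le> C"
    using assms(2) by (rule bounded_borelE) (rule that)
  show ?thesis
  proof (rule bounded_borelI)
    show "(\<lambda>z. f z * g z) \<in> borel_measurable circle"
      using B(1) C(1) by (rule borel_measurable_times)
    show "\<bar>f z * g z\<bar> \<le> B * C" if "cmod z = 1" for z
      using B(3)[OF that] C(3)[OF that] B(2) by (simp add: abs_mult mult_mono)
  qed
qed

lemma bounded_borel_power2: "bounded_borel f \<Longrightarrow> bounded_borel (\<lambda>z. (f z)\<^sup>2)"
  using bounded_borel_mult[of f f] by (simp add: power2_eq_square)

lemma bounded_borel_add:
  assumes "bounded_borel f" "bounded_borel g"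
  shows "bounded_borel (\<lambda>z. f z + g z)"
proof -
  obtain B where B: "f \<in> borel_measurable circle" "0 \<le> B" "\<And>z. cmod z = 1 \<Longrightarrow> \<bar>f z\<bar> \<le> B"
    using assms(1) by (rule bounded_borelE) (rule that)
  obtain C where C: "g \<in> borel_measurable circle" "0 \<le> C" "\<And>z. cmod z = 1 \<Longrightarrow> \<bar>g z\<bar> \<le> C"
    using assms(2) by (rule bounded_borelE) (rule that)
  show ?thesis
  proof (rule bounded_borelI)
    show "(\<lambda>z. f z + g z) \<in> borel_measurable circle"
      using B(1) C(1) by (rule borel_measurable_add)
    show "\<bar>f z + g z\<bar> \<le> B + C" if "cmod z = 1" for z
      using B(3)[OF that] C(3)[OF that] by linarith
  qed
qed

lemma bounded_borel_sum:
  "finite I \<Longrightarrow> (\<And>i. i \<in> I \<Longrightarrow> bounded_borel (f i)) \<Longrightarrow> bounded_borel (\<lambda>z. \<Sum>i\<in>I. f i z)"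
proof (induction I rule: finite_induct)
  case empty
  show ?case by (rule bounded_borelI[of _ 0]) auto
next
  case (insert i I)
  then show ?case by (simp add: bounded_borel_add)
qed

definition poisson :: "real \<Rightarrow> (complex \<Rightarrow> real) \<Rightarrow> complex \<Rightarrow> real" where
  "poisson r f z = (\<integral>w. poisson_kernel r z w * f w \<partial>circle)"

lemma bounded_borel_poisson_kernel:
  assumes "0 \<le> r" "r < 1" "cmod z = 1"
  shows "bounded_borel (poisson_kernel r z)"
  by (rule bounded_borelI[OF measurable_poisson_kernel_snd, where B = "1 / (1 - r)\<^sup>2"])
     (use assms poisson_kernel_le[of r z] poisson_kernel_nonneg[of r z] in auto)

lemma integrable_poisson_integrand:
  assumes "0 \<le> r" "r < 1" "cmod z = 1" "bounded_borel f"
  shows "integrable circle (\<lambda>w. poisson_kernel r z w * f w)"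
  by (intro bounded_borel_integrable bounded_borel_mult bounded_borel_poisson_kernel assms)

lemma abs_poisson_le:
  assumes r: "0 \<le> r" "r < 1" and z: "cmod z = 1" and f: "bounded_borel f"
  shows "\<bar>poisson r f z\<bar> \<le> 1 / (1 - r)\<^sup>2 * (\<integral>w. \<bar>f w\<bar> \<partial>circle)"
proof -
  have fi: "integrable circle f" by (rule bounded_borel_integrable[OF f])
  have "\<bar>poisson r f z\<bar> \<le> (\<integral>w. 1 / (1 - r)\<^sup>2 * \<bar>f w\<bar> \<partial>circle)"
    unfolding poisson_def
  proof (rule Bochner_Integration.integral_abs_bound_integral)
    show "integrable circle (\<lambda>w. poisson_kernel r z w * f w)"
      by (rule integrable_poisson_integrand[OF r z f])
    show "integrable circle (\<lambda>w. 1 / (1 - r)\<^sup>2 * \<bar>f w\<bar>)"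
      using fi by (intro integrable_mult_right Bochner_Integration.integrable_abs)
    fix w assume "w \<in> space circle"
    then show "\<bar>poisson_kernel r z w * f w\<bar> \<le> 1 / (1 - r)\<^sup>2 * \<bar>f w\<bar>"
      using poisson_kernel_le[OF r z, of w] poisson_kernel_nonneg[OF r, of z w]
      unfolding abs_mult by (intro mult_right_mono) auto
  qed
  also have "\<dots> = 1 / (1 - r)\<^sup>2 * (\<integral>w. \<bar>f w\<bar> \<partial>circle)"
    by (rule integral_mult_right_zero)
  finally show ?thesis .
qed

lemma measurable_poisson: 
  assumes [measurable]: "f \<in> borel_measurable circle"
  shows "poisson r f \<in> borel_measurable circle"
proof -
  have "(\<lambda>x. poisson_kernel r (fst x) (snd x) * f (snd x)) \<in> borel_measurable (circle \<Otimes>\<^sub>M circle)"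
    by measurable
  then show ?thesis
    unfolding poisson_def
    by (intro circle.borel_measurable_lebesgue_integral) (simp add: split_beta)
qed

lemma bounded_borel_poisson:
  assumes "0 \<le> r" "r < 1" "bounded_borel f"
  shows "bounded_borel (poisson r f)"
  by (rule bounded_borelI[OF measurable_poisson[OF bounded_borel_measurable[OF assms(3)]]])
     (rule abs_poisson_le[OF assms(1,2) _ assms(3)])

lemma poisson_nonneg:
  assumes "0 \<le> r" "r < 1" "\<And>z. cmod z = 1 \<Longrightarrow> 0 \<le> f z"
  shows "0 \<le> poisson r f z"
  unfolding poisson_def
  by (rule Bochner_Integration.integral_nonneg) (simp add: assms poisson_kernel_nonneg)

lemma poisson_sum:
  assumes "0 \<le> r" "r < 1" "cmod z = 1" "finite I" "\<And>i. i \<in> I \<Longrightarrow> bounded_borel (g i)"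
  shows "poisson r (\<lambda>w. \<Sum>i\<in>I. g i w) z = (\<Sum>i\<in>I. poisson r (g i) z)"
  unfolding poisson_def sum_distrib_left
  by (rule Bochner_Integration.integral_sum) (rule integrable_poisson_integrand[OF assms(1-3) assms(5)])

lemma integrable_circle2:
  assumes "h \<in> borel_measurable (circle \<Otimes>\<^sub>M circle)"
    and "\<And>z w. cmod z = 1 \<Longrightarrow> cmod w = 1 \<Longrightarrow> \<bar>h (z, w)\<bar> \<le> (B :: real)"
  shows "integrable (circle \<Otimes>\<^sub>M circle) h"
proof -
  interpret finite_measure "circle \<Otimes>\<^sub>M circle"
    by (rule finite_measure_pair_measure) (rule circle.finite_measure_axioms)+
  show ?thesis
    using assms by (intro integrable_const_bound[of _ B] AE_I2) (auto simp: space_pair_measure)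
qed

lemma poisson_selfadjoint:
  assumes r: "0 \<le> r" "r < 1" and f: "bounded_borel f" and g: "bounded_borel g"
  shows "(\<integral>z. poisson r f z * g z \<partial>circle) = (\<integral>z. f z * poisson r g z \<partial>circle)"
proof -
  obtain B where B[measurable]: "f \<in> borel_measurable circle" and B': "0 \<le> B" "\<And>z. cmod z = 1 \<Longrightarrow> \<bar>f z\<bar> \<le> B"
    using f by (rule bounded_borelE) (rule that)
  obtain C where C[measurable]: "g \<in> borel_measurable circle" and C': "0 \<le> C" "\<And>z. cmod z = 1 \<Longrightarrow> \<bar>g z\<bar> \<le> C"
    using g by (rule bounded_borelE) (rule that)
  have int: "integrable (circle \<Otimes>\<^sub>M circle) (\<lambda>(z, w). poisson_kernel r z w * f w * g z)"
  proof (rule integrable_circle2)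
    have "(\<lambda>x. poisson_kernel r (fst x) (snd x) * f (snd x) * g (fst x)) \<in> borel_measurable (circle \<Otimes>\<^sub>M circle)"
      by measurable
    then show "(\<lambda>(z, w). poisson_kernel r z w * f w * g z) \<in> borel_measurable (circle \<Otimes>\<^sub>M circle)"
      by (simp add: split_beta)
    fix z w :: complex assume *: "cmod z = 1" "cmod w = 1"
    show "\<bar>case (z, w) of (z, w) \<Rightarrow> poisson_kernel r z w * f w * g z\<bar> \<le> 1 / (1 - r)\<^sup>2 * B * C"
      unfolding prod.case abs_mult
      using poisson_kernel_le[OF r *] poisson_kernel_nonneg[OF r, of z w] B'(2)[OF *(2)] C'(2)[OF *(1)] B'(1) C'(1)
      by (intro mult_mono mult_nonneg_nonneg) auto
  qed
  have "(\<integral>z. poisson r f z * g z \<partial>circle) = (\<integral>z. (\<integral>w. poisson_kernel r z w * f w * g z \<partial>circle) \<partial>circle)"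
    unfolding poisson_def by (subst integral_mult_left_zero) simp
  also have "\<dots> = (\<integral>w. (\<integral>z. poisson_kernel r z w * f w * g z \<partial>circle) \<partial>circle)"
    by (rule circle2.Fubini_integral[symmetric]) (use int in simp)
  also have "\<dots> = (\<integral>w. (\<integral>z. f w * (poisson_kernel r w z * g z) \<partial>circle) \<partial>circle)"
    by (intro Bochner_Integration.integral_cong refl, subst poisson_kernel_sym) simp
  also have "\<dots> = (\<integral>w. f w * poisson r g w \<partial>circle)"
    unfolding poisson_def by (subst integral_mult_right_zero) simp
  finally show ?thesis .
qed

lemma poisson_poisson:
  assumes r: "0 \<le> r" "r < 1" and s: "0 \<le> s" "s < 1" and f: "bounded_borel f" and z: "cmod z = 1"
  shows "poisson r (poisson s f) z = poisson (r * s) f z"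
proof -
  obtain B where B[measurable]: "f \<in> borel_measurable circle" and B': "0 \<le> B" "\<And>z. cmod z = 1 \<Longrightarrow> \<bar>f z\<bar> \<le> B"
    using f by (rule bounded_borelE) (rule that)
  have [measurable]: "poisson_kernel r z \<in> borel_measurable circle"
    by (rule measurable_poisson_kernel_snd)
  have int: "integrable (circle \<Otimes>\<^sub>M circle) (\<lambda>(v, w). poisson_kernel r z w * (poisson_kernel s v w * f v))"
  proof (rule integrable_circle2)
    have "(\<lambda>x. poisson_kernel r z (snd x) * (poisson_kernel s (fst x) (snd x) * f (fst x))) \<in> borel_measurable (circle \<Otimes>\<^sub>M circle)"
      by measurable
    then show "(\<lambda>(v, w). poisson_kernel r z w * (poisson_kernel s v w * f v)) \<in> borel_measurable (circle \<Otimes>\<^sub>M circle)"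
      by (simp add: split_beta)
    fix v w :: complex assume *: "cmod v = 1" "cmod w = 1"
    show "\<bar>case (v, w) of (v, w) \<Rightarrow> poisson_kernel r z w * (poisson_kernel s v w * f v)\<bar>
        \<le> 1 / (1 - r)\<^sup>2 * (1 / (1 - s)\<^sup>2 * B)"
      unfolding prod.case abs_mult
      using poisson_kernel_le[OF r z *(2)] poisson_kernel_nonneg[OF r, of z w]
        poisson_kernel_le[OF s *] poisson_kernel_nonneg[OF s, of v w] B'(2)[OF *(1)] B'(1)
      by (intro mult_mono mult_nonneg_nonneg) auto
  qed
  have "poisson r (poisson s f) z = (\<integral>w. (\<integral>v. poisson_kernel r z w * (poisson_kernel s w v * f v) \<partial>circle) \<partial>circle)"
    unfolding poisson_def by (subst integral_mult_right_zero) simp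
  also have "\<dots> = (\<integral>w. (\<integral>v. poisson_kernel r z w * (poisson_kernel s v w * f v) \<partial>circle) \<partial>circle)"
    by (simp only: poisson_kernel_sym[of s])
  also have "\<dots> = (\<integral>v. (\<integral>w. poisson_kernel r z w * (poisson_kernel s v w * f v) \<partial>circle) \<partial>circle)"
    by (rule circle2.Fubini_integral) (use int in simp)
  also have "\<dots> = (\<integral>v. (\<integral>w. (poisson_kernel r z w * poisson_kernel s v w) * f v \<partial>circle) \<partial>circle)"
    by (simp only: mult.assoc)
  also have "\<dots> = (\<integral>v. poisson_kernel (r * s) z v * f v \<partial>circle)"
    by (intro Bochner_Integration.integral_cong refl, subst integral_mult_left_zero,
        subst poisson_kernel_semigroup[OF r s z]) auto
  finally show ?thesis by (simp add: poisson_def)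
qed

lemma poisson_mult_le:
  assumes r: "0 \<le> r" "r < 1" and s: "0 \<le> s" "s < 1" and f: "bounded_borel f" and z: "cmod z = 1"
    and nn: "\<And>z. cmod z = 1 \<Longrightarrow> 0 \<le> f z"
  shows "poisson (r * s) f z \<le> 8 * poisson r f z + 8 * poisson s f z"
proof -
  have rs: "0 \<le> r * s" "r * s < 1"
    using r s mult_strict_mono'[of r 1 s 1] by auto
  have "poisson (r * s) f z \<le> (\<integral>w. 8 * (poisson_kernel r z w * f w) + 8 * (poisson_kernel s z w * f w) \<partial>circle)"
    unfolding poisson_def
  proof (rule integral_mono)
    fix w assume "w \<in> space circle"
    then show "poisson_kernel (r * s) z w * f w \<le> 8 * (poisson_kernel r z w * f w) + 8 * (poisson_kernel s z w * f w)"
      using mult_right_mono[OF poisson_kernel_mult_le[OF r s z, of w] nn[of w]]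
      by (simp add: algebra_simps)
  qed (intro Bochner_Integration.integrable_add integrable_mult_right integrable_poisson_integrand r s rs z f)+
  also have "\<dots> = 8 * poisson r f z + 8 * poisson s f z"
    unfolding poisson_def
    by (subst Bochner_Integration.integral_add)
       (intro integrable_mult_right integrable_poisson_integrand r s z f | simp)+
  finally show ?thesis .
qed

text \<open>The maximal function over a finite set of radii: its norm is finite from the start, which is
  needed to absorb it in the inequality that bounds it.\<close>

definition poisson_max :: "real set \<Rightarrow> (complex \<Rightarrow> real) \<Rightarrow> complex \<Rightarrow> real" where
  "poisson_max S f z = Max ((\<lambda>r. poisson r f z) ` S)"

context
  fixes S :: "real set"
  assumes S: "finite S" "S \<noteq> {}" "S \<subseteq> {0..<1}"
begin

lemma radii: "r \<in> S \<Longrightarrow> 0 \<le> r" "r \<in> S \<Longrightarrow> r < 1"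
  using S by auto

lemma poisson_le_max: "r \<in> S \<Longrightarrow> poisson r f z \<le> poisson_max S f z"
  unfolding poisson_max_def using S by (intro Max_ge) auto

lemma poisson_max_attained: "\<exists>r\<in>S. poisson_max S f z = poisson r f z"
proof -
  have "Max ((\<lambda>r. poisson r f z) ` S) \<in> (\<lambda>r. poisson r f z) ` S"
    using S by (intro Max_in) auto
  then show ?thesis
    unfolding poisson_max_def by blast
qed

lemma poisson_max_nonneg: "(\<And>z. cmod z = 1 \<Longrightarrow> 0 \<le> f z) \<Longrightarrow> 0 \<le> poisson_max S f z"
  using poisson_max_attained[of f z] poisson_nonneg[of _ f z] radii by auto

lemma bounded_borel_poisson_max:
  assumes f: "bounded_borel f"
  shows "bounded_borel (poisson_max S f)"
proof -
  have "bounded_borel (poisson r f)" if "r \<in> S" for r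
    by (intro bounded_borel_poisson f radii that)
  then obtain B where B: "\<And>r z. r \<in> S \<Longrightarrow> cmod z = 1 \<Longrightarrow> \<bar>poisson r f z\<bar> \<le> B r"
    unfolding bounded_borel_def by metis
  show ?thesis
  proof (rule bounded_borelI)
    show "poisson_max S f \<in> borel_measurable circle"
      unfolding poisson_max_def
      by (intro borel_measurable_Max S measurable_poisson bounded_borel_measurable f)
    show "\<bar>poisson_max S f z\<bar> \<le> Max (B ` S)" if "cmod z = 1" for z
    proof -
      obtain r where r: "r \<in> S" "poisson_max S f z = poisson r f z"
        using poisson_max_attained by blast
      have "B r \<le> Max (B ` S)" using r S by simp
      then show ?thesis using B[OF r(1) that] r(2) by simp
    qed
  qed
qed

text \<open>The functions \<open>g r\<close> split the maximal function according to the smallest radius that attains it.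
  This is a measurable choice of a radius at each point, written as a partition.\<close>

lemma poisson_max_selection:
  assumes f: "bounded_borel f" and nn: "\<And>z. cmod z = 1 \<Longrightarrow> 0 \<le> f z"
  obtains g where "\<And>r. r \<in> S \<Longrightarrow> bounded_borel (g r)" "\<And>r z. r \<in> S \<Longrightarrow> 0 \<le> g r z"
    "\<And>z. (\<Sum>r\<in>S. g r z) = poisson_max S f z"
    "\<And>r z. r \<in> S \<Longrightarrow> g r z * poisson_max S f z = g r z * poisson r f z"
proof -
  define first where "first r z \<longleftrightarrow> poisson r f z = poisson_max S f z \<and>
      (\<forall>s\<in>S. s < r \<longrightarrow> poisson s f z \<noteq> poisson_max S f z)" for r z
  define g where "g r z = (if first r z then poisson_max S f z else 0)" for r z
  have fm [measurable]: "f \<in> borel_measurable circle"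
    by (rule bounded_borel_measurable[OF f])
  have [measurable]: "poisson r f \<in> borel_measurable circle" for r
    by (rule measurable_poisson[OF fm])
  have [measurable]: "poisson_max S f \<in> borel_measurable circle"
    by (rule bounded_borel_measurable[OF bounded_borel_poisson_max[OF f]])
  obtain B where B: "0 \<le> B" "\<And>z. cmod z = 1 \<Longrightarrow> \<bar>poisson_max S f z\<bar> \<le> B"
    using bounded_borel_poisson_max[OF f] by (rule bounded_borelE) (rule that)
  have 1: "bounded_borel (g r)" for r
  proof (rule bounded_borelI)
    have [measurable]: "Measurable.pred circle (\<lambda>z. \<forall>s\<in>S. s < r \<longrightarrow> poisson s f z \<noteq> poisson_max S f z)"
      by (intro pred_intros_finite(3) S(1)) measurable
    show "g r \<in> borel_measurable circle"
      unfolding g_def first_def by measurable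
    show "\<bar>g r z\<bar> \<le> B" if "cmod z = 1" for z
      using B(1) B(2)[OF that] by (simp add: g_def)
  qed
  have 2: "0 \<le> g r z" for r z
    using poisson_max_nonneg[OF nn] by (simp add: g_def)
  have 3: "(\<Sum>r\<in>S. g r z) = poisson_max S f z" for z
  proof -
    define T where "T = {r\<in>S. poisson r f z = poisson_max S f z}"
    have T: "finite T" "T \<noteq> {}"
      using S poisson_max_attained[of f z] by (auto simp: T_def)
    have "Min T \<in> T" using T by (rule Min_in)
    have iff: "first r z \<longleftrightarrow> r = Min T" if "r \<in> S" for r
    proof
      assume "first r z"
      then have "r \<in> T" "\<And>s. s \<in> T \<Longrightarrow> r \<le> s"
        using that by (auto simp: first_def T_def not_less[symmetric])
      then show "r = Min T" using T by (intro Min_eqI[symmetric]) auto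
    next
      assume r: "r = Min T"
      then have "\<And>s. s \<in> T \<Longrightarrow> r \<le> s" using T by simp
      then show "first r z"
        using \<open>Min T \<in> T\<close> r by (force simp: first_def T_def)
    qed
    have "(\<Sum>r\<in>S. g r z) = (\<Sum>r\<in>S. if r = Min T then poisson_max S f z else 0)"
      by (intro sum.cong refl) (simp add: g_def iff)
    also have "\<dots> = poisson_max S f z"
      using \<open>Min T \<in> T\<close> S by (simp add: T_def)
    finally show ?thesis .
  qed
  have 4: "g r z * poisson_max S f z = g r z * poisson r f z" for r z
    by (simp add: g_def first_def)
  show ?thesis using that 1 2 3 4 by blast
qed

text \<open>Write \<open>F\<close> for the maximal function and \<open>h = \<Sum>\<^sub>r P\<^sub>r g\<^sub>r\<close>, the adjoint of the linearized maximal
  operator applied to \<open>F\<close>. Then \<open>\<integral> F\<^sup>2 = \<integral> h f\<close>, and \<open>\<integral> h\<^sup>2\<close> is the sum over \<open>r\<close>, \<open>s\<close> of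
  \<open>\<integral> g\<^sub>r P\<^sub>r\<^sub>s g\<^sub>s\<close>. Bounding \<open>P\<^sub>r\<^sub>s\<close> by \<open>8 (P\<^sub>r + P\<^sub>s)\<close> decouples the two radii, and the \<open>g\<^sub>s\<close> sum up to
  \<open>F\<close> again, so \<open>\<integral> h\<^sup>2\<close> is at most 16 times the integral of \<open>F\<close> against its own maximal function.\<close>

lemma poisson_max_improve:
  assumes f: "bounded_borel f" and nn: "\<And>z. cmod z = 1 \<Longrightarrow> 0 \<le> f z"
  shows "(\<integral>z. (poisson_max S f z)\<^sup>2 \<partial>circle)\<^sup>2 \<le>
    16 * (\<integral>z. poisson_max S f z * poisson_max S (poisson_max S f) z \<partial>circle) * (\<integral>z. (f z)\<^sup>2 \<partial>circle)"
proof -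
  obtain g where g: "\<And>r. r \<in> S \<Longrightarrow> bounded_borel (g r)" "\<And>r z. r \<in> S \<Longrightarrow> 0 \<le> g r z"
    "\<And>z. (\<Sum>r\<in>S. g r z) = poisson_max S f z"
    "\<And>r z. r \<in> S \<Longrightarrow> g r z * poisson_max S f z = g r z * poisson r f z"
    using poisson_max_selection[OF f nn] by blast
  define F where "F = poisson_max S f"
  have F: "bounded_borel F" unfolding F_def by (rule bounded_borel_poisson_max[OF f])
  have bbp: "bounded_borel (poisson s (g r))" if "r \<in> S" "s \<in> S" for r s
    by (intro bounded_borel_poisson g radii that)
  define h where "h z = (\<Sum>r\<in>S. poisson r (g r) z)" for z
  have h: "bounded_borel h"
    unfolding h_def by (intro bounded_borel_sum S bbp)
  have 1: "(\<integral>z. (F z)\<^sup>2 \<partial>circle) = (\<integral>z. h z * f z \<partial>circle)"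
  proof -
    have "(\<integral>z. (F z)\<^sup>2 \<partial>circle) = (\<integral>z. (\<Sum>r\<in>S. g r z * poisson r f z) \<partial>circle)"
      by (intro Bochner_Integration.integral_cong refl)
         (simp add: F_def power2_eq_square g(3)[symmetric] sum_distrib_right g(4)[unfolded g(3)[symmetric]])
    also have "\<dots> = (\<Sum>r\<in>S. (\<integral>z. g r z * poisson r f z \<partial>circle))"
      by (intro Bochner_Integration.integral_sum bounded_borel_integrable bounded_borel_mult
          bounded_borel_poisson g f radii)
    also have "\<dots> = (\<Sum>r\<in>S. (\<integral>z. poisson r (g r) z * f z \<partial>circle))"
      by (intro sum.cong refl poisson_selfadjoint[symmetric] g f radii)
    also have "\<dots> = (\<integral>z. (\<Sum>r\<in>S. poisson r (g r) z * f z) \<partial>circle)"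
      by (intro Bochner_Integration.integral_sum[symmetric] bounded_borel_integrable bounded_borel_mult bbp f)
    finally show ?thesis by (simp add: h_def sum_distrib_right)
  qed
  define J where "J r s = (\<integral>z. g r z * poisson r (g s) z \<partial>circle)" for r s
  have 2: "(\<integral>z. poisson r (g r) z * poisson s (g s) z \<partial>circle) \<le> 8 * J r s + 8 * J s r"
    if r: "r \<in> S" and s: "s \<in> S" for r s
  proof -
    have "(\<integral>z. poisson r (g r) z * poisson s (g s) z \<partial>circle)
        = (\<integral>z. g r z * poisson r (poisson s (g s)) z \<partial>circle)"
      by (intro poisson_selfadjoint radii g bbp r s)
    also have "\<dots> = (\<integral>z. g r z * poisson (r * s) (g s) z \<partial>circle)"
      by (intro Bochner_Integration.integral_cong refl, subst poisson_poisson)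
         (use radii g r s in auto)
    also have "\<dots> \<le> (\<integral>z. 8 * (g r z * poisson r (g s) z) + 8 * (g r z * poisson s (g s) z) \<partial>circle)"
    proof (rule integral_mono)
      fix z assume "z \<in> space circle"
      then have "poisson (r * s) (g s) z \<le> 8 * poisson r (g s) z + 8 * poisson s (g s) z"
        by (intro poisson_mult_le radii g r s) auto
      then show "g r z * poisson (r * s) (g s) z \<le> 8 * (g r z * poisson r (g s) z) + 8 * (g r z * poisson s (g s) z)"
        using mult_left_mono[OF _ g(2)[OF r, of z]] by (fastforce simp: algebra_simps)
    next
      have "0 \<le> r * s" "r * s < 1"
        using radii[OF r] radii[OF s] mult_strict_mono'[of r 1 s 1] by auto
      then show "integrable circle (\<lambda>z. g r z * poisson (r * s) (g s) z)"
        by (intro bounded_borel_integrable bounded_borel_mult bounded_borel_poisson g r s)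
    qed (intro Bochner_Integration.integrable_add integrable_mult_right bounded_borel_integrable bounded_borel_mult bbp g r s)
    also have "\<dots> = 8 * J r s + 8 * (\<integral>z. g r z * poisson s (g s) z \<partial>circle)"
      unfolding J_def
      by (subst Bochner_Integration.integral_add)
         (intro integrable_mult_right bounded_borel_integrable bounded_borel_mult bbp g r s | simp)+
    also have "(\<integral>z. g r z * poisson s (g s) z \<partial>circle) = (\<integral>z. poisson s (g r) z * g s z \<partial>circle)"
      by (intro poisson_selfadjoint[symmetric] radii g r s)
    also have "\<dots> = J s r" by (simp add: J_def mult.commute)
    finally show ?thesis .
  qed
  have 3: "(\<integral>z. (h z)\<^sup>2 \<partial>circle) \<le> 16 * (\<Sum>r\<in>S. \<Sum>s\<in>S. J r s)"
  proof -
    have "(\<integral>z. (h z)\<^sup>2 \<partial>circle) = (\<integral>z. (\<Sum>r\<in>S. \<Sum>s\<in>S. poisson r (g r) z * poisson s (g s) z) \<partial>circle)"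
      by (simp add: h_def power2_eq_square sum_product)
    also have "\<dots> = (\<Sum>r\<in>S. (\<integral>z. (\<Sum>s\<in>S. poisson r (g r) z * poisson s (g s) z) \<partial>circle))"
      by (intro Bochner_Integration.integral_sum bounded_borel_integrable bounded_borel_sum bounded_borel_mult bbp S)
    also have "\<dots> = (\<Sum>r\<in>S. \<Sum>s\<in>S. (\<integral>z. poisson r (g r) z * poisson s (g s) z \<partial>circle))"
      by (intro sum.cong refl Bochner_Integration.integral_sum bounded_borel_integrable bounded_borel_mult bbp)
    also have "\<dots> \<le> (\<Sum>r\<in>S. \<Sum>s\<in>S. 8 * J r s + 8 * J s r)"
      by (intro sum_mono 2)
    also have "\<dots> = 8 * (\<Sum>r\<in>S. \<Sum>s\<in>S. J r s) + 8 * (\<Sum>r\<in>S. \<Sum>s\<in>S. J s r)"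
      by (simp add: sum.distrib sum_distrib_left)
    also have "(\<Sum>r\<in>S. \<Sum>s\<in>S. J s r) = (\<Sum>r\<in>S. \<Sum>s\<in>S. J r s)"
      by (rule sum.swap)
    finally show ?thesis by simp
  qed
  have 4: "(\<Sum>r\<in>S. \<Sum>s\<in>S. J r s) \<le> (\<integral>z. F z * poisson_max S F z \<partial>circle)"
  proof -
    have pF: "bounded_borel (poisson r F)" if "r \<in> S" for r
      by (intro bounded_borel_poisson radii that F)
    have "(\<Sum>s\<in>S. J r s) = (\<integral>z. g r z * poisson r F z \<partial>circle)" if r: "r \<in> S" for r
    proof -
      have "(\<Sum>s\<in>S. J r s) = (\<integral>z. (\<Sum>s\<in>S. g r z * poisson r (g s) z) \<partial>circle)"
        unfolding J_def
        by (intro Bochner_Integration.integral_sum[symmetric] bounded_borel_integrable bounded_borel_mult bbp g r)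
      also have "\<dots> = (\<integral>z. g r z * poisson r F z \<partial>circle)"
      proof (intro Bochner_Integration.integral_cong refl)
        fix z assume "z \<in> space circle"
        then have "poisson r (\<lambda>w. \<Sum>s\<in>S. g s w) z = (\<Sum>s\<in>S. poisson r (g s) z)"
          by (intro poisson_sum radii r S g) auto
        then show "(\<Sum>s\<in>S. g r z * poisson r (g s) z) = g r z * poisson r F z"
          by (simp add: g(3) F_def sum_distrib_left)
      qed
      finally show ?thesis .
    qed
    then have "(\<Sum>r\<in>S. \<Sum>s\<in>S. J r s) = (\<Sum>r\<in>S. (\<integral>z. g r z * poisson r F z \<partial>circle))"
      by (intro sum.cong) auto
    also have "\<dots> = (\<integral>z. (\<Sum>r\<in>S. g r z * poisson r F z) \<partial>circle)"
      by (intro Bochner_Integration.integral_sum[symmetric] bounded_borel_integrable bounded_borel_mult pF g)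
    also have "\<dots> \<le> (\<integral>z. F z * poisson_max S F z \<partial>circle)"
    proof (rule integral_mono)
      show "integrable circle (\<lambda>z. \<Sum>r\<in>S. g r z * poisson r F z)"
        by (intro bounded_borel_integrable bounded_borel_sum bounded_borel_mult S pF g)
      show "integrable circle (\<lambda>z. F z * poisson_max S F z)"
        by (intro bounded_borel_integrable bounded_borel_mult bounded_borel_poisson_max F)
      fix z
      have "(\<Sum>r\<in>S. g r z * poisson r F z) \<le> (\<Sum>r\<in>S. g r z * poisson_max S F z)"
        by (intro sum_mono mult_left_mono poisson_le_max g)
      then show "(\<Sum>r\<in>S. g r z * poisson r F z) \<le> F z * poisson_max S F z"
        by (simp add: sum_distrib_right[symmetric] g(3) F_def)
    qed
    finally show ?thesis .
  qed
  have "(\<integral>z. (F z)\<^sup>2 \<partial>circle)\<^sup>2 \<le> (\<integral>z. (h z)\<^sup>2 \<partial>circle) * (\<integral>z. (f z)\<^sup>2 \<partial>circle)"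
    unfolding 1
    by (intro integral_Cauchy_Schwarz bounded_borel_integrable bounded_borel_power2 bounded_borel_mult h f)
  also have "\<dots> \<le> 16 * (\<integral>z. F z * poisson_max S F z \<partial>circle) * (\<integral>z. (f z)\<^sup>2 \<partial>circle)"
    using 3 4 by (intro mult_right_mono) auto
  finally show ?thesis by (simp add: F_def)
qed

definition poisson_max_const :: "real \<Rightarrow> bool" where
  "poisson_max_const B \<longleftrightarrow> 0 \<le> B \<and> (\<forall>f. bounded_borel f \<longrightarrow> (\<forall>z. cmod z = 1 \<longrightarrow> 0 \<le> f z) \<longrightarrow>
     (\<integral>z. (poisson_max S f z)\<^sup>2 \<partial>circle) \<le> B * (\<integral>z. (f z)\<^sup>2 \<partial>circle))"

text \<open>A crude constant from the bound \<open>(1 - r)\<^sup>-\<^sup>2\<close> of the kernel. It depends on the set of radii.\<close>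

lemma poisson_max_const_exists: "\<exists>B. poisson_max_const B"
proof -
  define C where "C = Max ((\<lambda>r. 1 / (1 - r)\<^sup>2) ` S)"
  have C: "1 / (1 - r)\<^sup>2 \<le> C" if "r \<in> S" for r
    unfolding C_def using S that by simp
  have "(\<integral>z. (poisson_max S f z)\<^sup>2 \<partial>circle) \<le> C\<^sup>2 * (\<integral>z. (f z)\<^sup>2 \<partial>circle)"
    if f: "bounded_borel f" and nn: "\<forall>z. cmod z = 1 \<longrightarrow> 0 \<le> f z" for f
  proof -
    define I where "I = (\<integral>w. \<bar>f w\<bar> \<partial>circle)"
    have I: "0 \<le> I" by (simp add: I_def)
    have "(poisson_max S f z)\<^sup>2 \<le> (C * I)\<^sup>2" if z: "cmod z = 1" for z
    proof -
      obtain r where r: "r \<in> S" "poisson_max S f z = poisson r f z"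
        using poisson_max_attained by blast
      have "\<bar>poisson r f z\<bar> \<le> 1 / (1 - r)\<^sup>2 * I"
        unfolding I_def by (intro abs_poisson_le radii r z f)
      also have "\<dots> \<le> C * I" using C[OF r(1)] I by (intro mult_right_mono)
      finally show ?thesis using r(2) by (simp add: abs_le_square_iff[symmetric])
    qed
    then have "(\<integral>z. (poisson_max S f z)\<^sup>2 \<partial>circle) \<le> (\<integral>z. (C * I)\<^sup>2 \<partial>circle)"
      by (intro integral_mono bounded_borel_integrable bounded_borel_power2 bounded_borel_poisson_max f
          bounded_borelI[of "\<lambda>_. C * I" "\<bar>C * I\<bar>"]) auto
    also have "\<dots> = C\<^sup>2 * I\<^sup>2" by (simp add: power_mult_distrib)
    also have "I\<^sup>2 \<le> (\<integral>z. (f z)\<^sup>2 \<partial>circle)"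
    proof -
      have one: "bounded_borel (\<lambda>_. 1)" by (rule bounded_borelI[of _ 1]) auto
      have "I = (\<integral>z. f z * 1 \<partial>circle)"
        unfolding I_def using nn by (intro Bochner_Integration.integral_cong) auto
      then show ?thesis
        using integral_Cauchy_Schwarz[of circle f "\<lambda>_. 1"]
          bounded_borel_integrable[OF bounded_borel_power2[OF f]]
          bounded_borel_integrable[OF f] bounded_borel_integrable[OF one] by simp
    qed
    finally show ?thesis by (simp add: mult_left_mono)
  qed
  then have "poisson_max_const (C\<^sup>2)" by (simp add: poisson_max_const_def)
  then show ?thesis ..
qed

lemma poisson_max_const_improve:
  assumes B: "poisson_max_const B"
  shows "poisson_max_const (16 * sqrt B)"
  unfolding poisson_max_const_def
proof (intro conjI allI impI)
  show "0 \<le> 16 * sqrt B" using B by (simp add: poisson_max_const_def)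
  fix f assume f: "bounded_borel f" and nn: "\<forall>z. cmod z = 1 \<longrightarrow> 0 \<le> f z"
  define F where "F = poisson_max S f"
  define X Y Z where "X = (\<integral>z. (F z)\<^sup>2 \<partial>circle)" and "Y = (\<integral>z. (f z)\<^sup>2 \<partial>circle)"
    and "Z = (\<integral>z. F z * poisson_max S F z \<partial>circle)"
  have B0: "0 \<le> B" using B by (simp add: poisson_max_const_def)
  have F: "bounded_borel F" unfolding F_def by (rule bounded_borel_poisson_max[OF f])
  have Fnn: "\<forall>z. cmod z = 1 \<longrightarrow> 0 \<le> F z" unfolding F_def using poisson_max_nonneg nn by auto
  have X0: "0 \<le> X" "0 \<le> Y" by (auto simp: X_def Y_def)
  have "Z\<^sup>2 \<le> X * (\<integral>z. (poisson_max S F z)\<^sup>2 \<partial>circle)"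
    unfolding Z_def X_def
    by (intro integral_Cauchy_Schwarz bounded_borel_integrable bounded_borel_power2 bounded_borel_mult
        bounded_borel_poisson_max F)
  also have "\<dots> \<le> X * (B * X)"
    using B F Fnn X0 unfolding X_def poisson_max_const_def by (intro mult_left_mono) auto
  also have "\<dots> = (sqrt B * X)\<^sup>2"
    using B0 by (simp add: power_mult_distrib power2_eq_square[of X] mult_ac)
  finally have Z: "Z \<le> sqrt B * X"
    by (rule power2_le_imp_le) (intro mult_nonneg_nonneg real_sqrt_ge_zero B0 X0)
  have "X\<^sup>2 \<le> 16 * Z * Y"
    unfolding X_def Y_def Z_def F_def by (rule poisson_max_improve[OF f]) (use nn in auto)
  also have "\<dots> \<le> 16 * (sqrt B * X) * Y"
    by (intro mult_right_mono mult_left_mono Z X0) simp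
  finally have "X * X \<le> X * (16 * sqrt B * Y)"
    by (simp add: power2_eq_square mult_ac)
  then have "X \<le> 16 * sqrt B * Y"
  proof (cases "X = 0")
    case True
    then show ?thesis using X0 B0 by simp
  next
    case False
    then have "0 < X" using X0 by simp
    with \<open>X * X \<le> X * (16 * sqrt B * Y)\<close> show ?thesis by (rule mult_left_le_imp_le)
  qed
  then show "(\<integral>z. (poisson_max S f z)\<^sup>2 \<partial>circle) \<le> 16 * sqrt B * (\<integral>z. (f z)\<^sup>2 \<partial>circle)"
    by (simp add: X_def Y_def F_def)
qed

text \<open>With \<open>B\<close> also \<open>16 sqrt B\<close> is admissible, so the infimum \<open>b\<close> of the admissible constants satisfies
  \<open>b \<le> 16 sqrt b\<close>, that is \<open>b \<le> 256\<close>, whatever the set of radii is.\<close>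

theorem poisson_maximal_inequality:
  assumes f: "bounded_borel f" and nn: "\<And>z. cmod z = 1 \<Longrightarrow> 0 \<le> f z"
  shows "(\<integral>z. (poisson_max S f z)\<^sup>2 \<partial>circle) \<le> 256 * (\<integral>z. (f z)\<^sup>2 \<partial>circle)"
proof -
  define b where "b = Inf (Collect poisson_max_const)"
  have ne: "Collect poisson_max_const \<noteq> {}" using poisson_max_const_exists by auto
  have bdd: "bdd_below (Collect poisson_max_const)"
    by (rule bdd_belowI[of _ 0]) (simp add: poisson_max_const_def)
  have b0: "0 \<le> b" unfolding b_def
    by (rule cInf_greatest[OF ne]) (simp add: poisson_max_const_def)
  have "(b / 16)\<^sup>2 \<le> B" if "poisson_max_const B" for B
  proof -
    have "b \<le> 16 * sqrt B"
      unfolding b_def using poisson_max_const_improve[OF that] by (intro cInf_lower bdd) simp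
    then have "(b / 16)\<^sup>2 \<le> (sqrt B)\<^sup>2" using b0 by (intro power_mono) auto
    then show ?thesis using that by (simp add: poisson_max_const_def)
  qed
  then have "(b / 16)\<^sup>2 \<le> b"
    unfolding b_def by (intro cInf_greatest[OF ne]) auto
  then have "b * b \<le> b * 256" by (simp add: power2_eq_square)
  then have b: "b \<le> 256" using b0 by (cases "b = 0") (auto simp: mult_le_cancel_left)
  define X Y where "X = (\<integral>z. (poisson_max S f z)\<^sup>2 \<partial>circle)" and "Y = (\<integral>z. (f z)\<^sup>2 \<partial>circle)"
  have XB: "X \<le> B * Y" if "poisson_max_const B" for B
    using that f nn by (simp add: poisson_max_const_def X_def Y_def)
  have Y0: "0 \<le> Y" by (simp add: Y_def)
  have "X \<le> 256 * Y"
  proof (cases "Y = 0")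
    case True
    then show ?thesis using XB poisson_max_const_exists by auto
  next
    case False
    then have "X / Y \<le> B" if "poisson_max_const B" for B
      using XB[OF that] Y0 by (simp add: divide_le_eq)
    then have "X / Y \<le> b"
      unfolding b_def by (intro cInf_greatest[OF ne]) auto
    then have "X \<le> b * Y" using False Y0 by (simp add: divide_le_eq)
    also have "\<dots> \<le> 256 * Y" by (rule mult_right_mono[OF b Y0])
    finally show ?thesis .
  qed
  then show ?thesis by (simp add: X_def Y_def)
qed

end

section \<open>Square summable power series\<close>

lemma integral_poisson_polynomial:
  assumes r: "0 \<le> r" "r < 1" and \<zeta>: "cmod \<zeta> = 1"
  shows "(\<integral>w. (\<Sum>n<N. a n * w ^ n) * of_real (poisson_kernel r \<zeta> w) \<partial>circle) = (\<Sum>n<N. a n * (of_real r * \<zeta>) ^ n)"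
proof -
  have int: "integrable circle (\<lambda>w. w ^ n * complex_of_real (poisson_kernel r \<zeta> w))" for n
  proof (rule integrable_circle_bounded)
    show "(\<lambda>w. w ^ n * complex_of_real (poisson_kernel r \<zeta> w)) \<in> borel_measurable circle"
      using measurable_poisson_kernel_snd by measurable
    show "cmod (w ^ n * complex_of_real (poisson_kernel r \<zeta> w)) \<le> 1 / (1 - r)\<^sup>2" if "cmod w = 1" for w
      using that poisson_kernel_le[OF r \<zeta> that] poisson_kernel_nonneg[OF r, of \<zeta> w]
      by (simp add: norm_mult norm_power)
  qed
  have "(\<integral>w. (\<Sum>n<N. a n * w ^ n) * of_real (poisson_kernel r \<zeta> w) \<partial>circle)
      = (\<integral>w. (\<Sum>n<N. a n * (w ^ n * of_real (poisson_kernel r \<zeta> w))) \<partial>circle)"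
    by (simp only: sum_distrib_right mult.assoc)
  also have "\<dots> = (\<Sum>n<N. (\<integral>w. a n * (w ^ n * of_real (poisson_kernel r \<zeta> w)) \<partial>circle))"
    by (intro Bochner_Integration.integral_sum integrable_mult_right int)
  also have "\<dots> = (\<Sum>n<N. a n * (of_real r * \<zeta>) ^ n)"
    by (simp only: integral_mult_right_zero integral_poisson_kernel_power[OF r \<zeta>])
  finally show ?thesis .
qed

lemma polynomial_bound:
  assumes "cmod w \<le> 1" shows "cmod (\<Sum>n<N. a n * w ^ n) \<le> (\<Sum>n<N. cmod (a n))"
proof -
  have "cmod (\<Sum>n<N. a n * w ^ n) \<le> (\<Sum>n<N. cmod (a n * w ^ n))"
    by (rule norm_sum)
  also have "\<dots> \<le> (\<Sum>n<N. cmod (a n))"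
    using assms by (intro sum_mono) (simp add: norm_mult norm_power mult_left_le power_le_one)
  finally show ?thesis .
qed

lemma bounded_borel_polynomial: "bounded_borel (\<lambda>w. cmod (\<Sum>n<N. a n * w ^ n))"
proof (rule bounded_borelI)
  show "(\<lambda>w. cmod (\<Sum>n<N. a n * w ^ n)) \<in> borel_measurable circle"
    by measurable
  show "\<bar>cmod (\<Sum>n<N. a n * w ^ n)\<bar> \<le> (\<Sum>n<N. cmod (a n))" if "cmod w = 1" for w
    using polynomial_bound[of w a N] that by simp
qed

lemma cmod_polynomial_le_poisson:
  assumes r: "0 \<le> r" "r < 1" and \<zeta>: "cmod \<zeta> = 1"
  shows "cmod (\<Sum>n<N. a n * (of_real r * \<zeta>) ^ n) \<le> poisson r (\<lambda>w. cmod (\<Sum>n<N. a n * w ^ n)) \<zeta>"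
proof -
  have "cmod (\<Sum>n<N. a n * (of_real r * \<zeta>) ^ n)
      \<le> (\<integral>w. cmod ((\<Sum>n<N. a n * w ^ n) * of_real (poisson_kernel r \<zeta> w)) \<partial>circle)"
    unfolding integral_poisson_polynomial[OF r \<zeta>, symmetric] by (rule integral_norm_bound)
  also have "\<dots> = poisson r (\<lambda>w. cmod (\<Sum>n<N. a n * w ^ n)) \<zeta>"
    unfolding poisson_def
    by (intro Bochner_Integration.integral_cong refl)
       (simp add: norm_mult poisson_kernel_nonneg[OF r] mult.commute)
  finally show ?thesis .
qed

lemma integral_polynomial_sq:
  "(\<integral>w. (cmod (\<Sum>n<N. a n * w ^ n))\<^sup>2 \<partial>circle) = (\<Sum>n<N. (cmod (a n))\<^sup>2)"
proof -
  have int: "integrable circle (\<lambda>w. w ^ n * cnj w ^ m)" for n m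
    by (rule integrable_circle_bounded[where B = 1]; simp add: norm_mult norm_power)
  have "complex_of_real (\<integral>w. (cmod (\<Sum>n<N. a n * w ^ n))\<^sup>2 \<partial>circle)
      = (\<integral>w. (\<Sum>n<N. a n * w ^ n) * cnj (\<Sum>n<N. a n * w ^ n) \<partial>circle)"
    by (simp only: integral_complex_of_real[symmetric] complex_norm_square)
  also have "\<dots> = (\<integral>w. (\<Sum>n<N. \<Sum>m<N. (a n * cnj (a m)) * (w ^ n * cnj w ^ m)) \<partial>circle)"
    by (simp add: sum_product mult_ac)
  also have "\<dots> = (\<Sum>n<N. \<Sum>m<N. (a n * cnj (a m)) * (\<integral>w. w ^ n * cnj w ^ m \<partial>circle))"
  proof -
    have i: "integrable circle (\<lambda>w. (a n * cnj (a m)) * (w ^ n * cnj w ^ m))" for n m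
      by (rule integrable_mult_right) (rule int)
    have "(\<integral>w. (\<Sum>n<N. \<Sum>m<N. (a n * cnj (a m)) * (w ^ n * cnj w ^ m)) \<partial>circle)
        = (\<Sum>n<N. (\<integral>w. (\<Sum>m<N. (a n * cnj (a m)) * (w ^ n * cnj w ^ m)) \<partial>circle))"
      by (rule Bochner_Integration.integral_sum) (rule Bochner_Integration.integrable_sum, rule i)
    also have "\<dots> = (\<Sum>n<N. \<Sum>m<N. (\<integral>w. (a n * cnj (a m)) * (w ^ n * cnj w ^ m) \<partial>circle))"
      by (intro sum.cong refl Bochner_Integration.integral_sum i)
    finally show ?thesis by (simp only: integral_mult_right_zero)
  qed
  also have "\<dots> = (\<Sum>n<N. \<Sum>m<N. if n = m then a n * cnj (a m) else 0)"
    by (intro sum.cong refl) (simp add: integral_circle_moment)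
  also have "\<dots> = (\<Sum>n<N. a n * cnj (a n))"
    by (intro sum.cong refl) simp
  also have "\<dots> = complex_of_real (\<Sum>n<N. (cmod (a n))\<^sup>2)"
    by (simp only: complex_norm_square of_real_sum)
  finally show ?thesis by (simp only: of_real_eq_iff)
qed

lemma nn_integral_polynomial_max:
  assumes S: "finite S" "S \<noteq> {}" "S \<subseteq> {0..<1::real}"
  shows "(\<integral>\<^sup>+\<zeta>. (SUP r\<in>S. ennreal ((cmod (\<Sum>n<N. a n * (of_real r * \<zeta>) ^ n))\<^sup>2)) \<partial>circle)
    \<le> ennreal (256 * (\<Sum>n<N. (cmod (a n))\<^sup>2))"
proof -
  define p where "p w = cmod (\<Sum>n<N. a n * w ^ n)" for w
  have p: "bounded_borel p" unfolding p_def by (rule bounded_borel_polynomial)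
  define F where "F = poisson_max S p"
  have F: "bounded_borel F" unfolding F_def by (rule bounded_borel_poisson_max[OF S p])
  have pnn: "0 \<le> p \<zeta>" for \<zeta> by (simp add: p_def)
  have "(\<integral>\<^sup>+\<zeta>. (SUP r\<in>S. ennreal ((cmod (\<Sum>n<N. a n * (of_real r * \<zeta>) ^ n))\<^sup>2)) \<partial>circle)
      \<le> (\<integral>\<^sup>+\<zeta>. ennreal ((F \<zeta>)\<^sup>2) \<partial>circle)"
  proof (intro nn_integral_mono SUP_least ennreal_leI power_mono norm_ge_zero)
    fix \<zeta> r assume "\<zeta> \<in> space circle" "r \<in> S"
    then have "cmod (\<Sum>n<N. a n * (of_real r * \<zeta>) ^ n) \<le> poisson r p \<zeta>"
      unfolding p_def using S by (intro cmod_polynomial_le_poisson) auto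
    also have "\<dots> \<le> F \<zeta>" unfolding F_def by (rule poisson_le_max[OF S \<open>r \<in> S\<close>])
    finally show "cmod (\<Sum>n<N. a n * (of_real r * \<zeta>) ^ n) \<le> F \<zeta>" .
  qed
  also have "\<dots> = ennreal (\<integral>\<zeta>. (F \<zeta>)\<^sup>2 \<partial>circle)"
    by (rule nn_integral_eq_integral[OF bounded_borel_integrable[OF bounded_borel_power2[OF F]]]) simp
  also have "\<dots> \<le> ennreal (256 * (\<integral>\<zeta>. (p \<zeta>)\<^sup>2 \<partial>circle))"
    unfolding F_def by (intro ennreal_leI poisson_maximal_inequality S p pnn)
  also have "(\<integral>\<zeta>. (p \<zeta>)\<^sup>2 \<partial>circle) = (\<Sum>n<N. (cmod (a n))\<^sup>2)"
    unfolding p_def by (rule integral_polynomial_sq)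
  finally show ?thesis .
qed

text \<open>Monotone convergence reduces a countable supremum to finite ones.\<close>

lemma nn_integral_SUP_le:
  fixes u :: "nat \<Rightarrow> 'a \<Rightarrow> ennreal"
  assumes [measurable]: "\<And>i. u i \<in> borel_measurable M"
    and le: "\<And>k. (\<integral>\<^sup>+x. (SUP i\<in>{..k}. u i x) \<partial>M) \<le> C"
  shows "(\<integral>\<^sup>+x. (SUP i. u i x) \<partial>M) \<le> C"
proof -
  have eq: "(SUP i. u i x) = (SUP k. SUP i\<in>{..k}. u i x)" for x
  proof (rule antisym)
    show "(SUP i. u i x) \<le> (SUP k. SUP i\<in>{..k}. u i x)"
    proof (rule SUP_least)
      fix i
      have "u i x \<le> (SUP i\<in>{..i}. u i x)" by (rule SUP_upper) simp
      also have "\<dots> \<le> (SUP k. SUP i\<in>{..k}. u i x)" by (rule SUP_upper) simp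
      finally show "u i x \<le> (SUP k. SUP i\<in>{..k}. u i x)" .
    qed
    show "(SUP k. SUP i\<in>{..k}. u i x) \<le> (SUP i. u i x)"
      by (intro SUP_least SUP_upper) simp
  qed
  have "(\<integral>\<^sup>+x. (SUP i. u i x) \<partial>M) = (SUP k. (\<integral>\<^sup>+x. (SUP i\<in>{..k}. u i x) \<partial>M))"
    unfolding eq
  proof (rule nn_integral_monotone_convergence_SUP)
    show "incseq (\<lambda>k x. SUP i\<in>{..k}. u i x)"
      by (auto simp: incseq_def le_fun_def intro!: SUP_subset_mono)
    show "(\<lambda>x. SUP i\<in>{..k}. u i x) \<in> borel_measurable M" for k
      by (rule borel_measurable_SUP) (auto simp: countable_finite)
  qed
  also have "\<dots> \<le> C" by (rule SUP_least) (rule le)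
  finally show ?thesis .
qed

context
  fixes a :: "nat \<Rightarrow> complex"
  assumes sq_summable: "summable (\<lambda>n. (cmod (a n))\<^sup>2)"
begin

lemma sq_summable_imp_summable:
  assumes z: "cmod z < 1"
  shows "summable (\<lambda>n. cmod (a n * z ^ n))"
proof (rule summable_comparison_test')
  show "summable (\<lambda>n. (cmod (a n))\<^sup>2 + ((cmod z)\<^sup>2) ^ n)"
    using z by (intro summable_add sq_summable summable_geometric) (simp add: power_less_one_iff abs_square_less_1)
  show "norm (cmod (a n * z ^ n)) \<le> (cmod (a n))\<^sup>2 + ((cmod z)\<^sup>2) ^ n" for n
  proof -
    have "2 * cmod (a n) * cmod z ^ n \<le> (cmod (a n))\<^sup>2 + (cmod z ^ n)\<^sup>2"
      by (rule sum_squares_bound)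
    moreover have "0 \<le> cmod (a n) * cmod z ^ n" by simp
    ultimately have "cmod (a n) * cmod z ^ n \<le> (cmod (a n))\<^sup>2 + (cmod z ^ n)\<^sup>2"
      by linarith
    then show ?thesis by (simp add: norm_mult norm_power power_mult[symmetric] mult.commute)
  qed
qed

lemma sq_summable_holomorphic: "(\<lambda>z. \<Sum>n. a n * z ^ n) holomorphic_on ball 0 1"
proof (rule holomorphic_onI)
  fix z :: complex assume "z \<in> ball 0 1"
  then have "((\<lambda>z. \<Sum>n. a n * z ^ n) has_field_derivative (\<Sum>n. diffs a n * z ^ n)) (at z)"
    by (intro termdiffs_strong'[where K = 1]) (auto intro: summable_norm_cancel[OF sq_summable_imp_summable])
  then show "(\<lambda>z. \<Sum>n. a n * z ^ n) field_differentiable at z within ball 0 1"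
    using field_differentiable_at_within field_differentiable_def by blast
qed

text \<open>A polynomial is dominated on the circle of radius \<open>r\<close> by the Poisson integral of its modulus,
  so the maximal inequality bounds its supremum over finitely many radii. Monotone convergence extends
  this to all rational radii, Fatou's lemma to the power series, and continuity to all
  radii.\<close>

theorem hardy_maximal_function:
  obtains M where "M \<in> borel_measurable circle"
    "\<And>r \<zeta>. 0 \<le> r \<Longrightarrow> r < 1 \<Longrightarrow> cmod \<zeta> = 1 \<Longrightarrow> ennreal ((cmod (\<Sum>n. a n * (of_real r * \<zeta>) ^ n))\<^sup>2) \<le> M \<zeta>"
    "(\<integral>\<^sup>+\<zeta>. M \<zeta> \<partial>circle) \<le> ennreal (256 * (\<Sum>n. (cmod (a n))\<^sup>2))"
proof -
  define Q where "Q = \<rat> \<inter> {0..<1::real}"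
  define q where "q = from_nat_into Q"
  have Q: "countable Q" "Q \<noteq> {}"
    unfolding Q_def by (auto intro: countable_subset[OF _ countable_rat] intro!: exI[of _ 0])
  have rq: "range q = Q"
    unfolding q_def by (rule range_from_nat_into[OF Q(2) Q(1)])
  have q: "0 \<le> q i" "q i < 1" for i
    using rq by (auto simp: Q_def)
  define E where "E = (\<Sum>n. (cmod (a n))\<^sup>2)"
  define u where "u N i \<zeta> = ennreal ((cmod (\<Sum>n<N. a n * (of_real (q i) * \<zeta>) ^ n))\<^sup>2)" for N i \<zeta>
  define v where "v i \<zeta> = ennreal ((cmod (\<Sum>n. a n * (of_real (q i) * \<zeta>) ^ n))\<^sup>2)" for i \<zeta>
  have [measurable]: "u N i \<in> borel_measurable circle" for N i
    unfolding u_def by measurable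
  have [measurable]: "v i \<in> borel_measurable circle" for i
    unfolding v_def by measurable
  have uE: "(\<integral>\<^sup>+\<zeta>. (SUP i. u N i \<zeta>) \<partial>circle) \<le> ennreal (256 * E)" for N
  proof (rule nn_integral_SUP_le)
    fix k
    have "(\<integral>\<^sup>+\<zeta>. (SUP i\<in>{..k}. u N i \<zeta>) \<partial>circle)
        = (\<integral>\<^sup>+\<zeta>. (SUP r\<in>q ` {..k}. ennreal ((cmod (\<Sum>n<N. a n * (of_real r * \<zeta>) ^ n))\<^sup>2)) \<partial>circle)"
      by (simp add: u_def image_image)
    also have "\<dots> \<le> ennreal (256 * (\<Sum>n<N. (cmod (a n))\<^sup>2))"
      using q by (intro nn_integral_polynomial_max) auto
    also have "\<dots> \<le> ennreal (256 * E)"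
      unfolding E_def by (intro ennreal_leI mult_left_mono sum_le_suminf sq_summable) auto
    finally show "(\<integral>\<^sup>+\<zeta>. (SUP i\<in>{..k}. u N i \<zeta>) \<partial>circle) \<le> ennreal (256 * E)" .
  qed measurable
  define M where "M \<zeta> = (SUP i. v i \<zeta>)" for \<zeta>
  have Mm: "M \<in> borel_measurable circle"
    unfolding M_def by measurable
  have "M \<zeta> \<le> liminf (\<lambda>N. SUP i. u N i \<zeta>)" if \<zeta>: "\<zeta> \<in> space circle" for \<zeta>
    unfolding M_def
  proof (rule SUP_least)
    fix i
    have "(\<lambda>N. \<Sum>n<N. a n * (of_real (q i) * \<zeta>) ^ n) \<longlonglongrightarrow> (\<Sum>n. a n * (of_real (q i) * \<zeta>) ^ n)"
      using \<zeta> q[of i]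
      by (intro summable_LIMSEQ summable_norm_cancel[OF sq_summable_imp_summable]) (simp add: norm_mult)
    then have "(\<lambda>N. u N i \<zeta>) \<longlonglongrightarrow> v i \<zeta>"
      unfolding u_def v_def by (intro tendsto_ennrealI tendsto_intros)
    then have "v i \<zeta> = liminf (\<lambda>N. u N i \<zeta>)"
      by (intro lim_imp_Liminf[symmetric]) auto
    also have "\<dots> \<le> liminf (\<lambda>N. SUP i. u N i \<zeta>)"
      by (intro Liminf_mono always_eventually allI SUP_upper) simp
    finally show "v i \<zeta> \<le> liminf (\<lambda>N. SUP i. u N i \<zeta>)" .
  qed
  then have "(\<integral>\<^sup>+\<zeta>. M \<zeta> \<partial>circle) \<le> (\<integral>\<^sup>+\<zeta>. liminf (\<lambda>N. SUP i. u N i \<zeta>) \<partial>circle)"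
    by (rule nn_integral_mono)
  also have "\<dots> \<le> liminf (\<lambda>N. \<integral>\<^sup>+\<zeta>. (SUP i. u N i \<zeta>) \<partial>circle)"
    by (rule nn_integral_liminf) measurable
  also have "\<dots> \<le> liminf (\<lambda>N. ennreal (256 * E))"
    by (intro Liminf_mono always_eventually allI uE)
  also have "\<dots> = ennreal (256 * E)"
    by (simp add: Liminf_const)
  finally have ME: "(\<integral>\<^sup>+\<zeta>. M \<zeta> \<partial>circle) \<le> ennreal (256 * E)" .
  have MF: "ennreal ((cmod (\<Sum>n. a n * (of_real r * \<zeta>) ^ n))\<^sup>2) \<le> M \<zeta>"
    if r: "0 \<le> r" "r < 1" and \<zeta>: "cmod \<zeta> = 1" for r \<zeta>
  proof (rule ccontr)
    define w where "w t = ennreal ((cmod (\<Sum>n. a n * (of_real t * \<zeta>) ^ n))\<^sup>2)" for t :: real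
    assume "\<not> ?thesis"
    then have less: "M \<zeta> < w r" by (simp add: w_def not_le)
    have "of_real r * \<zeta> \<in> ball 0 1" using r \<zeta> by (simp add: norm_mult)
    then have "isCont (\<lambda>z. \<Sum>n. a n * z ^ n) (of_real r * \<zeta>)"
      using sq_summable_holomorphic by (auto simp: holomorphic_on_open intro: DERIV_isCont)
    then have "((\<lambda>t. \<Sum>n. a n * (of_real t * \<zeta>) ^ n) \<longlongrightarrow> (\<Sum>n. a n * (of_real r * \<zeta>) ^ n)) (at r)"
      by (rule isCont_tendsto_compose) (intro tendsto_intros)
    then have "(w \<longlongrightarrow> w r) (at r)"
      unfolding w_def by (intro tendsto_ennrealI tendsto_intros)
    then have "\<forall>\<^sub>F t in at r. M \<zeta> < w t"
      using less by (rule order_tendstoD)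
    then obtain d where d: "0 < d" "\<And>t. t \<noteq> r \<Longrightarrow> dist t r < d \<Longrightarrow> M \<zeta> < w t"
      unfolding eventually_at by auto
    obtain t where t: "t \<in> \<rat>" "r < t" "t < min 1 (r + d)"
      using Rats_dense_in_real[of r "min 1 (r + d)"] r d(1) by auto
    then have "t \<in> Q" using r by (simp add: Q_def)
    then obtain i where "q i = t" using rq by auto
    then have "w t \<le> M \<zeta>"
      unfolding M_def w_def v_def by (intro SUP_upper2[of i]) auto
    moreover have "M \<zeta> < w t" using t by (intro d(2)) (auto simp: dist_real_def)
    ultimately show False by simp
  qed
  show ?thesis by (rule that[OF Mm MF ME[unfolded E_def]])
qed

end

text \<open>Near 1 the values of \<open>F\<close> stay close to the limit \<open>l\<close> of an approximation, so they form a Cauchy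
  filter.\<close>

lemma cauchy_radial_limit:
  fixes F :: "real \<Rightarrow> complex"
  assumes "\<And>e. 0 < e \<Longrightarrow> \<exists>p l. (p \<longlongrightarrow> l) (at_left 1) \<and> (\<forall>r. 0 \<le> r \<longrightarrow> r < 1 \<longrightarrow> dist (F r) (p r) \<le> e)"
  shows "\<exists>l. (F \<longlongrightarrow> l) (at_left 1)"
proof -
  have "cauchy_filter (filtermap F (at_left 1))"
    unfolding cauchy_filter_metric_filtermap
  proof (intro allI impI)
    fix e :: real assume e: "0 < e"
    obtain p l where p: "(p \<longlongrightarrow> l) (at_left 1)" "\<And>r. 0 \<le> r \<Longrightarrow> r < 1 \<Longrightarrow> dist (F r) (p r) \<le> e / 5"
      using assms[of "e / 5"] e by auto
    define P where "P r \<longleftrightarrow> 0 \<le> r \<and> r < 1 \<and> dist (p r) l < e / 5" for r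
    have "\<forall>\<^sub>F r in at_left 1. dist (p r) l < e / 5"
      using p(1) e by (intro tendstoD) auto
    moreover have "\<forall>\<^sub>F r in at_left (1::real). r \<in> {0<..<1}"
      by (rule eventually_at_left_real) simp
    ultimately have "\<forall>\<^sub>F r in at_left 1. P r"
      by eventually_elim (simp add: P_def)
    moreover have "dist (F x) (F y) < e" if "P x" "P y" for x y
    proof -
      have "dist (F x) l < e / 2" if "P x" for x
        using that[unfolded P_def] p(2)[of x] dist_triangle[of "F x" l "p x"] e by linarith
      from this[OF that(1)] this[OF that(2)] show ?thesis by (rule dist_triangle_half_l)
    qed
    ultimately show "\<exists>P. eventually P (at_left 1) \<and> (\<forall>x y. P x \<and> P y \<longrightarrow> dist (F x) (F y) < e)"
      by blast
  qed
  then have "\<exists>l. filtermap F (at_left 1) \<le> nhds l"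
    using cauchy_filter_complete_converges[OF _ complete_UNIV, of "filtermap F (at_left 1)"]
    by (simp add: filtermap_bot_iff)
  then show ?thesis by (simp add: filterlim_def)
qed

text \<open>Let \<open>M k\<close> be the maximal function of the tail of the series from index \<open>k\<close> on. The integrals of \<open>M k\<close>
  tend to 0, so by Fatou's lemma the lower limit of \<open>M k\<close> vanishes almost everywhere. At such a
  point some partial sums approximate the series uniformly on the whole radius, as precisely as desired.\<close>

theorem ae_radial_limit:
  fixes a :: "nat \<Rightarrow> complex"
  assumes sq: "summable (\<lambda>n. (cmod (a n))\<^sup>2)"
  shows "AE \<zeta> in circle. \<exists>l. ((\<lambda>r. \<Sum>n. a n * (of_real r * \<zeta>) ^ n) \<longlongrightarrow> l) (at_left 1)"
proof -
  define b where "b k n = (if n < k then 0 else a n)" for k n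
  have bs: "summable (\<lambda>n. (cmod (b k n))\<^sup>2)" for k
    by (rule summable_comparison_test'[OF sq]) (simp add: b_def)
  define e where "e k = (\<Sum>n. (cmod (b k n))\<^sup>2)" for k
  have "e = (\<lambda>k. (\<Sum>n. (cmod (a n))\<^sup>2) - (\<Sum>n<k. (cmod (a n))\<^sup>2))"
  proof
    fix k
    have "e k = (\<Sum>n. (cmod (b k (n + k)))\<^sup>2) + (\<Sum>n<k. (cmod (b k n))\<^sup>2)"
      unfolding e_def by (rule suminf_split_initial_segment[OF bs])
    also have "\<dots> = (\<Sum>n. (cmod (a (n + k)))\<^sup>2)" by (simp add: b_def)
    finally show "e k = (\<Sum>n. (cmod (a n))\<^sup>2) - (\<Sum>n<k. (cmod (a n))\<^sup>2)"
      using suminf_split_initial_segment[OF sq, of k] by simp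
  qed
  then have "e \<longlonglongrightarrow> (\<Sum>n. (cmod (a n))\<^sup>2) - (\<Sum>n. (cmod (a n))\<^sup>2)"
    by (simp only:) (intro tendsto_diff tendsto_const summable_LIMSEQ sq)
  then have e0: "e \<longlonglongrightarrow> 0" by simp
  have "\<exists>M. M \<in> borel_measurable circle \<and>
      (\<forall>r \<zeta>. 0 \<le> r \<longrightarrow> r < 1 \<longrightarrow> cmod \<zeta> = 1 \<longrightarrow> ennreal ((cmod (\<Sum>n. b k n * (of_real r * \<zeta>) ^ n))\<^sup>2) \<le> M \<zeta>) \<and>
      (\<integral>\<^sup>+\<zeta>. M \<zeta> \<partial>circle) \<le> ennreal (256 * e k)" (is "\<exists>M. ?P k M") for k
  proof -
    obtain M where "M \<in> borel_measurable circle"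
      "\<And>r \<zeta>. 0 \<le> r \<Longrightarrow> r < 1 \<Longrightarrow> cmod \<zeta> = 1 \<Longrightarrow> ennreal ((cmod (\<Sum>n. b k n * (of_real r * \<zeta>) ^ n))\<^sup>2) \<le> M \<zeta>"
      "(\<integral>\<^sup>+\<zeta>. M \<zeta> \<partial>circle) \<le> ennreal (256 * (\<Sum>n. (cmod (b k n))\<^sup>2))"
      by (rule hardy_maximal_function[OF bs[of k]]) (rule that)
    then have "?P k M" by (simp add: e_def)
    then show ?thesis by (rule exI[of "?P k"])
  qed
  then have "\<forall>k. \<exists>M. ?P k M" by (rule allI)
  from choice[OF this] obtain M where PM: "\<forall>k. ?P k (M k)" by (rule exE)
  have M: "\<And>k. M k \<in> borel_measurable circle"
    "\<And>k r \<zeta>. 0 \<le> r \<Longrightarrow> r < 1 \<Longrightarrow> cmod \<zeta> = 1 \<Longrightarrow> ennreal ((cmod (\<Sum>n. b k n * (of_real r * \<zeta>) ^ n))\<^sup>2) \<le> M k \<zeta>"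
    "\<And>k. (\<integral>\<^sup>+\<zeta>. M k \<zeta> \<partial>circle) \<le> ennreal (256 * e k)"
    using PM by simp_all
  note M(1)[measurable]
  have "(\<integral>\<^sup>+\<zeta>. liminf (\<lambda>k. M k \<zeta>) \<partial>circle) \<le> liminf (\<lambda>k. \<integral>\<^sup>+\<zeta>. M k \<zeta> \<partial>circle)"
    by (rule nn_integral_liminf) measurable
  also have "\<dots> \<le> liminf (\<lambda>k. ennreal (256 * e k))"
    by (intro Liminf_mono always_eventually allI M(3))
  also have "\<dots> = ennreal (256 * 0)"
    using e0 by (intro lim_imp_Liminf tendsto_ennrealI tendsto_intros) auto
  finally have "(\<integral>\<^sup>+\<zeta>. liminf (\<lambda>k. M k \<zeta>) \<partial>circle) = 0" by simp
  then have "AE \<zeta> in circle. liminf (\<lambda>k. M k \<zeta>) = 0"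
    by (subst (asm) nn_integral_0_iff_AE) measurable
  then show ?thesis
    using AE_space
  proof eventually_elim
    case (elim \<zeta>)
    then have \<zeta>: "cmod \<zeta> = 1" by simp
    show ?case
    proof (rule cauchy_radial_limit)
      fix d :: real assume d: "0 < d"
      have "\<exists>k. M k \<zeta> < ennreal (d\<^sup>2)"
      proof (rule ccontr)
        assume "\<not> ?thesis"
        then have "ennreal (d\<^sup>2) \<le> liminf (\<lambda>k. M k \<zeta>)"
          by (intro Liminf_bounded always_eventually) (simp add: not_less)
        then show False using elim(1) d by simp
      qed
      then obtain k where k: "M k \<zeta> < ennreal (d\<^sup>2)" ..
      define p where "p r = (\<Sum>n<k. a n * (of_real r * \<zeta>) ^ n)" for r :: real
      have "(p \<longlongrightarrow> p 1) (at_left 1)"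
        unfolding p_def by (intro tendsto_intros)
      moreover have "dist (\<Sum>n. a n * (of_real r * \<zeta>) ^ n) (p r) \<le> d" if r: "0 \<le> r" "r < 1" for r
      proof -
        have z: "cmod (of_real r * \<zeta>) < 1" using r \<zeta> by (simp add: norm_mult)
        have s: "summable (\<lambda>n. a n * (of_real r * \<zeta>) ^ n)"
          by (rule summable_norm_cancel[OF sq_summable_imp_summable[OF sq z]])
        have s': "summable (\<lambda>n. b k n * (of_real r * \<zeta>) ^ n)"
          by (rule summable_norm_cancel[OF sq_summable_imp_summable[OF bs z]])
        have "(\<Sum>n. b k n * (of_real r * \<zeta>) ^ n) = (\<Sum>n. b k (n + k) * (of_real r * \<zeta>) ^ (n + k)) + (\<Sum>n<k. b k n * (of_real r * \<zeta>) ^ n)"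
          by (rule suminf_split_initial_segment[OF s'])
        also have "\<dots> = (\<Sum>n. a (n + k) * (of_real r * \<zeta>) ^ (n + k))" by (simp add: b_def)
        also have "\<dots> = (\<Sum>n. a n * (of_real r * \<zeta>) ^ n) - p r"
          using suminf_split_initial_segment[OF s, of k] by (simp add: p_def)
        finally have eq: "(\<Sum>n. a n * (of_real r * \<zeta>) ^ n) - p r = (\<Sum>n. b k n * (of_real r * \<zeta>) ^ n)" by simp
        have "ennreal ((cmod (\<Sum>n. b k n * (of_real r * \<zeta>) ^ n))\<^sup>2) < ennreal (d\<^sup>2)"
          using M(2)[OF r \<zeta>] k by (rule le_less_trans)
        then have "(cmod (\<Sum>n. b k n * (of_real r * \<zeta>) ^ n))\<^sup>2 < d\<^sup>2"
          by (simp add: ennreal_less_iff)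
        then have "cmod (\<Sum>n. b k n * (of_real r * \<zeta>) ^ n) < d"
          by (rule power2_less_imp_less) (rule less_imp_le[OF d])
        then show ?thesis by (simp only: dist_norm eq)
      qed
      ultimately show "\<exists>p l. (p \<longlongrightarrow> l) (at_left 1) \<and>
          (\<forall>r. 0 \<le> r \<longrightarrow> r < 1 \<longrightarrow> dist (\<Sum>n. a n * (of_real r * \<zeta>) ^ n) (p r) \<le> d)"
        by blast
    qed
  qed
qed

section \<open>Boundary functions of the Hardy class\<close>

definition radial_boundary :: "(complex \<Rightarrow> complex) \<Rightarrow> (complex \<Rightarrow> complex) \<Rightarrow> bool" where
  "radial_boundary F f \<longleftrightarrow> (AE \<zeta> in circle. ((\<lambda>r. F (of_real r * \<zeta>)) \<longlongrightarrow> f \<zeta>) (at_left 1))"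

text \<open>Any sequence in \<open>[0, 1)\<close> that tends to 1 would do; it replaces the limit \<open>r \<rightarrow> 1\<close> by a sequential
  one, as the measurability and convergence theorems require.\<close>

definition radius :: "nat \<Rightarrow> real" where
  "radius k = 1 - 1 / (real k + 2)"

lemma radius: "0 \<le> radius k" "radius k < 1"
  by (auto simp: radius_def field_simps)

lemma filterlim_radius: "filterlim radius (at_left 1) sequentially"
proof (rule tendsto_imp_filterlim_at_left)
  have "(\<lambda>k. 1 - 1 / real (k + 2)) \<longlonglongrightarrow> 1 - 0"
    by (intro tendsto_diff tendsto_const LIMSEQ_ignore_initial_segment lim_1_over_n)
  then show "radius \<longlonglongrightarrow> 1"
    by (simp add: radius_def[abs_def] add.commute)
qed (simp add: radius always_eventually)

lemma radial_boundary_radius: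
  assumes "radial_boundary F f"
  shows "AE \<zeta> in circle. (\<lambda>k. F (of_real (radius k) * \<zeta>)) \<longlonglongrightarrow> f \<zeta>"
  using assms unfolding radial_boundary_def
  by eventually_elim (rule filterlim_compose[OF _ filterlim_radius])

lemma holomorphic_dilate:
  assumes F: "F holomorphic_on ball 0 1" and r: "0 \<le> r" "r < 1"
  shows "(\<lambda>\<zeta>. F (of_real r * \<zeta>)) \<in> borel_measurable circle" (is ?m)
    and "\<exists>B. \<forall>\<zeta>. cmod \<zeta> = 1 \<longrightarrow> cmod (F (of_real r * \<zeta>)) \<le> B" (is ?b)
proof -
  have c: "continuous_on (sphere 0 1) (\<lambda>\<zeta>. F (of_real r * \<zeta>))"
    by (rule continuous_on_compose2[OF holomorphic_on_imp_continuous_on[OF F]])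
       (use r in \<open>auto intro!: continuous_intros simp: norm_mult\<close>)
  show ?m
    using borel_measurable_continuous_on_restrict[OF c] by (simp add: circle_def)
  have "bounded ((\<lambda>\<zeta>. F (of_real r * \<zeta>)) ` sphere 0 1)"
    by (intro compact_imp_bounded compact_continuous_image c compact_sphere)
  then obtain B where "\<forall>w\<in>(\<lambda>\<zeta>. F (of_real r * \<zeta>)) ` sphere 0 1. cmod w \<le> B"
    unfolding bounded_iff by blast
  then show ?b
    by (intro exI[of _ B]) simp
qed

lemma sq_integrable_dilate:
  assumes "F holomorphic_on ball 0 1" "0 \<le> r" "r < 1"
  shows "sq_integrable (\<lambda>\<zeta>. F (of_real r * \<zeta>))"
proof -
  obtain B where "\<And>\<zeta>. cmod \<zeta> = 1 \<Longrightarrow> cmod (F (of_real r * \<zeta>)) \<le> B"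
    using holomorphic_dilate(2)[OF assms] by blast
  then show ?thesis
    by (rule sq_integrable_bounded[OF holomorphic_dilate(1)[OF assms]])
qed

lemma power_series_of_holomorphic:
  assumes F: "F holomorphic_on ball 0 1"
  obtains c where "\<And>z. cmod z < 1 \<Longrightarrow> (\<lambda>n. c n * z ^ n) sums F z"
    "\<And>z. cmod z < 1 \<Longrightarrow> summable (\<lambda>n. cmod (c n * z ^ n))"
proof -
  define c where "c n = (deriv ^^ n) F 0 / fact n" for n
  have s: "(\<lambda>n. c n * z ^ n) sums F z" if "cmod z < 1" for z
    using holomorphic_power_series[OF F, of z] that by (simp add: c_def)
  have "summable (\<lambda>n. cmod (c n * z ^ n))" if z: "cmod z < 1" for z
  proof (rule powser_insidea)
    define w where "w = complex_of_real ((cmod z + 1) / 2)"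
    have w: "cmod w = (cmod z + 1) / 2"
      unfolding w_def norm_of_real by (rule abs_of_nonneg) simp
    show "summable (\<lambda>n. c n * w ^ n)"
      by (rule sums_summable[OF s]) (use w z in simp)
    show "cmod z < cmod w" using w z by simp
  qed
  with s show ?thesis by (rule that)
qed

lemma sums_integral_dilate:
  assumes c: "\<And>z. cmod z < 1 \<Longrightarrow> (\<lambda>n. c n * z ^ n) sums F z"
    and s: "\<And>z. cmod z < 1 \<Longrightarrow> summable (\<lambda>n. cmod (c n * z ^ n))"
    and r: "0 \<le> r" "r < 1" and g: "integrable circle g"
  shows "(\<lambda>n. c n * of_real r ^ n * (\<integral>\<zeta>. \<zeta> ^ n * g \<zeta> \<partial>circle)) sums (\<integral>\<zeta>. F (of_real r * \<zeta>) * g \<zeta> \<partial>circle)"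
proof -
  have "(\<lambda>n. c n * of_real r ^ n * (\<integral>\<zeta>. \<zeta> ^ n * g \<zeta> \<partial>circle)) sums
      (\<integral>\<zeta>. (\<Sum>n. c n * of_real r ^ n * \<zeta> ^ n) * g \<zeta> \<partial>circle)"
    using s[of "of_real r"] r by (intro sums_integral_power_series g) simp
  also have "(\<integral>\<zeta>. (\<Sum>n. c n * of_real r ^ n * \<zeta> ^ n) * g \<zeta> \<partial>circle) = (\<integral>\<zeta>. F (of_real r * \<zeta>) * g \<zeta> \<partial>circle)"
  proof (intro Bochner_Integration.integral_cong refl)
    fix \<zeta> assume "\<zeta> \<in> space circle"
    then have "cmod (of_real r * \<zeta>) < 1" using r by (simp add: norm_mult)
    from sums_unique[OF c[OF this]]
    show "(\<Sum>n. c n * of_real r ^ n * \<zeta> ^ n) * g \<zeta> = F (of_real r * \<zeta>) * g \<zeta>"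
      by (simp add: power_mult_distrib mult.assoc)
  qed
  finally show ?thesis .
qed

text \<open>The defining bound of the Hardy class makes the dilates bounded in \<open>L\<^sup>2\<close>, and they converge almost
  everywhere to the boundary function.\<close>

lemma hardy_dilate_weak_limit:
  assumes F: "F \<in> hardy_disk" and b: "radial_boundary F f" and f: "sq_integrable f" and g: "sq_integrable g"
  shows "(\<lambda>k. \<integral>\<zeta>. F (of_real (radius k) * \<zeta>) * g \<zeta> \<partial>circle) \<longlonglongrightarrow> (\<integral>\<zeta>. f \<zeta> * g \<zeta> \<partial>circle)"
proof -
  have hol: "F holomorphic_on ball 0 1" using F by (simp add: hardy_disk_def)
  obtain C where C: "\<And>r. 0 \<le> r \<Longrightarrow> r < 1 \<Longrightarrow> (\<integral>\<zeta>. (cmod (F (of_real r * \<zeta>)))\<^sup>2 \<partial>circle) \<le> C"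
    using F by (force simp: hardy_disk_def)
  define Fk where "Fk k \<zeta> = F (of_real (radius k) * \<zeta>)" for k \<zeta>
  have Fk: "sq_integrable (Fk k)" for k
    unfolding Fk_def by (intro sq_integrable_dilate hol radius)
  have mf: "sq_integrable (\<lambda>\<zeta>. - f \<zeta>)"
    using sq_integrable_mult_bounded[OF f, of "\<lambda>_. -1" 1] by simp
  define u where "u k \<zeta> = Fk k \<zeta> + - f \<zeta>" for k \<zeta>
  have u: "sq_integrable (u k)" for k
    unfolding u_def by (rule sq_integrable_add[OF Fk mf])
  have i2: "integrable circle (\<lambda>\<zeta>. (cmod (Fk k \<zeta>))\<^sup>2)" "integrable circle (\<lambda>\<zeta>. (cmod (f \<zeta>))\<^sup>2)"
    "integrable circle (\<lambda>\<zeta>. (cmod (u k \<zeta>))\<^sup>2)" for k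
    using Fk f u by (auto simp: sq_integrable_def)
  have "(\<lambda>k. \<integral>\<zeta>. u k \<zeta> * g \<zeta> \<partial>circle) \<longlonglongrightarrow> 0"
  proof (rule weak_convergence_circle[OF u _ _ g])
    fix k
    have sq: "(cmod (x + - y))\<^sup>2 \<le> 2 * (cmod x)\<^sup>2 + 2 * (cmod y)\<^sup>2" for x y
      using cmod_add_power2_le[of x "- y"] by simp
    have "(\<integral>\<zeta>. (cmod (u k \<zeta>))\<^sup>2 \<partial>circle) \<le> (\<integral>\<zeta>. 2 * (cmod (Fk k \<zeta>))\<^sup>2 + 2 * (cmod (f \<zeta>))\<^sup>2 \<partial>circle)"
      unfolding u_def
      by (intro integral_mono i2[unfolded u_def] Bochner_Integration.integrable_add integrable_mult_right sq)
    also have "\<dots> = 2 * (\<integral>\<zeta>. (cmod (Fk k \<zeta>))\<^sup>2 \<partial>circle) + 2 * (\<integral>\<zeta>. (cmod (f \<zeta>))\<^sup>2 \<partial>circle)"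
      by (subst Bochner_Integration.integral_add) (intro integrable_mult_right i2 | simp)+
    also have "\<dots> \<le> 2 * C + 2 * (\<integral>\<zeta>. (cmod (f \<zeta>))\<^sup>2 \<partial>circle)"
      using C[OF radius, of k] by (simp add: Fk_def)
    finally show "(\<integral>\<zeta>. (cmod (u k \<zeta>))\<^sup>2 \<partial>circle) \<le> 2 * C + 2 * (\<integral>\<zeta>. (cmod (f \<zeta>))\<^sup>2 \<partial>circle)" .
  next
    show "AE \<zeta> in circle. (\<lambda>k. u k \<zeta>) \<longlonglongrightarrow> 0"
      using radial_boundary_radius[OF b]
    proof eventually_elim
      case (elim \<zeta>)
      then have "(\<lambda>k. Fk k \<zeta> + - f \<zeta>) \<longlonglongrightarrow> f \<zeta> + - f \<zeta>"
        unfolding Fk_def by (intro tendsto_add tendsto_const)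
      then show ?case by (simp add: u_def)
    qed
  qed
  then have "(\<lambda>k. (\<integral>\<zeta>. u k \<zeta> * g \<zeta> \<partial>circle) + (\<integral>\<zeta>. f \<zeta> * g \<zeta> \<partial>circle)) \<longlonglongrightarrow> 0 + (\<integral>\<zeta>. f \<zeta> * g \<zeta> \<partial>circle)"
    by (intro tendsto_add tendsto_const)
  also have "(\<lambda>k. (\<integral>\<zeta>. u k \<zeta> * g \<zeta> \<partial>circle) + (\<integral>\<zeta>. f \<zeta> * g \<zeta> \<partial>circle)) = (\<lambda>k. \<integral>\<zeta>. F (of_real (radius k) * \<zeta>) * g \<zeta> \<partial>circle)"
  proof
    fix k
    have "(\<integral>\<zeta>. u k \<zeta> * g \<zeta> \<partial>circle) + (\<integral>\<zeta>. f \<zeta> * g \<zeta> \<partial>circle) = (\<integral>\<zeta>. u k \<zeta> * g \<zeta> + f \<zeta> * g \<zeta> \<partial>circle)"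
      by (intro Bochner_Integration.integral_add[symmetric] integrable_mult_sq_integrable u f g)
    also have "\<dots> = (\<integral>\<zeta>. F (of_real (radius k) * \<zeta>) * g \<zeta> \<partial>circle)"
      by (intro Bochner_Integration.integral_cong refl) (simp add: u_def Fk_def algebra_simps)
    finally show "(\<integral>\<zeta>. u k \<zeta> * g \<zeta> \<partial>circle) + (\<integral>\<zeta>. f \<zeta> * g \<zeta> \<partial>circle) = (\<integral>\<zeta>. F (of_real (radius k) * \<zeta>) * g \<zeta> \<partial>circle)" .
  qed
  finally show ?thesis by simp
qed

text \<open>For a dilate the integral vanishes term by term in the power series; the boundary function is a
  weak limit of dilates.\<close>

lemma hardy_boundary_annihilator:
  assumes F: "F \<in> hardy_disk" and b: "radial_boundary F f" and f: "sq_integrable f" and g: "sq_integrable g"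
    and zero: "\<And>n. (\<integral>\<zeta>. \<zeta> ^ n * g \<zeta> \<partial>circle) = 0"
  shows "(\<integral>\<zeta>. f \<zeta> * g \<zeta> \<partial>circle) = 0"
proof -
  have hol: "F holomorphic_on ball 0 1" using F by (simp add: hardy_disk_def)
  obtain c where c: "\<And>z. cmod z < 1 \<Longrightarrow> (\<lambda>n. c n * z ^ n) sums F z"
    "\<And>z. cmod z < 1 \<Longrightarrow> summable (\<lambda>n. cmod (c n * z ^ n))"
    using power_series_of_holomorphic[OF hol] by blast
  have "(\<integral>\<zeta>. F (of_real (radius k) * \<zeta>) * g \<zeta> \<partial>circle) = 0" for k
    using sums_unique[OF sums_integral_dilate[OF c radius integrable_sq_integrable[OF g], of k]]
    by (simp add: zero)
  then have "(\<lambda>k. 0) \<longlonglongrightarrow> (\<integral>\<zeta>. f \<zeta> * g \<zeta> \<partial>circle)"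
    using hardy_dilate_weak_limit[OF F b f g] by simp
  then show ?thesis using LIMSEQ_unique[OF tendsto_const] by metis
qed

lemma sq_integrable_monomial: "sq_integrable (\<lambda>\<zeta>. \<zeta> ^ n * cnj \<zeta> ^ m)"
  by (rule sq_integrable_bounded[where B = 1]) (measurable, simp add: norm_mult norm_power)

lemma sq_integrable_monomial_mult:
  assumes "sq_integrable f"
  shows "sq_integrable (\<lambda>\<zeta>. \<zeta> ^ n * cnj \<zeta> ^ m * f \<zeta>)"
proof (rule sq_integrable_mult_bounded[OF assms])
  show "(\<lambda>\<zeta>. \<zeta> ^ n * cnj \<zeta> ^ m) \<in> borel_measurable circle"
    by measurable
  show "AE \<zeta> in circle. cmod (\<zeta> ^ n * cnj \<zeta> ^ m) \<le> 1"
    by (rule AE_I2) (simp add: norm_mult norm_power)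
qed

lemma hardy_boundary_negative_moments:
  assumes "F \<in> hardy_disk" "radial_boundary F f" "sq_integrable f"
  shows "(\<integral>\<zeta>. f \<zeta> * \<zeta> ^ Suc m \<partial>circle) = 0"
proof (rule hardy_boundary_annihilator[OF assms])
  show "sq_integrable (\<lambda>\<zeta>. \<zeta> ^ Suc m)"
    using sq_integrable_monomial[of "Suc m" 0] by simp
  show "(\<integral>\<zeta>. \<zeta> ^ n * \<zeta> ^ Suc m \<partial>circle) = 0" for n
    by (simp only: power_add[symmetric] integral_circle_power) simp
qed

text \<open>The second factor \<open>\<zeta> h \<zeta>\<close> annihilates all nonnegative powers, since the negative Fourier coefficients of \<open>h\<close>
  vanish. This is the orthogonality of \<open>H\<^sup>2\<close> and \<open>H\<^sup>2\<^sub>-\<close>, as \<open>\<zeta> h \<zeta>\<close> is the conjugate of an element of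
  \<open>H\<^sup>2\<^sub>-\<close>.\<close>

lemma hardy_boundary_orthogonal:
  assumes f: "F \<in> hardy_disk" "radial_boundary F f" "sq_integrable f"
    and h: "H \<in> hardy_disk" "radial_boundary H h" "sq_integrable h"
  shows "(\<integral>\<zeta>. f \<zeta> * (\<zeta> * h \<zeta>) \<partial>circle) = 0"
proof (rule hardy_boundary_annihilator[OF f])
  show "sq_integrable (\<lambda>\<zeta>. \<zeta> * h \<zeta>)"
    using sq_integrable_monomial_mult[OF h(3), of 1 0] by simp
  show "(\<integral>\<zeta>. \<zeta> ^ n * (\<zeta> * h \<zeta>) \<partial>circle) = 0" for n
    using hardy_boundary_negative_moments[OF h, of n] by (simp add: mult_ac)
qed

text \<open>The maximal function bounds all dilates at once. So it shows that the sum of the series is in the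
  Hardy class and that the boundary function, a limit of dilates, is square integrable. Its Fourier
  coefficients are limits of those of the dilates.\<close>

theorem hardy_boundary_exists:
  assumes sq: "summable (\<lambda>n. (cmod (a n))\<^sup>2)"
  obtains F f where "F \<in> hardy_disk" "radial_boundary F f" "sq_integrable f"
    "\<And>n. (\<integral>\<zeta>. f \<zeta> * cnj \<zeta> ^ n \<partial>circle) = a n"
proof -
  define F where "F z = (\<Sum>n. a n * z ^ n)" for z
  have hol: "F holomorphic_on ball 0 1"
    unfolding F_def by (rule sq_summable_holomorphic[OF sq])
  define C where "C = 256 * (\<Sum>n. (cmod (a n))\<^sup>2)"
  obtain M where M: "M \<in> borel_measurable circle"
    "\<And>r \<zeta>. 0 \<le> r \<Longrightarrow> r < 1 \<Longrightarrow> cmod \<zeta> = 1 \<Longrightarrow> ennreal ((cmod (F (of_real r * \<zeta>)))\<^sup>2) \<le> M \<zeta>"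
    "(\<integral>\<^sup>+\<zeta>. M \<zeta> \<partial>circle) \<le> ennreal C"
    by (rule hardy_maximal_function[OF sq, folded F_def C_def]) (rule that)
  have C0: "0 \<le> C" unfolding C_def by (intro mult_nonneg_nonneg suminf_nonneg sq) auto
  have "(\<integral>\<zeta>. (cmod (F (of_real r * \<zeta>)))\<^sup>2 \<partial>circle) \<le> C" if r: "0 \<le> r" "r < 1" for r
  proof (rule integral_real_bounded[OF C0])
    have "(\<integral>\<^sup>+\<zeta>. ennreal ((cmod (F (of_real r * \<zeta>)))\<^sup>2) \<partial>circle) \<le> (\<integral>\<^sup>+\<zeta>. M \<zeta> \<partial>circle)"
      by (intro nn_integral_mono M(2) r) simp
    also note M(3)
    finally show "(\<integral>\<^sup>+\<zeta>. ennreal ((cmod (F (of_real r * \<zeta>)))\<^sup>2) \<partial>circle) \<le> ennreal C" .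
  qed
  then have Fh: "F \<in> hardy_disk"
    unfolding hardy_disk_def by (intro CollectI conjI hol exI[of _ C] ballI) simp
  define f where "f \<zeta> = lim (\<lambda>k. F (of_real (radius k) * \<zeta>))" for \<zeta>
  have fm: "f \<in> borel_measurable circle"
    unfolding f_def by (intro borel_measurable_lim_metric holomorphic_dilate[OF hol] radius)
  have b: "radial_boundary F f"
    unfolding radial_boundary_def using ae_radial_limit[OF sq, folded F_def]
  proof eventually_elim
    case (elim \<zeta>)
    then obtain l where l: "((\<lambda>r. F (of_real r * \<zeta>)) \<longlongrightarrow> l) (at_left 1)"
      by (rule exE)
    then have "(\<lambda>k. F (of_real (radius k) * \<zeta>)) \<longlonglongrightarrow> l"
      by (rule filterlim_compose[OF _ filterlim_radius])
    then have "f \<zeta> = l" unfolding f_def by (rule limI)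
    with l show ?case by simp
  qed
  have "(\<integral>\<^sup>+\<zeta>. ennreal ((cmod (f \<zeta>))\<^sup>2) \<partial>circle) \<le> (\<integral>\<^sup>+\<zeta>. M \<zeta> \<partial>circle)"
  proof (rule nn_integral_mono_AE)
    show "AE \<zeta> in circle. ennreal ((cmod (f \<zeta>))\<^sup>2) \<le> M \<zeta>"
      using radial_boundary_radius[OF b] AE_space
    proof eventually_elim
      case (elim \<zeta>)
      have "(\<lambda>k. ennreal ((cmod (F (of_real (radius k) * \<zeta>)))\<^sup>2)) \<longlonglongrightarrow> ennreal ((cmod (f \<zeta>))\<^sup>2)"
        by (intro tendsto_ennrealI tendsto_intros elim)
      then show ?case
        by (rule Lim_bounded[where M = 0]) (use elim in \<open>auto intro!: M(2) radius\<close>)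
    qed
  qed
  also have "\<dots> < \<infinity>" using M(3) by (auto simp: le_less_trans)
  finally have f: "sq_integrable f"
    unfolding sq_integrable_def using fm by (auto intro!: integrableI_bounded)
  have "(\<integral>\<zeta>. f \<zeta> * cnj \<zeta> ^ n \<partial>circle) = a n" for n
  proof -
    have g: "sq_integrable (\<lambda>\<zeta>. cnj \<zeta> ^ n)" using sq_integrable_monomial[of 0 n] by simp
    have s: "summable (\<lambda>n. cmod (a n * z ^ n))" if "cmod z < 1" for z
      by (rule sq_summable_imp_summable[OF sq that])
    have c: "(\<lambda>n. a n * z ^ n) sums F z" if "cmod z < 1" for z
      unfolding F_def by (rule summable_sums[OF summable_norm_cancel[OF s[OF that]]])
    have "(\<integral>\<zeta>. F (of_real (radius k) * \<zeta>) * cnj \<zeta> ^ n \<partial>circle) = a n * of_real (radius k) ^ n" for k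
    proof -
      have "(\<lambda>m. a m * of_real (radius k) ^ m * (\<integral>\<zeta>. \<zeta> ^ m * cnj \<zeta> ^ n \<partial>circle)) sums
          (\<integral>\<zeta>. F (of_real (radius k) * \<zeta>) * cnj \<zeta> ^ n \<partial>circle)"
        by (rule sums_integral_dilate[OF c s radius integrable_sq_integrable[OF g]])
      also have "(\<lambda>m. a m * of_real (radius k) ^ m * (\<integral>\<zeta>. \<zeta> ^ m * cnj \<zeta> ^ n \<partial>circle))
          = (\<lambda>m. if m = n then a m * of_real (radius k) ^ m else 0)"
        by (simp add: fun_eq_iff integral_circle_moment)
      finally show ?thesis
        using sums_unique2 sums_single[of n "\<lambda>m. a m * of_real (radius k) ^ m"] by blast
    qed
    then have "(\<lambda>k. a n * of_real (radius k) ^ n) \<longlonglongrightarrow> (\<integral>\<zeta>. f \<zeta> * cnj \<zeta> ^ n \<partial>circle)"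
      using hardy_dilate_weak_limit[OF Fh b f g] by simp
    moreover have "(\<lambda>k. a n * of_real (radius k) ^ n) \<longlonglongrightarrow> a n * of_real 1 ^ n"
      using filterlim_radius by (intro tendsto_intros) (simp add: filterlim_at)
    ultimately show ?thesis using LIMSEQ_unique by force
  qed
  with Fh b f show ?thesis by (rule that)
qed

section \<open>Uniqueness of Fourier coefficients and the decomposition\<close>

text \<open>On the circle \<open>cnj \<zeta>\<close> is the inverse of \<open>\<zeta>\<close>, so the two families of moments are the Fourier
  coefficients for all integer exponents.\<close>

definition trig_null :: "(complex \<Rightarrow> complex) \<Rightarrow> bool" where
  "trig_null f \<longleftrightarrow> integrable circle f \<and>
     (\<forall>n. (\<integral>\<zeta>. \<zeta> ^ n * f \<zeta> \<partial>circle) = 0 \<and> (\<integral>\<zeta>. cnj \<zeta> ^ n * f \<zeta> \<partial>circle) = 0)"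

lemma integrable_mult_bounded:
  assumes "integrable circle f" and [measurable]: "g \<in> borel_measurable circle"
    and g: "\<And>\<zeta>. cmod \<zeta> = 1 \<Longrightarrow> cmod (g \<zeta>) \<le> B"
  shows "integrable circle (\<lambda>\<zeta>. g \<zeta> * f \<zeta>)"
proof (rule Bochner_Integration.integrable_bound)
  show "integrable circle (\<lambda>\<zeta>. B * cmod (f \<zeta>))"
    using assms(1) by (intro integrable_mult_right integrable_norm)
  show "(\<lambda>\<zeta>. g \<zeta> * f \<zeta>) \<in> borel_measurable circle"
    using assms(1) by measurable
  show "AE \<zeta> in circle. norm (g \<zeta> * f \<zeta>) \<le> norm (B * cmod (f \<zeta>))"
  proof (rule AE_I2)
    fix \<zeta> assume "\<zeta> \<in> space circle"
    then have "cmod (g \<zeta>) \<le> \<bar>B\<bar>" using g[of \<zeta>] by simp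
    then show "norm (g \<zeta> * f \<zeta>) \<le> norm (B * cmod (f \<zeta>))"
      by (simp add: norm_mult abs_mult mult_right_mono)
  qed
qed

lemma trig_null_integrable_power:
  assumes "trig_null f"
  shows "integrable circle (\<lambda>\<zeta>. \<zeta> ^ n * f \<zeta>)" "integrable circle (\<lambda>\<zeta>. cnj \<zeta> ^ n * f \<zeta>)"
  using assms by (auto simp: trig_null_def norm_power intro!: integrable_mult_bounded[where B = 1])

lemma trig_null_add:
  assumes f: "trig_null f" and g: "trig_null g"
  shows "trig_null (\<lambda>\<zeta>. f \<zeta> + g \<zeta>)"
  using assms trig_null_integrable_power[OF f] trig_null_integrable_power[OF g]
  by (simp add: trig_null_def ring_distribs)

lemma trig_null_cmult:
  assumes f: "trig_null f"
  shows "trig_null (\<lambda>\<zeta>. c * f \<zeta>)"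
  using assms by (simp add: trig_null_def mult.left_commute[of _ c])

lemma trig_null_cong:
  assumes "trig_null f" "\<And>\<zeta>. cmod \<zeta> = 1 \<Longrightarrow> f \<zeta> = g \<zeta>"
  shows "trig_null g"
proof -
  have "integrable circle f \<longleftrightarrow> integrable circle g"
    by (rule Bochner_Integration.integrable_cong) (auto simp: assms)
  moreover have "(\<integral>\<zeta>. \<zeta> ^ n * f \<zeta> \<partial>circle) = (\<integral>\<zeta>. \<zeta> ^ n * g \<zeta> \<partial>circle)"
    "(\<integral>\<zeta>. cnj \<zeta> ^ n * f \<zeta> \<partial>circle) = (\<integral>\<zeta>. cnj \<zeta> ^ n * g \<zeta> \<partial>circle)" for n
    by (auto intro!: Bochner_Integration.integral_cong simp: assms)
  ultimately show ?thesis using assms(1) by (simp add: trig_null_def)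
qed

lemma trig_null_shift:
  assumes f: "trig_null f"
  shows "trig_null (\<lambda>\<zeta>. \<zeta> * f \<zeta>)" "trig_null (\<lambda>\<zeta>. cnj \<zeta> * f \<zeta>)"
proof -
  have cancel: "\<zeta> ^ Suc m * (cnj \<zeta> * w) = \<zeta> ^ m * w" "cnj \<zeta> ^ Suc m * (\<zeta> * w) = cnj \<zeta> ^ m * w"
    if "cmod \<zeta> = 1" for \<zeta> w m
    using cnj_eq_inverse_circle[OF that] by (simp_all add: algebra_simps)
  have 1: "(\<integral>\<zeta>. \<zeta> ^ n * (\<zeta> * f \<zeta>) \<partial>circle) = 0" for n
    using f[unfolded trig_null_def, THEN conjunct2, rule_format, of "Suc n"] by (simp add: mult_ac)
  have 2: "(\<integral>\<zeta>. cnj \<zeta> ^ n * (cnj \<zeta> * f \<zeta>) \<partial>circle) = 0" for n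
    using f[unfolded trig_null_def, THEN conjunct2, rule_format, of "Suc n"] by (simp add: mult_ac)
  have 3: "(\<integral>\<zeta>. cnj \<zeta> ^ n * (\<zeta> * f \<zeta>) \<partial>circle) = 0" for n
  proof (cases n)
    case 0
    then show ?thesis using 1[of 0] by simp
  next
    case (Suc m)
    have "(\<integral>\<zeta>. cnj \<zeta> ^ Suc m * (\<zeta> * f \<zeta>) \<partial>circle) = (\<integral>\<zeta>. cnj \<zeta> ^ m * f \<zeta> \<partial>circle)"
      by (intro Bochner_Integration.integral_cong refl cancel) simp
    then show ?thesis using f Suc by (simp add: trig_null_def)
  qed
  have 4: "(\<integral>\<zeta>. \<zeta> ^ n * (cnj \<zeta> * f \<zeta>) \<partial>circle) = 0" for n
  proof (cases n)
    case 0
    then show ?thesis using 2[of 0] by simp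
  next
    case (Suc m)
    have "(\<integral>\<zeta>. \<zeta> ^ Suc m * (cnj \<zeta> * f \<zeta>) \<partial>circle) = (\<integral>\<zeta>. \<zeta> ^ m * f \<zeta> \<partial>circle)"
      by (intro Bochner_Integration.integral_cong refl cancel) simp
    then show ?thesis using f Suc by (simp add: trig_null_def)
  qed
  show "trig_null (\<lambda>\<zeta>. \<zeta> * f \<zeta>)" "trig_null (\<lambda>\<zeta>. cnj \<zeta> * f \<zeta>)"
    using 1 2 3 4 trig_null_integrable_power[OF f, of 1] by (simp_all add: trig_null_def)
qed

text \<open>The class is stable under multiplication by \<open>\<zeta>\<close> and \<open>cnj \<zeta>\<close>, hence by real linear functionals, which
  are combinations of the two, hence by real polynomials in the coordinates. Generalizing over \<open>f\<close> makes
  the induction pass through products.\<close>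

lemma trig_null_real_polynomial:
  assumes "real_polynomial_function p" "trig_null f"
  shows "trig_null (\<lambda>\<zeta>. of_real (p \<zeta>) * f \<zeta>)"
  using assms
proof (induction arbitrary: f rule: real_polynomial_function.induct)
  case (linear p)
  note f = linear.prems
  interpret bounded_linear p by fact
  define c d where "c = (of_real (p 1) - \<i> * of_real (p \<i>)) / 2" and "d = (of_real (p 1) + \<i> * of_real (p \<i>)) / 2"
  have p: "complex_of_real (p \<zeta>) = c * \<zeta> + d * cnj \<zeta>" for \<zeta>
  proof -
    have "p \<zeta> = p (Re \<zeta> *\<^sub>R 1 + Im \<zeta> *\<^sub>R \<i>)"
      by (rule arg_cong[where f = p]) (simp add: complex_eq_iff)
    also have "\<dots> = Re \<zeta> * p 1 + Im \<zeta> * p \<i>"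
      by (simp only: add scaleR) simp
    finally show ?thesis
      by (simp add: c_def d_def complex_eq_iff field_simps)
  qed
  have "trig_null (\<lambda>\<zeta>. c * (\<zeta> * f \<zeta>) + d * (cnj \<zeta> * f \<zeta>))"
    by (intro trig_null_add trig_null_cmult trig_null_shift f)
  then show ?case
    by (rule trig_null_cong) (simp add: p algebra_simps)
next
  case (const c)
  then show ?case by (rule trig_null_cmult)
next
  case (add p q)
  have "trig_null (\<lambda>\<zeta>. of_real (p \<zeta>) * f \<zeta> + of_real (q \<zeta>) * f \<zeta>)"
    by (intro trig_null_add add)
  then show ?case by (rule trig_null_cong) (simp add: algebra_simps)
next
  case (mult p q)
  have "trig_null (\<lambda>\<zeta>. of_real (p \<zeta>) * (of_real (q \<zeta>) * f \<zeta>))"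
    by (intro mult)
  then show ?case by (rule trig_null_cong) (simp add: algebra_simps)
qed

text \<open>By Stone--Weierstrass \<open>g\<close> is within \<open>e\<close> of a real polynomial on the circle, and the integral of a
  polynomial times \<open>f\<close> vanishes.\<close>

lemma trig_null_continuous:
  assumes f: "trig_null f" and g: "continuous_on UNIV (g :: complex \<Rightarrow> real)"
  shows "(\<integral>\<zeta>. of_real (g \<zeta>) * f \<zeta> \<partial>circle) = 0"
proof (rule ccontr)
  define I where "I = (\<integral>\<zeta>. of_real (g \<zeta>) * f \<zeta> \<partial>circle)"
  define N where "N = (\<integral>\<zeta>. cmod (f \<zeta>) \<partial>circle)"
  assume "\<not> ?thesis"
  then have I: "0 < cmod I" by (simp add: I_def)
  have N: "0 \<le> N" by (simp add: N_def)
  have fi: "integrable circle f" using f by (simp add: trig_null_def)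
  \<comment> \<open>Small enough for \<open>e N < |I|\<close>; the summand 1 covers \<open>N = 0\<close>.\<close>
  define e where "e = cmod I / (2 * (N + 1))"
  have e: "0 < e" using I N by (simp add: e_def)
  have gs: "continuous_on (sphere 0 1) g" using g continuous_on_subset by blast
  obtain p where p: "real_polynomial_function p" "\<And>\<zeta>. \<zeta> \<in> sphere 0 1 \<Longrightarrow> \<bar>g \<zeta> - p \<zeta>\<bar> < e"
    using Stone_Weierstrass_real_polynomial_function[OF compact_sphere gs e] by blast
  have tn: "trig_null (\<lambda>\<zeta>. of_real (p \<zeta>) * f \<zeta>)"
    by (rule trig_null_real_polynomial[OF p(1) f])
  have pi: "integrable circle (\<lambda>\<zeta>. of_real (p \<zeta>) * f \<zeta>)" "(\<integral>\<zeta>. of_real (p \<zeta>) * f \<zeta> \<partial>circle) = 0"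
    using tn spec[of _ 0] by (auto simp: trig_null_def dest: spec[of _ 0])
  have gm: "g \<in> borel_measurable circle"
    using borel_measurable_continuous_on_restrict[OF gs] by (simp add: circle_def)
  obtain B where "\<forall>w\<in>g ` sphere 0 1. norm w \<le> B"
    using compact_imp_bounded[OF compact_continuous_image[OF gs compact_sphere]] unfolding bounded_iff by blast
  then have B: "\<bar>g \<zeta>\<bar> \<le> B" if "cmod \<zeta> = 1" for \<zeta>
    using that by simp
  have gi: "integrable circle (\<lambda>\<zeta>. of_real (g \<zeta>) * f \<zeta>)"
  proof (rule integrable_mult_bounded[OF fi])
    show "(\<lambda>\<zeta>. complex_of_real (g \<zeta>)) \<in> borel_measurable circle"
      using gm by measurable
    show "cmod (complex_of_real (g \<zeta>)) \<le> B" if "cmod \<zeta> = 1" for \<zeta>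
      using B[OF that] by simp
  qed
  have "I = (\<integral>\<zeta>. of_real (g \<zeta>) * f \<zeta> - of_real (p \<zeta>) * f \<zeta> \<partial>circle)"
    using Bochner_Integration.integral_diff[OF gi pi(1)] by (simp add: I_def pi(2))
  then have "cmod I \<le> (\<integral>\<zeta>. e * cmod (f \<zeta>) \<partial>circle)"
  proof (simp only:, intro Bochner_Integration.integral_norm_bound_integral Bochner_Integration.integrable_diff gi pi
      integrable_mult_right integrable_norm fi)
    fix \<zeta> assume "\<zeta> \<in> space circle"
    then have "\<bar>g \<zeta> - p \<zeta>\<bar> \<le> e" using p(2)[of \<zeta>] by simp
    moreover have "of_real (g \<zeta>) * f \<zeta> - of_real (p \<zeta>) * f \<zeta> = of_real (g \<zeta> - p \<zeta>) * f \<zeta>"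
      by (simp add: algebra_simps)
    ultimately show "cmod (of_real (g \<zeta>) * f \<zeta> - of_real (p \<zeta>) * f \<zeta>) \<le> e * cmod (f \<zeta>)"
      by (simp only: norm_mult norm_of_real) (rule mult_right_mono, auto)
  qed
  also have "\<dots> = e * N" by (simp add: N_def)
  also have "\<dots> = cmod I * (N / (2 * (N + 1)))" by (simp add: e_def)
  also have "\<dots> < cmod I * 1"
    using I N by (intro mult_strict_left_mono) (auto simp: field_simps)
  finally show False by simp
qed

text \<open>The indicator of a closed set is a bounded pointwise limit of continuous functions, which
  are cut off at distance \<open>1 / k\<close> from the set.\<close>

lemma trig_null_closed:
  assumes f: "trig_null f" and A: "closed (A :: complex set)"
  shows "(\<integral>\<zeta>. indicator A \<zeta> *\<^sub>R f \<zeta> \<partial>circle) = 0"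
proof (cases "A = {}")
  case False
  define g where "g k \<zeta> = max 0 (1 - real k * infdist \<zeta> A)" for k \<zeta>
  have gc: "continuous_on UNIV (g k)" for k
    unfolding g_def by (intro continuous_intros)
  have fi: "integrable circle f" using f by (simp add: trig_null_def)
  have [measurable]: "g k \<in> borel_measurable circle" for k
    using borel_measurable_continuous_on_restrict[OF continuous_on_subset[OF gc, of "sphere 0 1"]]
    by (simp add: circle_def)
  have Am[measurable]: "indicator A \<in> borel_measurable circle"
    unfolding circle_def by (simp add: A borel_closed measurable_restrict_space1 cong: measurable_cong_sets)
  have [measurable]: "f \<in> borel_measurable circle" using fi by simp
  have "(\<lambda>k. \<integral>\<zeta>. of_real (g k \<zeta>) * f \<zeta> \<partial>circle) \<longlonglongrightarrow> (\<integral>\<zeta>. indicator A \<zeta> *\<^sub>R f \<zeta> \<partial>circle)"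
  proof (rule integral_dominated_convergence[OF _ _ integrable_norm[OF fi]])
    show "AE \<zeta> in circle. (\<lambda>k. of_real (g k \<zeta>) * f \<zeta>) \<longlonglongrightarrow> indicator A \<zeta> *\<^sub>R f \<zeta>"
    proof (intro AE_I2)
      fix \<zeta>
      have "(\<lambda>k. g k \<zeta>) \<longlonglongrightarrow> indicator A \<zeta>"
      proof (cases "\<zeta> \<in> A")
        case True
        then show ?thesis by (simp add: g_def)
      next
        case out: False
        then have pos: "0 < infdist \<zeta> A"
          using in_closed_iff_infdist_zero[OF A False] infdist_nonneg[of \<zeta> A] by (simp add: less_le)
        obtain n where n: "1 / infdist \<zeta> A < real n" using reals_Archimedean2 by blast
        have "g k \<zeta> = 0" if "n \<le> k" for k
        proof -
          have "1 / infdist \<zeta> A < real k" using n that by (meson less_le_trans of_nat_mono)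
          then have "1 < real k * infdist \<zeta> A" using pos by (simp add: field_simps)
          then show ?thesis by (simp add: g_def)
        qed
        then have "\<forall>\<^sub>F k in sequentially. g k \<zeta> = 0"
          unfolding eventually_sequentially by blast
        then show ?thesis using out by (simp add: tendsto_eventually)
      qed
      then have "(\<lambda>k. complex_of_real (g k \<zeta>) * f \<zeta>) \<longlonglongrightarrow> of_real (indicator A \<zeta>) * f \<zeta>"
        by (intro tendsto_mult tendsto_of_real tendsto_const)
      then show "(\<lambda>k. of_real (g k \<zeta>) * f \<zeta>) \<longlonglongrightarrow> indicator A \<zeta> *\<^sub>R f \<zeta>"
        by (simp only: scaleR_conv_of_real)
    qed
    show "AE \<zeta> in circle. norm (of_real (g k \<zeta>) * f \<zeta>) \<le> norm (f \<zeta>)" for k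
    proof (intro AE_I2)
      fix \<zeta>
      have "\<bar>g k \<zeta>\<bar> \<le> 1" unfolding g_def using infdist_nonneg[of \<zeta> A] by auto
      then show "norm (of_real (g k \<zeta>) * f \<zeta>) \<le> norm (f \<zeta>)"
        by (simp add: norm_mult mult_left_le_one_le)
    qed
  qed measurable
  moreover have "(\<integral>\<zeta>. of_real (g k \<zeta>) * f \<zeta> \<partial>circle) = 0" for k
    by (rule trig_null_continuous[OF f gc])
  ultimately have "(\<lambda>k. 0) \<longlonglongrightarrow> (\<integral>\<zeta>. indicator A \<zeta> *\<^sub>R f \<zeta> \<partial>circle)" by simp
  then show ?thesis using LIMSEQ_unique[OF tendsto_const] by metis
qed simp

lemma trig_null_borel:
  assumes f: "trig_null f" and B: "B \<in> sets (borel :: complex measure)"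
  shows "(\<integral>\<zeta>. indicator B \<zeta> *\<^sub>R f \<zeta> \<partial>circle) = 0"
proof -
  have fi: "integrable circle f" using f by (simp add: trig_null_def)
  have im: "indicator D \<in> borel_measurable circle" if "D \<in> sets borel" for D :: "complex set"
    unfolding circle_def using that by (simp add: measurable_restrict_space1 cong: measurable_cong_sets)
  have ii: "integrable circle (\<lambda>\<zeta>. indicator D \<zeta> *\<^sub>R f \<zeta>)" if "D \<in> sets borel" for D :: "complex set"
  proof (rule Bochner_Integration.integrable_bound[OF fi])
    show "(\<lambda>\<zeta>. indicator D \<zeta> *\<^sub>R f \<zeta>) \<in> borel_measurable circle"
      using im[OF that] fi by measurable
  qed (auto simp: indicator_def)
  have "Int_stable (Collect closed :: complex set set)"
    by (auto simp: Int_stable_def)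
  moreover have "Collect closed \<subseteq> Pow (UNIV :: complex set)"
    by simp
  moreover have "B \<in> sigma_sets UNIV (Collect closed)"
    using B by (simp add: borel_eq_closed)
  ultimately show ?thesis
  proof (induction rule: sigma_sets_induct_disjoint)
    case (basic A)
    then show ?case using trig_null_closed[OF f] by simp
  next
    case empty
    show ?case by simp
  next
    case (compl A)
    then have A: "A \<in> sets borel" by (simp add: borel_eq_closed)
    have "(\<integral>\<zeta>. indicator (UNIV - A) \<zeta> *\<^sub>R f \<zeta> \<partial>circle) = (\<integral>\<zeta>. f \<zeta> - indicator A \<zeta> *\<^sub>R f \<zeta> \<partial>circle)"
      by (intro Bochner_Integration.integral_cong) (auto simp: indicator_def)
    also have "\<dots> = (\<integral>\<zeta>. f \<zeta> \<partial>circle) - (\<integral>\<zeta>. indicator A \<zeta> *\<^sub>R f \<zeta> \<partial>circle)"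
      by (rule Bochner_Integration.integral_diff[OF fi ii[OF A]])
    also have "\<dots> = 0"
      using f[unfolded trig_null_def, THEN conjunct2, rule_format, of 0] compl by simp
    finally show ?case .
  next
    case (union A)
    then have A: "A i \<in> sets borel" for i by (auto simp: borel_eq_closed)
    have AU: "(\<Union>i. A i) \<in> sets borel" using A by blast
    have AN: "(\<Union>i<n. A i) \<in> sets borel" for n using A by blast
    have "(\<integral>\<zeta>. indicator (\<Union>i<n. A i) \<zeta> *\<^sub>R f \<zeta> \<partial>circle) = 0" for n
    proof -
      have dj: "disjoint_family_on A {..<n}"
        using union(1) by (rule disjoint_family_on_mono[rotated]) simp
      have "(\<integral>\<zeta>. indicator (\<Union>i<n. A i) \<zeta> *\<^sub>R f \<zeta> \<partial>circle) = (\<integral>\<zeta>. (\<Sum>i<n. indicator (A i) \<zeta> *\<^sub>R f \<zeta>) \<partial>circle)"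
        by (simp only: indicator_UN_disjoint[OF finite_lessThan dj] scaleR_sum_left)
      also have "\<dots> = (\<Sum>i<n. (\<integral>\<zeta>. indicator (A i) \<zeta> *\<^sub>R f \<zeta> \<partial>circle))"
        by (intro Bochner_Integration.integral_sum ii A)
      finally show ?thesis using union by simp
    qed
    moreover have "(\<lambda>n. \<integral>\<zeta>. indicator (\<Union>i<n. A i) \<zeta> *\<^sub>R f \<zeta> \<partial>circle)
        \<longlonglongrightarrow> (\<integral>\<zeta>. indicator (\<Union>i. A i) \<zeta> *\<^sub>R f \<zeta> \<partial>circle)"
    proof (rule integral_dominated_convergence[OF _ _ integrable_norm[OF fi]])
      show "AE \<zeta> in circle. (\<lambda>n. indicator (\<Union>i<n. A i) \<zeta> *\<^sub>R f \<zeta>) \<longlonglongrightarrow> indicator (\<Union>i. A i) \<zeta> *\<^sub>R f \<zeta>"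
        by (intro AE_I2 tendsto_scaleR tendsto_const LIMSEQ_indicator_UN)
      show "AE \<zeta> in circle. norm (indicator (\<Union>i<n. A i) \<zeta> *\<^sub>R f \<zeta>) \<le> norm (f \<zeta>)" for n
        by (intro AE_I2) (simp add: indicator_def)
    qed (use ii[OF AU] ii[OF AN] in \<open>simp_all\<close>)
    ultimately have "(\<lambda>n. 0) \<longlonglongrightarrow> (\<integral>\<zeta>. indicator (\<Union>i. A i) \<zeta> *\<^sub>R f \<zeta> \<partial>circle)" by simp
    then show ?case using LIMSEQ_unique[OF tendsto_const] by metis
  qed
qed

theorem fourier_uniqueness:
  assumes "trig_null f"
  shows "AE \<zeta> in circle. f \<zeta> = 0"
proof (rule circle.density_zero)
  show "integrable circle f" using assms by (simp add: trig_null_def)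
  fix A assume "A \<in> sets circle"
  then obtain B where B: "B \<in> sets borel" "A = sphere 0 1 \<inter> B"
    by (auto simp: sets_circle sets_restrict_space)
  have "set_lebesgue_integral circle A f = (\<integral>\<zeta>. indicator B \<zeta> *\<^sub>R f \<zeta> \<partial>circle)"
    unfolding set_lebesgue_integral_def
    by (intro Bochner_Integration.integral_cong) (auto simp: B(2) indicator_def)
  also have "\<dots> = 0" by (rule trig_null_borel[OF assms B(1)])
  finally show "set_lebesgue_integral circle A f = 0" .
qed

text \<open>Expanding \<open>\<integral> |f - p|\<^sup>2 \<ge> 0\<close> for the partial sums \<open>p\<close> of the analytic part of the Fourier series.\<close>

lemma bessel_inequality:
  assumes f: "sq_integrable f"
  defines "a \<equiv> \<lambda>n. \<integral>\<zeta>. f \<zeta> * cnj \<zeta> ^ n \<partial>circle"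
  shows "summable (\<lambda>n. (cmod (a n))\<^sup>2)"
proof (rule bounded_imp_summable)
  fix N
  define p where "p \<zeta> = (\<Sum>n<Suc N. a n * \<zeta> ^ n)" for \<zeta>
  define E where "E = (\<Sum>n<Suc N. (cmod (a n))\<^sup>2)"
  have [measurable]: "p \<in> borel_measurable circle" unfolding p_def by measurable
  have p: "sq_integrable p"
    by (rule sq_integrable_bounded[where B = "\<Sum>n<Suc N. cmod (a n)"])
       (measurable, auto simp: p_def intro: polynomial_bound simp del: sum.lessThan_Suc)
  have pp: "(\<integral>\<zeta>. (cmod (p \<zeta>))\<^sup>2 \<partial>circle) = E"
    unfolding p_def E_def by (rule integral_polynomial_sq)
  have fp: "(\<integral>\<zeta>. f \<zeta> * cnj (p \<zeta>) \<partial>circle) = of_real E"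
  proof -
    have i: "integrable circle (\<lambda>\<zeta>. f \<zeta> * cnj \<zeta> ^ n)" for n
      using integrable_mult_sq_integrable[OF f sq_integrable_monomial[of 0 n]] by simp
    have "(\<integral>\<zeta>. f \<zeta> * cnj (p \<zeta>) \<partial>circle) = (\<integral>\<zeta>. (\<Sum>n<Suc N. cnj (a n) * (f \<zeta> * cnj \<zeta> ^ n)) \<partial>circle)"
      unfolding p_def by (simp add: sum_distrib_left mult_ac del: sum.lessThan_Suc)
    also have "\<dots> = (\<Sum>n<Suc N. (\<integral>\<zeta>. cnj (a n) * (f \<zeta> * cnj \<zeta> ^ n) \<partial>circle))"
      by (intro Bochner_Integration.integral_sum integrable_mult_right i)
    also have "\<dots> = (\<Sum>n<Suc N. cnj (a n) * a n)"
      by (simp only: integral_mult_right_zero a_def)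
    also have "\<dots> = of_real E"
      by (simp only: E_def of_real_sum complex_norm_square mult.commute)
    finally show ?thesis .
  qed
  have ri: "integrable circle (\<lambda>\<zeta>. Re (f \<zeta> * cnj (p \<zeta>)))"
    by (intro integrable_Re integrable_mult_sq_integrable f sq_integrable_cnj p)
  have re: "(\<integral>\<zeta>. Re (f \<zeta> * cnj (p \<zeta>)) \<partial>circle) = E"
    using integral_Re[OF integrable_mult_sq_integrable[OF f sq_integrable_cnj[OF p]]] fp by simp
  have i2: "integrable circle (\<lambda>\<zeta>. (cmod (f \<zeta>))\<^sup>2)" "integrable circle (\<lambda>\<zeta>. (cmod (p \<zeta>))\<^sup>2)"
    using f p by (auto simp: sq_integrable_def)
  have "0 \<le> (\<integral>\<zeta>. (cmod (f \<zeta> - p \<zeta>))\<^sup>2 \<partial>circle)" by simp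
  also have "\<dots> = (\<integral>\<zeta>. (cmod (f \<zeta>))\<^sup>2 - 2 * Re (f \<zeta> * cnj (p \<zeta>)) + (cmod (p \<zeta>))\<^sup>2 \<partial>circle)"
    by (intro Bochner_Integration.integral_cong refl)
       (simp only: cmod_power2, simp add: power2_eq_square algebra_simps)
  also have "\<dots> = (\<integral>\<zeta>. (cmod (f \<zeta>))\<^sup>2 \<partial>circle) - 2 * E + E"
    using ri i2 by (simp only: Bochner_Integration.integral_add Bochner_Integration.integral_diff
        Bochner_Integration.integrable_diff integrable_mult_right integral_mult_right_zero re pp)
  finally have "E \<le> (\<integral>\<zeta>. (cmod (f \<zeta>))\<^sup>2 \<partial>circle)" by simp
  then show "(\<Sum>n\<le>N. (cmod (a n))\<^sup>2) \<le> (\<integral>\<zeta>. (cmod (f \<zeta>))\<^sup>2 \<partial>circle)"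
    by (simp only: E_def lessThan_Suc_atMost)
qed simp

text \<open>The function \<open>g\<close> has the nonnegative Fourier coefficients of \<open>f\<close>, and \<open>h\<close> those of \<open>cnj (\<zeta> f \<zeta>)\<close>, so that
  \<open>cnj (\<zeta> h \<zeta>)\<close> has the negative coefficients of \<open>f\<close>. The two sides then have the same Fourier
  coefficients.\<close>

theorem hardy_decomposition:
  assumes f: "sq_integrable f"
  obtains F g H h where "F \<in> hardy_disk" "radial_boundary F g" "sq_integrable g"
    "H \<in> hardy_disk" "radial_boundary H h" "sq_integrable h"
    "AE \<zeta> in circle. f \<zeta> = g \<zeta> + cnj \<zeta> * cnj (h \<zeta>)"
proof -
  obtain F g where g: "F \<in> hardy_disk" "radial_boundary F g" "sq_integrable g"
    "\<And>n. (\<integral>\<zeta>. g \<zeta> * cnj \<zeta> ^ n \<partial>circle) = (\<integral>\<zeta>. f \<zeta> * cnj \<zeta> ^ n \<partial>circle)"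
    by (rule hardy_boundary_exists[OF bessel_inequality[OF f]]) (rule that)
  have f': "sq_integrable (\<lambda>\<zeta>. cnj (\<zeta> * f \<zeta>))"
    using sq_integrable_cnj[OF sq_integrable_monomial_mult[OF f, of 1 0]] by simp
  obtain H h where h: "H \<in> hardy_disk" "radial_boundary H h" "sq_integrable h"
    "\<And>n. (\<integral>\<zeta>. h \<zeta> * cnj \<zeta> ^ n \<partial>circle) = (\<integral>\<zeta>. cnj (\<zeta> * f \<zeta>) * cnj \<zeta> ^ n \<partial>circle)"
    by (rule hardy_boundary_exists[OF bessel_inequality[OF f']]) (rule that)
  define k where "k \<zeta> = cnj (\<zeta> * h \<zeta>)" for \<zeta>
  have k: "sq_integrable k"
    unfolding k_def using sq_integrable_cnj[OF sq_integrable_monomial_mult[OF h(3), of 1 0]] by simp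
  have ip: "integrable circle (\<lambda>\<zeta>. cnj \<zeta> ^ n * u \<zeta>)" "integrable circle (\<lambda>\<zeta>. \<zeta> ^ n * u \<zeta>)" if "sq_integrable u" for u n
    using integrable_sq_integrable[OF sq_integrable_monomial_mult[OF that, of 0 n]]
      integrable_sq_integrable[OF sq_integrable_monomial_mult[OF that, of n 0]] by simp_all
  have cn: "(\<integral>\<zeta>. cnj \<zeta> ^ n * k \<zeta> \<partial>circle) = 0" for n
  proof -
    have "(\<integral>\<zeta>. cnj \<zeta> ^ n * k \<zeta> \<partial>circle) = (\<integral>\<zeta>. cnj (h \<zeta> * \<zeta> ^ Suc n) \<partial>circle)"
      by (simp add: k_def mult_ac)
    also have "\<dots> = 0"
      by (subst Bochner_Integration.integral_cnj, subst hardy_boundary_negative_moments[OF h(1-3)]) simp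
    finally show ?thesis .
  qed
  have cp: "(\<integral>\<zeta>. \<zeta> ^ Suc n * k \<zeta> \<partial>circle) = (\<integral>\<zeta>. \<zeta> ^ Suc n * f \<zeta> \<partial>circle)" for n
  proof -
    have "(\<integral>\<zeta>. \<zeta> ^ Suc n * k \<zeta> \<partial>circle) = (\<integral>\<zeta>. cnj (h \<zeta> * cnj \<zeta> ^ n) \<partial>circle)"
    proof (intro Bochner_Integration.integral_cong refl)
      fix \<zeta> assume "\<zeta> \<in> space circle"
      then have "\<zeta> * cnj \<zeta> = 1" by (simp add: cnj_eq_inverse_circle)
      then show "\<zeta> ^ Suc n * k \<zeta> = cnj (h \<zeta> * cnj \<zeta> ^ n)"
        by (simp add: k_def algebra_simps)
    qed
    also have "\<dots> = cnj (\<integral>\<zeta>. cnj (\<zeta> * f \<zeta>) * cnj \<zeta> ^ n \<partial>circle)"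
      by (subst Bochner_Integration.integral_cnj, subst h(4)) simp
    also have "\<dots> = (\<integral>\<zeta>. \<zeta> ^ Suc n * f \<zeta> \<partial>circle)"
      by (subst Bochner_Integration.integral_cnj[symmetric]) (simp add: mult_ac)
    finally show ?thesis .
  qed
  have gp: "(\<integral>\<zeta>. \<zeta> ^ Suc n * g \<zeta> \<partial>circle) = 0" for n
    using hardy_boundary_negative_moments[OF g(1-3), of n] by (simp add: mult_ac)
  have gn: "(\<integral>\<zeta>. cnj \<zeta> ^ n * g \<zeta> \<partial>circle) = (\<integral>\<zeta>. cnj \<zeta> ^ n * f \<zeta> \<partial>circle)" for n
    using g(4)[of n] by (simp add: mult.commute)
  define d where "d \<zeta> = f \<zeta> - g \<zeta> - k \<zeta>" for \<zeta>
  have dn: "(\<integral>\<zeta>. cnj \<zeta> ^ n * d \<zeta> \<partial>circle) = 0" for n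
  proof -
    have "(\<integral>\<zeta>. cnj \<zeta> ^ n * d \<zeta> \<partial>circle)
        = (\<integral>\<zeta>. cnj \<zeta> ^ n * f \<zeta> - cnj \<zeta> ^ n * g \<zeta> - cnj \<zeta> ^ n * k \<zeta> \<partial>circle)"
      by (simp only: d_def right_diff_distrib)
    also have "\<dots> = (\<integral>\<zeta>. cnj \<zeta> ^ n * f \<zeta> \<partial>circle) - (\<integral>\<zeta>. cnj \<zeta> ^ n * g \<zeta> \<partial>circle) - (\<integral>\<zeta>. cnj \<zeta> ^ n * k \<zeta> \<partial>circle)"
      by (simp only: Bochner_Integration.integral_diff Bochner_Integration.integrable_diff ip f g k)
    finally show ?thesis by (simp only: gn cn) simp
  qed
  have dp: "(\<integral>\<zeta>. \<zeta> ^ n * d \<zeta> \<partial>circle) = 0" for n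
  proof (cases n)
    case 0
    then show ?thesis using dn[of 0] by simp
  next
    case (Suc m)
    have "(\<integral>\<zeta>. \<zeta> ^ Suc m * d \<zeta> \<partial>circle)
        = (\<integral>\<zeta>. \<zeta> ^ Suc m * f \<zeta> - \<zeta> ^ Suc m * g \<zeta> - \<zeta> ^ Suc m * k \<zeta> \<partial>circle)"
      by (simp only: d_def right_diff_distrib)
    also have "\<dots> = (\<integral>\<zeta>. \<zeta> ^ Suc m * f \<zeta> \<partial>circle) - (\<integral>\<zeta>. \<zeta> ^ Suc m * g \<zeta> \<partial>circle) - (\<integral>\<zeta>. \<zeta> ^ Suc m * k \<zeta> \<partial>circle)"
      by (simp only: Bochner_Integration.integral_diff Bochner_Integration.integrable_diff ip f g k)
    finally show ?thesis unfolding Suc by (simp only: gp cp) simp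
  qed
  have "integrable circle d"
    unfolding d_def
    by (intro Bochner_Integration.integrable_diff integrable_sq_integrable f g k)
  then have "trig_null d" using dn dp by (simp add: trig_null_def)
  then have "AE \<zeta> in circle. d \<zeta> = 0" by (rule fourier_uniqueness)
  then have "AE \<zeta> in circle. f \<zeta> = g \<zeta> + cnj \<zeta> * cnj (h \<zeta>)"
    by eventually_elim (simp add: d_def k_def algebra_simps)
  with g(1-3) h(1-3) show ?thesis by (rule that)
qed

section \<open>The Hilbert space structure on classes of functions\<close>

lemma ae_eq_refl_iff: "ae_eq f f \<longleftrightarrow> f \<in> borel_measurable circle"
  by (simp add: ae_eq_def)

lemma circle_fun_exhaust:
  obtains f where "f \<in> borel_measurable circle" "X = abs_circle_fun f"
proof
  show "rep_circle_fun X \<in> borel_measurable circle"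
    using Quotient_rep_reflp[OF Quotient_circle_fun] by (simp add: ae_eq_refl_iff)
  show "X = abs_circle_fun (rep_circle_fun X)"
    using Quotient_abs_rep[OF Quotient_circle_fun] by simp
qed

lemma abs_circle_fun_eq_iff:
  assumes "f \<in> borel_measurable circle" "g \<in> borel_measurable circle"
  shows "abs_circle_fun f = abs_circle_fun g \<longleftrightarrow> (AE \<zeta> in circle. f \<zeta> = g \<zeta>)"
  using Quotient_rel[OF Quotient_circle_fun, of f g] assms by (auto simp: ae_eq_def)

lemma abs_circle_fun_in_L2:
  "f \<in> borel_measurable circle \<Longrightarrow> abs_circle_fun f \<in> L2 \<longleftrightarrow> sq_integrable f"
  by (simp add: L2_def in_L2.abs_eq ae_eq_refl_iff sq_integrable_def)

lemma L2_E:
  assumes "X \<in> L2"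
  obtains f where "sq_integrable f" "X = abs_circle_fun f"
proof -
  obtain f where "f \<in> borel_measurable circle" "X = abs_circle_fun f" by (rule circle_fun_exhaust)
  with assms show ?thesis by (intro that[of f]) (auto simp: abs_circle_fun_in_L2)
qed

lemma abs_circle_fun_simps:
  assumes "f \<in> borel_measurable circle" "g \<in> borel_measurable circle"
  shows "abs_circle_fun f + abs_circle_fun g = abs_circle_fun (\<lambda>\<zeta>. f \<zeta> + g \<zeta>)"
    and "abs_circle_fun f - abs_circle_fun g = abs_circle_fun (\<lambda>\<zeta>. f \<zeta> - g \<zeta>)"
    and "abs_circle_fun f * abs_circle_fun g = abs_circle_fun (\<lambda>\<zeta>. f \<zeta> * g \<zeta>)"
    and "cnj_cf (abs_circle_fun f) = abs_circle_fun (\<lambda>\<zeta>. cnj (f \<zeta>))"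
    and "L2_inner (abs_circle_fun f) (abs_circle_fun g) = (\<integral>\<zeta>. f \<zeta> * cnj (g \<zeta>) \<partial>circle)"
  using assms
  by (simp_all add: plus_circle_fun.abs_eq minus_circle_fun.abs_eq times_circle_fun.abs_eq cnj_cf.abs_eq
      L2_inner.abs_eq ae_eq_refl_iff)

lemma L2_add: assumes "X \<in> L2" "Y \<in> L2" shows "X + Y \<in> L2"
proof -
  obtain f g where f: "sq_integrable f" "X = abs_circle_fun f" and g: "sq_integrable g" "Y = abs_circle_fun g"
    using assms by (metis L2_E)
  note m = f(1)[THEN sq_integrableD] g(1)[THEN sq_integrableD]
  show ?thesis
    using sq_integrable_add[OF f(1) g(1)]
    by (simp add: f(2) g(2) abs_circle_fun_simps m abs_circle_fun_in_L2 borel_measurable_add)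
qed

lemma abs_circle_fun_in_Linf:
  "f \<in> borel_measurable circle \<Longrightarrow> abs_circle_fun f \<in> Linf \<longleftrightarrow> (\<exists>C. AE \<zeta> in circle. cmod (f \<zeta>) \<le> C)"
  by (simp add: Linf_def in_Linf.abs_eq ae_eq_refl_iff)

lemma Linf_E:
  assumes "X \<in> Linf"
  obtains f C where "f \<in> borel_measurable circle" "X = abs_circle_fun f" "AE \<zeta> in circle. cmod (f \<zeta>) \<le> C"
proof -
  obtain f where "f \<in> borel_measurable circle" "X = abs_circle_fun f" by (rule circle_fun_exhaust)
  with assms show ?thesis using that[of f] by (auto simp: abs_circle_fun_in_Linf)
qed

lemma L2_mult: assumes "\<Psi> \<in> Linf" "X \<in> L2" shows "\<Psi> * X \<in> L2"
proof -
  obtain f where f: "sq_integrable f" "X = abs_circle_fun f" using assms(2) by (rule L2_E)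
  obtain g C where g: "g \<in> borel_measurable circle" "\<Psi> = abs_circle_fun g" "AE \<zeta> in circle. cmod (g \<zeta>) \<le> C"
    using assms(1) by (rule Linf_E)
  note m = f(1)[THEN sq_integrableD] g(1)
  show ?thesis
    using sq_integrable_mult_bounded[OF f(1) g(1,3)]
    by (simp add: f(2) g(2) abs_circle_fun_simps m abs_circle_fun_in_L2 borel_measurable_times)
qed

lemma L2_norm_mult_le:
  assumes "\<Psi> \<in> Linf"
  shows "\<exists>C. \<forall>X\<in>L2. L2_norm (\<Psi> * X) \<le> C * L2_norm X"
proof -
  obtain g C where g: "g \<in> borel_measurable circle" "\<Psi> = abs_circle_fun g" "AE \<zeta> in circle. cmod (g \<zeta>) \<le> C"
    using assms by (rule Linf_E)
  have "L2_norm (\<Psi> * X) \<le> \<bar>C\<bar> * L2_norm X" if X: "X \<in> L2" for X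
  proof -
    obtain f where f: "sq_integrable f" "X = abs_circle_fun f" using X by (rule L2_E)
    note m = f(1)[THEN sq_integrableD] g(1)
    have gf: "sq_integrable (\<lambda>\<zeta>. g \<zeta> * f \<zeta>)" by (rule sq_integrable_mult_bounded[OF f(1) g(1,3)])
    have n: "L2_norm (abs_circle_fun h) = sqrt (\<integral>\<zeta>. (cmod (h \<zeta>))\<^sup>2 \<partial>circle)" if "h \<in> borel_measurable circle" for h
    proof -
      have "L2_inner (abs_circle_fun h) (abs_circle_fun h) = (\<integral>\<zeta>. complex_of_real ((cmod (h \<zeta>))\<^sup>2) \<partial>circle)"
        by (simp only: abs_circle_fun_simps[OF that that] complex_norm_square)
      also have "\<dots> = of_real (\<integral>\<zeta>. (cmod (h \<zeta>))\<^sup>2 \<partial>circle)" by (rule integral_complex_of_real)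
      finally show ?thesis by (simp add: L2_norm_def)
    qed
    have "(\<integral>\<zeta>. (cmod (g \<zeta> * f \<zeta>))\<^sup>2 \<partial>circle) \<le> (\<integral>\<zeta>. C\<^sup>2 * (cmod (f \<zeta>))\<^sup>2 \<partial>circle)"
    proof (rule integral_mono_AE)
      show "AE \<zeta> in circle. (cmod (g \<zeta> * f \<zeta>))\<^sup>2 \<le> C\<^sup>2 * (cmod (f \<zeta>))\<^sup>2"
        using g(3)
      proof eventually_elim
        case (elim \<zeta>)
        then have "(cmod (g \<zeta>))\<^sup>2 \<le> C\<^sup>2" by (intro power_mono) auto
        then show ?case by (simp add: norm_mult power_mult_distrib mult_right_mono)
      qed
      show "integrable circle (\<lambda>\<zeta>. C\<^sup>2 * (cmod (f \<zeta>))\<^sup>2)"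
        using f(1) by (intro integrable_mult_right) (simp add: sq_integrable_def)
    qed (use gf in \<open>simp add: sq_integrable_def\<close>)
    also have "\<dots> = C\<^sup>2 * (\<integral>\<zeta>. (cmod (f \<zeta>))\<^sup>2 \<partial>circle)" by (rule integral_mult_right_zero)
    finally have "sqrt (\<integral>\<zeta>. (cmod (g \<zeta> * f \<zeta>))\<^sup>2 \<partial>circle) \<le> sqrt (C\<^sup>2 * (\<integral>\<zeta>. (cmod (f \<zeta>))\<^sup>2 \<partial>circle))"
      by (rule real_sqrt_le_mono)
    also have "\<dots> = \<bar>C\<bar> * sqrt (\<integral>\<zeta>. (cmod (f \<zeta>))\<^sup>2 \<partial>circle)"
      by (simp add: real_sqrt_mult)
    finally show ?thesis
      using m gf by (simp add: f(2) g(2) abs_circle_fun_simps n sq_integrableD)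
  qed
  then show ?thesis by blast
qed

lemma const_cf_Linf: "const_cf c \<in> Linf"
  unfolding Linf_def mem_Collect_eq by transfer auto

lemma unimodular_Linf: "unimodular \<theta> \<Longrightarrow> \<theta> \<in> Linf"
  unfolding Linf_def mem_Collect_eq by transfer (auto intro!: exI[of _ 1] elim: eventually_mono)

lemma unimodular_cnj: "unimodular \<theta> \<Longrightarrow> unimodular (cnj_cf \<theta>)"
  by transfer simp

lemma unimodular_coord: "unimodular coord_cf"
  by transfer (auto intro: AE_I2)

lemma unimodular_mult_cnj: "unimodular \<theta> \<Longrightarrow> \<theta> * cnj_cf \<theta> = 1"
proof -
  assume u: "unimodular \<theta>"
  obtain f where f: "f \<in> borel_measurable circle" "\<theta> = abs_circle_fun f" by (rule circle_fun_exhaust)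
  have "AE \<zeta> in circle. cmod (f \<zeta>) = 1"
    using u by (simp add: f unimodular.abs_eq ae_eq_refl_iff)
  then have "AE \<zeta> in circle. f \<zeta> * cnj (f \<zeta>) = 1"
    by eventually_elim (rule cnj_eq_inverse_circle)
  moreover have m: "(\<lambda>\<zeta>. f \<zeta> * cnj (f \<zeta>)) \<in> borel_measurable circle"
    using f(1) by measurable
  ultimately have "abs_circle_fun (\<lambda>\<zeta>. f \<zeta> * cnj (f \<zeta>)) = abs_circle_fun (\<lambda>_. 1)"
    by (subst abs_circle_fun_eq_iff) auto
  moreover have "(\<lambda>\<zeta>. cnj (f \<zeta>)) \<in> borel_measurable circle" using f(1) by measurable
  ultimately show ?thesis
    using f by (simp add: abs_circle_fun_simps one_circle_fun.abs_eq)
qed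

lemma const_cf_minus_one: "const_cf (-1) = -1"
  by transfer (auto simp: ae_eq_def)

lemma L2_minus: "X \<in> L2 \<Longrightarrow> - X \<in> L2"
  using L2_mult[OF const_cf_Linf, of X "-1"] by (simp add: const_cf_minus_one)

lemma L2_diff: "X \<in> L2 \<Longrightarrow> Y \<in> L2 \<Longrightarrow> X - Y \<in> L2"
  using L2_add[of X "- Y"] L2_minus[of Y] by simp

lemma L2_inner_add_left:
  assumes "X \<in> L2" "Y \<in> L2" "Z \<in> L2"
  shows "L2_inner (X + Y) Z = L2_inner X Z + L2_inner Y Z"
proof -
  obtain f where f: "sq_integrable f" "X = abs_circle_fun f" using assms(1) by (rule L2_E)
  obtain g where g: "sq_integrable g" "Y = abs_circle_fun g" using assms(2) by (rule L2_E)
  obtain h where h: "sq_integrable h" "Z = abs_circle_fun h" using assms(3) by (rule L2_E)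
  note m = f(1)[THEN sq_integrableD] g(1)[THEN sq_integrableD] h(1)[THEN sq_integrableD]
  have "L2_inner (X + Y) Z = (\<integral>\<zeta>. f \<zeta> * cnj (h \<zeta>) + g \<zeta> * cnj (h \<zeta>) \<partial>circle)"
    by (simp add: f(2) g(2) h(2) abs_circle_fun_simps m borel_measurable_add distrib_right)
  also have "\<dots> = (\<integral>\<zeta>. f \<zeta> * cnj (h \<zeta>) \<partial>circle) + (\<integral>\<zeta>. g \<zeta> * cnj (h \<zeta>) \<partial>circle)"
    by (intro Bochner_Integration.integral_add integrable_mult_sq_integrable sq_integrable_cnj f g h)
  finally show ?thesis by (simp add: f(2) g(2) h(2) abs_circle_fun_simps m)
qed

lemma L2_inner_commute: "L2_inner X Y = cnj (L2_inner Y X)"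
proof -
  obtain f where f: "f \<in> borel_measurable circle" "X = abs_circle_fun f" by (rule circle_fun_exhaust)
  obtain g where g: "g \<in> borel_measurable circle" "Y = abs_circle_fun g" by (rule circle_fun_exhaust)
  show ?thesis
    unfolding f(2) g(2) abs_circle_fun_simps[OF f(1) g(1)] abs_circle_fun_simps[OF g(1) f(1)]
    by (subst Bochner_Integration.integral_cnj[symmetric]) (simp add: mult.commute)
qed

lemma L2_inner_mult_left: "L2_inner (\<Psi> * X) Y = L2_inner X (cnj_cf \<Psi> * Y)"
proof -
  obtain f where f: "f \<in> borel_measurable circle" "X = abs_circle_fun f" by (rule circle_fun_exhaust)
  obtain g where g: "g \<in> borel_measurable circle" "Y = abs_circle_fun g" by (rule circle_fun_exhaust)
  obtain p where p: "p \<in> borel_measurable circle" "\<Psi> = abs_circle_fun p" by (rule circle_fun_exhaust)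
  have "(\<lambda>\<zeta>. cnj (p \<zeta>)) \<in> borel_measurable circle" using p(1) by measurable
  then show ?thesis
    by (simp add: f g p abs_circle_fun_simps borel_measurable_times mult_ac)
qed

lemma L2_inner_const_left: "L2_inner (const_cf c * X) Y = c * L2_inner X Y"
proof -
  obtain f where f: "f \<in> borel_measurable circle" "X = abs_circle_fun f" by (rule circle_fun_exhaust)
  obtain g where g: "g \<in> borel_measurable circle" "Y = abs_circle_fun g" by (rule circle_fun_exhaust)
  show ?thesis
    by (simp add: f g const_cf.abs_eq abs_circle_fun_simps borel_measurable_times mult.assoc)
qed

lemma L2_inner_minus_left: "L2_inner (- X) Y = - L2_inner X Y"
  using L2_inner_const_left[of "-1" X Y] by (simp add: const_cf_minus_one)

lemma L2_inner_diff_left: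
  assumes "X \<in> L2" "Y \<in> L2" "Z \<in> L2"
  shows "L2_inner (X - Y) Z = L2_inner X Z - L2_inner Y Z"
  using L2_inner_add_left[of X "- Y" Z] assms L2_minus by (simp add: L2_inner_minus_left)

lemma L2_inner_diff_right:
  assumes "X \<in> L2" "Y \<in> L2" "Z \<in> L2"
  shows "L2_inner Z (X - Y) = L2_inner Z X - L2_inner Z Y"
  unfolding L2_inner_commute[of Z] L2_inner_diff_left[OF assms] by simp

lemma L2_inner_eq_zero:
  assumes "X \<in> L2" "L2_inner X X = 0"
  shows "X = 0"
proof -
  obtain f where f: "sq_integrable f" "X = abs_circle_fun f" using assms(1) by (rule L2_E)
  note m = f(1)[THEN sq_integrableD]
  have "complex_of_real (\<integral>\<zeta>. (cmod (f \<zeta>))\<^sup>2 \<partial>circle) = L2_inner X X"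
    by (simp only: integral_complex_of_real[symmetric] complex_norm_square f(2) abs_circle_fun_simps[OF m m])
  then have "(\<integral>\<zeta>. (cmod (f \<zeta>))\<^sup>2 \<partial>circle) = 0"
    by (simp only: assms(2) of_real_eq_0_iff)
  then have "AE \<zeta> in circle. (cmod (f \<zeta>))\<^sup>2 = 0"
    using f(1) by (subst (asm) integral_nonneg_eq_0_iff_AE) (auto simp: sq_integrable_def)
  then have "AE \<zeta> in circle. f \<zeta> = 0" by eventually_elim simp
  then show ?thesis
    using m by (simp add: f(2) zero_circle_fun.abs_eq abs_circle_fun_eq_iff)
qed

section \<open>Hardy space and its orthogonal complement\<close>

lemma abs_circle_fun_in_H2:
  assumes "F \<in> hardy_disk" "radial_boundary F f" "sq_integrable f"
  shows "abs_circle_fun f \<in> H2"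
  using assms sq_integrableD[OF assms(3)]
  by (auto simp: H2_def abs_circle_fun_in_L2 boundary_fun.abs_eq ae_eq_refl_iff radial_boundary_def)

lemma H2_E:
  assumes "X \<in> H2"
  obtains F f where "F \<in> hardy_disk" "radial_boundary F f" "sq_integrable f" "X = abs_circle_fun f"
proof -
  obtain F where F: "X \<in> L2" "F \<in> hardy_disk" "boundary_fun F X" using assms by (auto simp: H2_def)
  obtain f where f: "sq_integrable f" "X = abs_circle_fun f" using F(1) by (rule L2_E)
  have "radial_boundary F f"
    using F(3) sq_integrableD[OF f(1)] by (simp add: f(2) boundary_fun.abs_eq ae_eq_refl_iff radial_boundary_def)
  with F f show ?thesis by (intro that)
qed

lemma H2_subset_L2: "X \<in> H2 \<Longrightarrow> X \<in> L2"
  by (simp add: H2_def)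

lemma cnj_cf_L2: "X \<in> L2 \<Longrightarrow> cnj_cf X \<in> L2"
  unfolding L2_def mem_Collect_eq by transfer simp

lemma H2_minus_subset_L2: "X \<in> H2_minus \<Longrightarrow> X \<in> L2"
  unfolding H2_minus_def
  by (elim imageE, hypsubst) (intro L2_mult unimodular_Linf unimodular_cnj unimodular_coord cnj_cf_L2 H2_subset_L2)

lemma H2_minus_abs:
  assumes "h \<in> borel_measurable circle"
  shows "cnj_cf coord_cf * cnj_cf (abs_circle_fun h) = abs_circle_fun (\<lambda>\<zeta>. cnj \<zeta> * cnj (h \<zeta>))"
proof -
  have "(\<lambda>\<zeta>. cnj (h \<zeta>)) \<in> borel_measurable circle" "(\<lambda>\<zeta>. cnj \<zeta>) \<in> borel_measurable circle"
    using assms by measurable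
  then show ?thesis
    using assms borel_measurable_circle_id by (simp add: coord_cf.abs_eq abs_circle_fun_simps)
qed

lemma H2_orthogonal_H2_minus:
  assumes "X \<in> H2" "Y \<in> H2_minus"
  shows "L2_inner X Y = 0"
proof -
  obtain F f where f: "F \<in> hardy_disk" "radial_boundary F f" "sq_integrable f" "X = abs_circle_fun f"
    using assms(1) by (rule H2_E)
  obtain Z where Z: "Z \<in> H2" "Y = cnj_cf coord_cf * cnj_cf Z" using assms(2) by (auto simp: H2_minus_def)
  obtain H h where h: "H \<in> hardy_disk" "radial_boundary H h" "sq_integrable h" "Z = abs_circle_fun h"
    using Z(1) by (rule H2_E)
  have hm: "h \<in> borel_measurable circle" by (rule sq_integrableD[OF h(3)])
  have m: "(\<lambda>\<zeta>. cnj \<zeta> * cnj (h \<zeta>)) \<in> borel_measurable circle" using hm by measurable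
  have "L2_inner X Y = (\<integral>\<zeta>. f \<zeta> * (\<zeta> * h \<zeta>) \<partial>circle)"
    unfolding Z(2) h(4) H2_minus_abs[OF hm] f(4) abs_circle_fun_simps[OF sq_integrableD[OF f(3)] m]
    by simp
  then show ?thesis using hardy_boundary_orthogonal[OF f(1-3) h(1-3)] by simp
qed

lemma L2_decomposition:
  assumes "X \<in> L2"
  obtains Y Z where "Y \<in> H2" "Z \<in> H2_minus" "X = Y + Z"
proof -
  obtain f where f: "sq_integrable f" "X = abs_circle_fun f" using assms by (rule L2_E)
  obtain F g H h where *: "F \<in> hardy_disk" "radial_boundary F g" "sq_integrable g"
    "H \<in> hardy_disk" "radial_boundary H h" "sq_integrable h"
    "AE \<zeta> in circle. f \<zeta> = g \<zeta> + cnj \<zeta> * cnj (h \<zeta>)"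
    using f(1) by (rule hardy_decomposition) (rule that)
  note m = *(3)[THEN sq_integrableD] *(6)[THEN sq_integrableD] f(1)[THEN sq_integrableD]
  have m': "(\<lambda>\<zeta>. cnj \<zeta> * cnj (h \<zeta>)) \<in> borel_measurable circle" using m(2) by measurable
  have m'': "(\<lambda>\<zeta>. g \<zeta> + cnj \<zeta> * cnj (h \<zeta>)) \<in> borel_measurable circle"
    using m(1) m' by (rule borel_measurable_add)
  show ?thesis
  proof (rule that)
    show "abs_circle_fun g \<in> H2" by (rule abs_circle_fun_in_H2[OF *(1-3)])
    show "cnj_cf coord_cf * cnj_cf (abs_circle_fun h) \<in> H2_minus"
      unfolding H2_minus_def by (intro imageI abs_circle_fun_in_H2[OF *(4-6)])
    show "X = abs_circle_fun g + cnj_cf coord_cf * cnj_cf (abs_circle_fun h)"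
      using *(7) by (simp add: f(2) H2_minus_abs m m' m'' abs_circle_fun_simps abs_circle_fun_eq_iff)
  qed
qed

text \<open>If \<open>X = Y + Z\<close> with \<open>Y\<close> in \<open>H\<^sup>2\<close> and \<open>Z\<close> in \<open>H\<^sup>2\<^sub>-\<close> is orthogonal to \<open>H\<^sup>2\<^sub>-\<close>, then so is \<open>Z\<close>, which is therefore 0.
  The linearity of \<open>H\<^sup>2\<close> is read off from this description.\<close>

lemma H2_iff: "X \<in> H2 \<longleftrightarrow> X \<in> L2 \<and> (\<forall>Y\<in>H2_minus. L2_inner X Y = 0)"
proof (intro iffI conjI ballI)
  assume X: "X \<in> L2 \<and> (\<forall>Y\<in>H2_minus. L2_inner X Y = 0)"
  obtain Y Z where YZ: "Y \<in> H2" "Z \<in> H2_minus" "X = Y + Z" using X L2_decomposition by blast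
  note l = H2_subset_L2[OF YZ(1)] H2_minus_subset_L2[OF YZ(2)]
  have "L2_inner Z Z = L2_inner X Z - L2_inner Y Z"
    using L2_inner_add_left[OF l l(2)] by (simp add: YZ(3))
  then have "Z = 0"
    using X YZ H2_orthogonal_H2_minus l by (intro L2_inner_eq_zero) auto
  then show "X \<in> H2" using YZ by simp
qed (auto simp: H2_subset_L2 H2_orthogonal_H2_minus)

lemma H2_add: "X \<in> H2 \<Longrightarrow> Y \<in> H2 \<Longrightarrow> X + Y \<in> H2"
  by (auto simp: H2_iff L2_add L2_inner_add_left H2_minus_subset_L2)

lemma H2_diff: "X \<in> H2 \<Longrightarrow> Y \<in> H2 \<Longrightarrow> X - Y \<in> H2"
  by (auto simp: H2_iff L2_diff L2_inner_diff_left H2_minus_subset_L2)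

lemma H2_const_mult: "X \<in> H2 \<Longrightarrow> const_cf c * X \<in> H2"
  by (auto simp: H2_iff L2_mult const_cf_Linf L2_inner_const_left)

lemma hardy_disk_mult_bounded:
  assumes T: "T holomorphic_on ball 0 1" "bounded (T ` ball 0 1)" and F: "F \<in> hardy_disk"
  shows "(\<lambda>z. T z * F z) \<in> hardy_disk"
proof -
  have hol: "F holomorphic_on ball 0 1" using F by (simp add: hardy_disk_def)
  obtain C where C: "\<And>r. 0 \<le> r \<Longrightarrow> r < 1 \<Longrightarrow> (\<integral>\<zeta>. (cmod (F (of_real r * \<zeta>)))\<^sup>2 \<partial>circle) \<le> C"
    using F by (force simp: hardy_disk_def)
  obtain B where B: "\<And>z. cmod z < 1 \<Longrightarrow> cmod (T z) \<le> B"
    using T(2) by (force simp: bounded_iff)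
  have hol': "(\<lambda>z. T z * F z) holomorphic_on ball 0 1"
    by (intro holomorphic_intros T hol)
  have "(\<integral>\<zeta>. (cmod (T (of_real r * \<zeta>) * F (of_real r * \<zeta>)))\<^sup>2 \<partial>circle) \<le> B\<^sup>2 * C" if r: "0 \<le> r" "r < 1" for r
  proof -
    have "(\<integral>\<zeta>. (cmod (T (of_real r * \<zeta>) * F (of_real r * \<zeta>)))\<^sup>2 \<partial>circle)
        \<le> (\<integral>\<zeta>. B\<^sup>2 * (cmod (F (of_real r * \<zeta>)))\<^sup>2 \<partial>circle)"
    proof (rule integral_mono)
      show "integrable circle (\<lambda>\<zeta>. (cmod (T (of_real r * \<zeta>) * F (of_real r * \<zeta>)))\<^sup>2)"
        using sq_integrable_dilate[OF hol' r] by (simp add: sq_integrable_def)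
      show "integrable circle (\<lambda>\<zeta>. B\<^sup>2 * (cmod (F (of_real r * \<zeta>)))\<^sup>2)"
        using sq_integrable_dilate[OF hol r] by (intro integrable_mult_right) (simp add: sq_integrable_def)
      fix \<zeta> assume "\<zeta> \<in> space circle"
      then have "cmod (of_real r * \<zeta>) < 1" using r by (simp add: norm_mult)
      then have "(cmod (T (of_real r * \<zeta>)))\<^sup>2 \<le> B\<^sup>2" by (intro power_mono B) auto
      then show "(cmod (T (of_real r * \<zeta>) * F (of_real r * \<zeta>)))\<^sup>2 \<le> B\<^sup>2 * (cmod (F (of_real r * \<zeta>)))\<^sup>2"
        by (simp add: norm_mult power_mult_distrib mult_right_mono)
    qed
    also have "\<dots> = B\<^sup>2 * (\<integral>\<zeta>. (cmod (F (of_real r * \<zeta>)))\<^sup>2 \<partial>circle)"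
      by (rule integral_mult_right_zero)
    also have "\<dots> \<le> B\<^sup>2 * C" by (intro mult_left_mono C r) simp
    finally show ?thesis .
  qed
  then show ?thesis
    unfolding hardy_disk_def by (intro CollectI conjI hol' exI[of _ "B\<^sup>2 * C"] ballI) simp
qed

text \<open>An inner function comes from a bounded holomorphic function, and multiplication by such functions
  preserves the Hardy class; radial limits multiply.\<close>

lemma inner_mult_H2:
  assumes \<theta>: "inner_function \<theta>" and X: "X \<in> H2"
  shows "\<theta> * X \<in> H2"
proof -
  obtain T where u: "unimodular \<theta>" and T: "T holomorphic_on ball 0 1" "bounded (T ` ball 0 1)" "boundary_fun T \<theta>"
    using \<theta> by (auto simp: inner_function_def)
  obtain t where t: "t \<in> borel_measurable circle" "\<theta> = abs_circle_fun t" by (rule circle_fun_exhaust)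
  obtain F f where f: "F \<in> hardy_disk" "radial_boundary F f" "sq_integrable f" "X = abs_circle_fun f"
    using X by (rule H2_E)
  have Tt: "radial_boundary T t"
    using T(3) t by (simp add: boundary_fun.abs_eq ae_eq_refl_iff radial_boundary_def)
  have fm: "f \<in> borel_measurable circle" by (rule sq_integrableD[OF f(3)])
  have eq: "\<theta> * X = abs_circle_fun (\<lambda>\<zeta>. t \<zeta> * f \<zeta>)"
    by (simp add: t f(4) abs_circle_fun_simps fm)
  have "\<theta> * X \<in> L2" by (intro L2_mult unimodular_Linf u H2_subset_L2 X)
  then have "abs_circle_fun (\<lambda>\<zeta>. t \<zeta> * f \<zeta>) \<in> L2"
    by (simp only: eq)
  then have "sq_integrable (\<lambda>\<zeta>. t \<zeta> * f \<zeta>)"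
    by (simp add: abs_circle_fun_in_L2 borel_measurable_times t fm)
  moreover have "radial_boundary (\<lambda>z. T z * F z) (\<lambda>\<zeta>. t \<zeta> * f \<zeta>)"
    using Tt f(2) unfolding radial_boundary_def by eventually_elim (rule tendsto_mult)
  ultimately show ?thesis
    unfolding eq by (intro abs_circle_fun_in_H2[OF hardy_disk_mult_bounded[OF T(1,2) f(1)]])
qed

section \<open>Model spaces and their projections\<close>

text \<open>Two candidates \<open>g\<close> and \<open>h\<close> differ by a vector \<open>(f - g) - (f - h)\<close> that is orthogonal to both of them, hence
  to itself.\<close>

lemma orth_proj_eqI:
  assumes V: "V \<subseteq> L2" and g: "g \<in> V" "f - g \<in> L2 \<ominus> V"
  shows "orth_proj V f = g"
  unfolding orth_proj_def
proof (rule the_equality)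
  show "g \<in> V \<and> f - g \<in> L2 \<ominus> V" using g by simp
  fix h assume h: "h \<in> V \<and> f - h \<in> L2 \<ominus> V"
  have l: "g \<in> L2" "h \<in> L2" "f - g \<in> L2" "f - h \<in> L2" "h - g \<in> L2"
    using V g h by (auto simp: orth_diff_def intro!: L2_diff)
  have "L2_inner (h - g) k = L2_inner (f - g) k - L2_inner (f - h) k" if "k \<in> L2" for k
    using L2_inner_diff_left[OF l(3,4) that] by simp
  then have "L2_inner (h - g) h = 0" "L2_inner (h - g) g = 0"
    using g h l by (auto simp: orth_diff_def)
  then have "L2_inner (h - g) (h - g) = 0"
    by (simp add: L2_inner_diff_right[OF l(2,1,5)])
  then have "h - g = 0" using l(5) by (intro L2_inner_eq_zero)
  then show "h = g" by simp
qed

lemma model_space_subset_L2: "model_space \<theta> \<subseteq> L2"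
  by (auto simp: model_space_def orth_diff_def H2_subset_L2)

lemma minus_plus_inner_in_model_perp:
  assumes \<theta>: "inner_function \<theta>" and "f \<in> H2_minus" "g \<in> H2"
  shows "f + \<theta> * g \<in> model_perp \<theta>"
proof -
  have l: "f \<in> L2" "\<theta> * g \<in> L2"
    using assms by (auto intro: H2_minus_subset_L2 H2_subset_L2 inner_mult_H2)
  have "L2_inner (f + \<theta> * g) k = 0" if k: "k \<in> model_space \<theta>" for k
  proof -
    have k': "k \<in> H2" "L2_inner k (\<theta> * g) = 0"
      using k assms(3) by (auto simp: model_space_def orth_diff_def)
    have "L2_inner k f = 0" by (rule H2_orthogonal_H2_minus[OF k'(1) assms(2)])
    then show ?thesis
      using L2_inner_add_left[OF l H2_subset_L2[OF k'(1)]] k'(2)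
      by (simp add: L2_inner_commute[of _ k])
  qed
  then show ?thesis using L2_add[OF l] by (simp add: model_perp_def orth_diff_def)
qed

text \<open>Write \<open>X = p + f\<close> with \<open>p\<close> in \<open>H\<^sup>2\<close> and \<open>f\<close> in \<open>H\<^sup>2\<^sub>-\<close>, and then \<open>cnj \<theta> p = g + m\<close> in the same way, so that
  \<open>X = \<theta> m + (f + \<theta> g)\<close>. The term \<open>\<theta> m = p - \<theta> g\<close> is in \<open>H\<^sup>2\<close>, and it is orthogonal to \<open>\<theta> H\<^sup>2\<close> because
  \<open>m\<close> is orthogonal to \<open>H\<^sup>2\<close> and \<open>\<theta>\<close> is unimodular.\<close>

lemma model_decomposition:
  assumes \<theta>: "inner_function \<theta>" and X: "X \<in> L2"
  obtains k f g where "k \<in> model_space \<theta>" "f \<in> H2_minus" "g \<in> H2" "X = k + (f + \<theta> * g)"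
proof -
  have u: "unimodular \<theta>" using \<theta> by (simp add: inner_function_def)
  obtain p f where p: "p \<in> H2" and f: "f \<in> H2_minus" and Xpf: "X = p + f"
    using X by (rule L2_decomposition)
  have "cnj_cf \<theta> * p \<in> L2" by (intro L2_mult unimodular_Linf unimodular_cnj u H2_subset_L2 p)
  then obtain g m where g: "g \<in> H2" and m: "m \<in> H2_minus" and gm: "cnj_cf \<theta> * p = g + m"
    by (rule L2_decomposition)
  have "p = \<theta> * cnj_cf \<theta> * p" by (simp add: unimodular_mult_cnj[OF u])
  also have "\<dots> = \<theta> * g + \<theta> * m" by (simp only: mult.assoc gm distrib_left)
  finally have pgm: "p = \<theta> * g + \<theta> * m" .
  have "\<theta> * m = p - \<theta> * g" using pgm by simp
  then have "\<theta> * m \<in> H2" using H2_diff[OF p inner_mult_H2[OF \<theta> g]] by simp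
  moreover have "L2_inner (\<theta> * m) (\<theta> * h) = 0" if h: "h \<in> H2" for h
  proof -
    have "L2_inner (\<theta> * m) (\<theta> * h) = L2_inner m (\<theta> * cnj_cf \<theta> * h)"
      by (simp add: L2_inner_mult_left mult_ac)
    also have "\<dots> = cnj (L2_inner h m)"
      by (simp add: unimodular_mult_cnj[OF u] L2_inner_commute[of m])
    finally show ?thesis using H2_orthogonal_H2_minus[OF h m] by simp
  qed
  ultimately have "\<theta> * m \<in> model_space \<theta>" by (auto simp: model_space_def orth_diff_def)
  then show ?thesis
    using f g by (rule that) (simp add: Xpf pgm algebra_simps)
qed

lemma P_proj_props:
  assumes \<theta>: "inner_function \<theta>" and X: "X \<in> L2"
  shows "P_proj \<theta> X \<in> model_space \<theta>" "X - P_proj \<theta> X \<in> model_perp \<theta>"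
proof -
  obtain k f g where k: "k \<in> model_space \<theta>" and fg: "f \<in> H2_minus" "g \<in> H2" and eq: "X = k + (f + \<theta> * g)"
    using \<theta> X by (rule model_decomposition)
  have perp: "X - k \<in> model_perp \<theta>"
    using minus_plus_inner_in_model_perp[OF \<theta> fg] by (simp add: eq)
  then have "P_proj \<theta> X = k"
    unfolding P_proj_def by (intro orth_proj_eqI model_space_subset_L2 k) (simp add: model_perp_def)
  with k perp show "P_proj \<theta> X \<in> model_space \<theta>" "X - P_proj \<theta> X \<in> model_perp \<theta>" by simp_all
qed

lemma model_perp_L2: "X \<in> model_perp \<theta> \<Longrightarrow> X \<in> L2"
  by (simp add: model_perp_def orth_diff_def)

lemma model_space_inter_perp:
  assumes "X \<in> model_space \<theta>" "X \<in> model_perp \<theta>"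
  shows "X = 0"
proof (rule L2_inner_eq_zero)
  show "X \<in> L2" by (rule model_perp_L2[OF assms(2)])
  show "L2_inner X X = 0" using assms by (simp add: model_perp_def orth_diff_def)
qed

lemma model_perp_add: "X \<in> model_perp \<theta> \<Longrightarrow> Y \<in> model_perp \<theta> \<Longrightarrow> X + Y \<in> model_perp \<theta>"
  using model_space_subset_L2[of \<theta>]
  by (auto simp: model_perp_def orth_diff_def L2_add L2_inner_add_left subset_iff)

lemma model_perp_diff: "X \<in> model_perp \<theta> \<Longrightarrow> Y \<in> model_perp \<theta> \<Longrightarrow> X - Y \<in> model_perp \<theta>"
  using model_space_subset_L2[of \<theta>]
  by (auto simp: model_perp_def orth_diff_def L2_diff L2_inner_diff_left subset_iff)

lemma model_perp_const: "X \<in> model_perp \<theta> \<Longrightarrow> const_cf c * X \<in> model_perp \<theta>"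
  by (auto simp: model_perp_def orth_diff_def L2_mult const_cf_Linf L2_inner_const_left)

lemma model_space_closed:
  assumes \<theta>: "inner_function \<theta>"
  shows "X \<in> model_space \<theta> \<Longrightarrow> Y \<in> model_space \<theta> \<Longrightarrow> X + Y \<in> model_space \<theta>"
    and "X \<in> model_space \<theta> \<Longrightarrow> const_cf c * X \<in> model_space \<theta>"
  by (auto simp: model_space_def orth_diff_def H2_add H2_const_mult L2_inner_add_left L2_inner_const_left
      H2_subset_L2 inner_mult_H2[OF \<theta>])

text \<open>In the general decomposition the component in the model space is also orthogonal to
  the model space.\<close>

lemma model_perp_decomposition:
  assumes \<theta>: "inner_function \<theta>" and X: "X \<in> model_perp \<theta>"
  obtains f g where "f \<in> H2_minus" "g \<in> H2" "X = f + \<theta> * g"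
proof -
  obtain k f g where k: "k \<in> model_space \<theta>" and fg: "f \<in> H2_minus" "g \<in> H2" and eq: "X = k + (f + \<theta> * g)"
    using \<theta> model_perp_L2[OF X] by (rule model_decomposition)
  have "k = X - (f + \<theta> * g)" using eq by simp
  then have "k \<in> model_perp \<theta>"
    using model_perp_diff[OF X minus_plus_inner_in_model_perp[OF \<theta> fg]] by simp
  then have "k = 0" using k by (intro model_space_inter_perp)
  with fg eq show ?thesis by (intro that) auto
qed

lemma P_proj_eq_zero_iff:
  assumes "inner_function \<theta>" "X \<in> L2"
  shows "P_proj \<theta> X = 0 \<longleftrightarrow> X \<in> model_perp \<theta>"
proof
  assume "P_proj \<theta> X = 0"
  then show "X \<in> model_perp \<theta>" using P_proj_props(2)[OF assms] by simp
next
  assume X: "X \<in> model_perp \<theta>"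
  have "P_proj \<theta> X = X - (X - P_proj \<theta> X)" by simp
  then have "P_proj \<theta> X \<in> model_perp \<theta>"
    using model_perp_diff[OF X P_proj_props(2)[OF assms]] by simp
  then show "P_proj \<theta> X = 0" using P_proj_props(1)[OF assms] by (intro model_space_inter_perp)
qed

lemma Q_proj_eq_zero_iff:
  assumes \<theta>: "inner_function \<theta>" and X: "X \<in> L2"
  shows "Q_proj \<theta> X = 0 \<longleftrightarrow> X \<in> model_space \<theta>"
proof
  assume "Q_proj \<theta> X = 0"
  then show "X \<in> model_space \<theta>" using P_proj_props(1)[OF assms] by (simp add: Q_proj_def)
next
  assume K: "X \<in> model_space \<theta>"
  have "0 \<in> L2" using L2_diff[OF X X] by simp
  moreover have "L2_inner 0 k = 0" if "k \<in> model_space \<theta>" for k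
    using L2_inner_diff_left[OF X X, of k] subsetD[OF model_space_subset_L2 that] by simp
  ultimately have "0 \<in> L2 \<ominus> model_space \<theta>"
    by (simp add: orth_diff_def)
  then have "P_proj \<theta> X = X"
    unfolding P_proj_def by (intro orth_proj_eqI model_space_subset_L2 K) simp
  then show "Q_proj \<theta> X = 0" by (simp add: Q_proj_def)
qed

section \<open>The isomorphism between the kernels\<close>

lemma inverse_Linf_props:
  assumes "invertible_Linf \<phi>"
  shows "inverse_Linf \<phi> \<in> Linf" "\<phi> * inverse_Linf \<phi> = 1"
proof -
  obtain \<psi> where \<psi>: "\<psi> \<in> Linf" "\<phi> * \<psi> = 1" using assms by (auto simp: invertible_Linf_def)
  have "inverse_Linf \<phi> = \<psi>"
    unfolding inverse_Linf_def
  proof (rule the_equality)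
    fix \<psi>' assume "\<psi>' \<in> Linf \<and> \<phi> * \<psi>' = 1"
    then have "\<psi>' = \<psi>' * (\<phi> * \<psi>)" "(\<phi> * \<psi>') * \<psi> = \<psi>" using \<psi> by simp_all
    then show "\<psi>' = \<psi>" by (simp add: mult_ac)
  qed (use \<psi> in simp)
  with \<psi> show "inverse_Linf \<phi> \<in> Linf" "\<phi> * inverse_Linf \<phi> = 1" by simp_all
qed

lemma ker_D_iff:
  assumes "inner_function \<alpha>" "\<phi> \<in> Linf"
  shows "f \<in> ker_D \<theta> \<alpha> \<phi> \<longleftrightarrow> f \<in> model_perp \<theta> \<and> \<phi> * f \<in> model_space \<alpha>"
  using Q_proj_eq_zero_iff[OF assms(1) L2_mult[OF assms(2) model_perp_L2, of f]]
  by (auto simp: ker_D_def dual_truncated_toeplitz_def)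

lemma ker_A_iff:
  assumes "inner_function \<theta>" "\<psi> \<in> Linf"
  shows "f \<in> ker_A \<alpha> \<theta> \<psi> \<longleftrightarrow> f \<in> model_space \<alpha> \<and> \<psi> * f \<in> model_perp \<theta>"
  using P_proj_eq_zero_iff[OF assms(1) L2_mult[OF assms(2) subsetD[OF model_space_subset_L2]], of f]
  by (auto simp: ker_A_def truncated_toeplitz_def)

text \<open>A decomposition of \<open>u\<close> exists, and the value \<open>\<phi> (f + \<theta> g) = \<phi> u\<close> does not depend on its choice.\<close>

lemma N_DA_eq:
  assumes "inner_function \<theta>" "u \<in> ker_D \<theta> \<alpha> \<phi>"
  shows "N_DA \<theta> \<alpha> \<phi> u = \<phi> * u"
proof -
  have "u \<in> model_perp \<theta>" using assms(2) by (simp add: ker_D_def)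
  then obtain f g where fg: "f \<in> H2_minus" "g \<in> H2" "u = f + \<theta> * g"
    using assms(1) model_perp_decomposition by blast
  have "(THE v. \<exists>f\<in>H2_minus. \<exists>g\<in>H2. u = f + \<theta> * g \<and> v = \<phi> * (f + \<theta> * g)) = \<phi> * u"
    by (rule the_equality) (use fg in auto)
  then show ?thesis using assms(2) by (simp add: N_DA_def)
qed

text \<open>On its domain the map is multiplication by \<open>\<phi>\<close>, and multiplication by the inverse \<open>\<psi>\<close> of \<open>\<phi>\<close> leads
  back. Both multipliers are bounded, which gives the two norm estimates.\<close>

theorem theorem6p6:
  fixes \<alpha> \<theta> \<phi> :: circle_fun
  assumes "inner_function \<alpha>" and "inner_function \<theta>" and "invertible_Linf \<phi>"
  shows "L2_isomorphism (ker_D \<theta> \<alpha> \<phi>) (ker_A \<alpha> \<theta> (inverse_Linf \<phi>)) (N_DA \<theta> \<alpha> \<phi>) \<and>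
    ker_D \<theta> \<alpha> \<phi> = (\<lambda>f. inverse_Linf \<phi> * f) ` ker_A \<alpha> \<theta> (inverse_Linf \<phi>)"
proof -
  define \<psi> where "\<psi> = inverse_Linf \<phi>"
  have \<psi>: "\<psi> \<in> Linf" "\<phi> * \<psi> = 1"
    unfolding \<psi>_def by (rule inverse_Linf_props[OF assms(3)])+
  have \<phi>: "\<phi> \<in> Linf" using assms(3) by (simp add: invertible_Linf_def)
  have inv: "\<psi> * (\<phi> * f) = f" "\<phi> * (\<psi> * f) = f" for f
  proof -
    show "\<phi> * (\<psi> * f) = f" using \<psi>(2) by (simp add: mult.assoc[symmetric])
    then show "\<psi> * (\<phi> * f) = f" by (simp add: mult.left_commute)
  qed
  define D A where "D = ker_D \<theta> \<alpha> \<phi>" and "A = ker_A \<alpha> \<theta> \<psi>"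
  have D: "f \<in> D \<longleftrightarrow> f \<in> model_perp \<theta> \<and> \<phi> * f \<in> model_space \<alpha>" for f
    unfolding D_def by (rule ker_D_iff[OF assms(1) \<phi>])
  have A: "f \<in> A \<longleftrightarrow> f \<in> model_space \<alpha> \<and> \<psi> * f \<in> model_perp \<theta>" for f
    unfolding A_def by (rule ker_A_iff[OF assms(2) \<psi>(1)])
  have DA: "\<phi> * f \<in> A" if "f \<in> D" for f using that by (simp add: A D inv)
  have AD: "\<psi> * f \<in> D" if "f \<in> A" for f using that by (simp add: A D inv)
  have DL: "f \<in> L2" if "f \<in> D" for f using that D model_perp_L2 by blast
  have N: "N_DA \<theta> \<alpha> \<phi> f = \<phi> * f" if "f \<in> D" for f
    using that unfolding D_def by (rule N_DA_eq[OF assms(2)])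
  have Dadd: "f + g \<in> D" if "f \<in> D" "g \<in> D" for f g
    using that by (simp add: D model_perp_add model_space_closed[OF assms(1)] distrib_left)
  have Dconst: "const_cf c * f \<in> D" if "f \<in> D" for c f
    using that by (simp add: D model_perp_const model_space_closed[OF assms(1)] mult.left_commute[of \<phi>])
  obtain C1 where C1: "\<And>f. f \<in> L2 \<Longrightarrow> L2_norm (\<phi> * f) \<le> C1 * L2_norm f"
    using L2_norm_mult_le[OF \<phi>] by blast
  obtain C2 where C2: "\<And>f. f \<in> L2 \<Longrightarrow> L2_norm (\<psi> * f) \<le> C2 * L2_norm f"
    using L2_norm_mult_le[OF \<psi>(1)] by blast
  have "L2_isomorphism D A (N_DA \<theta> \<alpha> \<phi>)"
    unfolding L2_isomorphism_def
  proof (intro conjI ballI allI)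
    show "N_DA \<theta> \<alpha> \<phi> (f + g) = N_DA \<theta> \<alpha> \<phi> f + N_DA \<theta> \<alpha> \<phi> g" if "f \<in> D" "g \<in> D" for f g
      using that by (simp add: N Dadd distrib_left)
    show "N_DA \<theta> \<alpha> \<phi> (const_cf c * f) = const_cf c * N_DA \<theta> \<alpha> \<phi> f" if "f \<in> D" for c f
      using that by (simp add: N Dconst mult.left_commute)
    show "bij_betw (N_DA \<theta> \<alpha> \<phi>) D A"
      by (rule bij_betw_byWitness[where f' = "\<lambda>f. \<psi> * f"]) (auto simp: N inv DA AD)
    show "\<exists>C. \<forall>f\<in>D. L2_norm (N_DA \<theta> \<alpha> \<phi> f) \<le> C * L2_norm f"
      using C1 by (intro exI[of _ C1]) (simp add: N DL)
    show "\<exists>C. \<forall>f\<in>D. L2_norm f \<le> C * L2_norm (N_DA \<theta> \<alpha> \<phi> f)"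
    proof (intro exI[of _ C2] ballI)
      fix f assume f: "f \<in> D"
      then have "L2_norm (\<psi> * (\<phi> * f)) \<le> C2 * L2_norm (\<phi> * f)"
        by (intro C2 L2_mult \<phi> DL)
      then show "L2_norm f \<le> C2 * L2_norm (N_DA \<theta> \<alpha> \<phi> f)"
        by (simp add: inv N f)
    qed
  qed
  moreover have "D = (\<lambda>f. \<psi> * f) ` A"
  proof (intro equalityI subsetI)
    fix f assume "f \<in> D"
    then show "f \<in> (\<lambda>f. \<psi> * f) ` A" by (intro image_eqI[of _ _ "\<phi> * f"]) (simp_all add: inv DA)
  qed (auto intro: AD)
  ultimately show ?thesis by (simp add: D_def A_def \<psi>_def)
qed

end
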